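(* Let $q\in\mathbb{C}\setminus\{0\}$ be not a root of unity. Let $\mathcal{S}$ be the set of all $U_q(\mathfrak{sl}_2)$-module algebra structures on the quantum plane $\mathbb{C}_q[x,y]$ such that $$(\mathsf{e}(x))_0=(\mathsf{e}(y))_0=(\mathsf{f}(x))_0=(\mathsf{f}(y))_0=0\quad\text{and}\quad(\mathsf{e}(x))_1=(\mathsf{e}(y))_1=(\mathsf{f}(x))_1=(\mathsf{f}(y))_1=0 .$$ Then $\mathcal{S}$ consists of exactly the 4 structures given by $$\mathsf{k}(x)=\pm x,\qquad \mathsf{k}(y)=\pm y,\qquad \mathsf{e}(x)=\mathsf{e}(y)=\mathsf{f}(x)=\mathsf{f}(y)=0$$ (the two signs being chosen independently), and these 4 structures are pairwise nonisomorphic.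
   Context: The quantum plane $\mathbb{C}_q[x,y]$ is the unital associative $\mathbb{C}$-algebra with generators $x,y$ and the single relation $yx=qxy$; the monomials $x^my^n$ ($m,n\ge 0$) form a basis. Its $i$-th homogeneous component is the linear span of the $x^my^n$ with $m+n=i$; for a polynomial $p$, $(p)_i$ denotes the projection of $p$ to the $i$-th homogeneous component (parallel to the other components). $U_q(\mathfrak{sl}_2)$ is the unital associative $\mathbb{C}$-algebra with generators $\mathsf{k},\mathsf{k}^{-1},\mathsf{e},\mathsf{f}$ and relations $\mathsf{k}^{-1}\mathsf{k}=\mathsf{k}\mathsf{k}^{-1}=\mathbf{1}$, $\mathsf{k}\mathsf{e}=q^2\mathsf{e}\mathsf{k}$, $\mathsf{k}\mathsf{f}=q^{-2}\mathsf{f}\mathsf{k}$, $\mathsf{e}\mathsf{f}-\mathsf{f}\mathsf{e}=\frac{\mathsf{k}-\mathsf{k}^{-1}}{q-q^{-1}}$, with Hopf algebra structure $\Delta(\mathsf{k})=\mathsf{k}\otimes\mathsf{k}$, $\Delta(\mathsf{e})=\mathbf{1}\otimes\mathsf{e}+\mathsf{e}\otimes\mathsf{k}$, $\Delta(\mathsf{f})=\mathsf{f}\otimes\mathbf{1}+\mathsf{k}^{-1}\otimes\mathsf{f}$, $\varepsilon(\mathsf{k})=1$, $\varepsilon(\mathsf{e})=\varepsilon(\mathsf{f})=0$, $S(\mathsf{k})=\mathsf{k}^{-1}$, $S(\mathsf{e})=-\mathsf{e}\mathsf{k}^{-1}$, $S(\mathsf{f})=-\mathsf{k}\mathsf{f}$.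 For a Hopf algebra $H$ and a unital algebra $A$, a structure of $H$-module algebra on $A$ is an algebra homomorphism $\pi:H\to\operatorname{End}_{\mathbb{C}}A$ such that $\pi(h)(ab)=\sum_i\pi(h_i')(a)\,\pi(h_i'')(b)$ (where $\Delta(h)=\sum_i h_i'\otimes h_i''$) and $\pi(h)(\mathbf{1})=\varepsilon(h)\mathbf{1}$ for all $h\in H$, $a,b\in A$. One writes $h(a)$ for $\pi(h)(a)$. A structure on $\mathbb{C}_q[x,y]$ is uniquely determined by the values of $\mathsf{k},\mathsf{e},\mathsf{f}$ on $x,y$. Structures $\pi_1,\pi_2$ are isomorphic if there is an algebra automorphism $\Psi$ of $A$ with $\Psi\pi_1(h)\Psi^{-1}=\pi_2(h)$ for all $h\in H$. *)

theory Defs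
  imports Complex_Main "HOL-Algebra.Module" "HOL-Algebra.QuotRing" "HOL-Library.Poly_Mapping"
begin

section \<open>Complex associative algebras\<close>

text \<open>
  Algebras over the complex numbers use the record \<open>module\<close>, which has both the ring
  operations and a scalar multiplication. The scalars are the type \<^typ>\<open>complex\<close>.
  Linear maps are kept \<open>extensional\<close>, so that two of them are equal as soon as they agree
  on the carrier, and sets of them can be counted.
\<close>

definition complex_alg :: "(complex, complex) module" where
  "complex_alg = \<lparr>carrier = UNIV, mult = (*), one = 1, zero = 0, add = (+), smult = (*)\<rparr>"

definition opposite_alg :: "(complex, 'a, 'm) module_scheme \<Rightarrow> (complex, 'a) module" where
  "opposite_alg A = \<lparr>carrier = carrier A, mult = (\<lambda>a b. b \<otimes>\<^bsub>A\<^esub> a), one = \<one>\<^bsub>A\<^esub>,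
     zero = \<zero>\<^bsub>A\<^esub>, add = add A, smult = smult A\<rparr>"

definition alg_hom ::
    "(complex, 'a, 'm) module_scheme \<Rightarrow> (complex, 'b, 'n) module_scheme \<Rightarrow> ('a \<Rightarrow> 'b) set" where
  "alg_hom A B = {\<phi> \<in> ring_hom A B \<inter> extensional (carrier A).
     \<forall>c. \<forall>a\<in>carrier A. \<phi> (c \<odot>\<^bsub>A\<^esub> a) = c \<odot>\<^bsub>B\<^esub> \<phi> a}"

definition alg_aut :: "(complex, 'a, 'm) module_scheme \<Rightarrow> ('a \<Rightarrow> 'a) set" where
  "alg_aut A = {\<Psi> \<in> alg_hom A A. bij_betw \<Psi> (carrier A) (carrier A)}"

definition End_alg :: "(complex, 'a, 'm) module_scheme \<Rightarrow> (complex, 'a \<Rightarrow> 'a) module" where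
  "End_alg A = \<lparr>
     carrier = {T \<in> carrier A \<rightarrow>\<^sub>E carrier A.
       (\<forall>a\<in>carrier A. \<forall>b\<in>carrier A. T (a \<oplus>\<^bsub>A\<^esub> b) = T a \<oplus>\<^bsub>A\<^esub> T b) \<and>
       (\<forall>c. \<forall>a\<in>carrier A. T (c \<odot>\<^bsub>A\<^esub> a) = c \<odot>\<^bsub>A\<^esub> T a)},
     mult = compose (carrier A),
     one = (\<lambda>a\<in>carrier A. a),
     zero = (\<lambda>a\<in>carrier A. \<zero>\<^bsub>A\<^esub>),
     add = (\<lambda>S T. \<lambda>a\<in>carrier A. S a \<oplus>\<^bsub>A\<^esub> T a),
     smult = (\<lambda>c T. \<lambda>a\<in>carrier A. c \<odot>\<^bsub>A\<^esub> T a)\<rparr>"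

inductive_set lin_span :: "(complex, 'a, 'm) module_scheme \<Rightarrow> 'a set \<Rightarrow> 'a set"
  for A :: "(complex, 'a, 'm) module_scheme" and S :: "'a set" where
  zero: "\<zero>\<^bsub>A\<^esub> \<in> lin_span A S"
| step: "\<lbrakk>v \<in> S; w \<in> lin_span A S\<rbrakk> \<Longrightarrow> c \<odot>\<^bsub>A\<^esub> v \<oplus>\<^bsub>A\<^esub> w \<in> lin_span A S"

text \<open>
  The ring structure is that of \<open>A Quot I\<close>. Adding \<open>I\<close> in the scalar multiplication
  matters only for \<open>c = 0\<close>, where the image of a coset is \<open>{\<zero>}\<close> instead of \<open>I\<close>.
\<close>

definition quot_alg ::
    "(complex, 'a, 'm) module_scheme \<Rightarrow> 'a set \<Rightarrow> (complex, 'a set) module" where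
  "quot_alg A I = \<lparr>carrier = carrier (A Quot I), mult = mult (A Quot I), one = one (A Quot I),
     zero = zero (A Quot I), add = add (A Quot I),
     smult = (\<lambda>c X. I <+>\<^bsub>A\<^esub> (\<lambda>a. c \<odot>\<^bsub>A\<^esub> a) ` X)\<rparr>"

text \<open>
  The monoid algebra of a monoid \<open>G\<close>: finitely supported functions on \<open>G\<close> with the
  convolution product.
\<close>

definition monoid_alg :: "('a, 'm) monoid_scheme \<Rightarrow> (complex, 'a \<Rightarrow>\<^sub>0 complex) module" where
  "monoid_alg G = \<lparr>carrier = {p. Poly_Mapping.keys p \<subseteq> carrier G},
     mult = (\<lambda>p r. \<Sum>u\<in>Poly_Mapping.keys p. \<Sum>v\<in>Poly_Mapping.keys r.
       Poly_Mapping.single (u \<otimes>\<^bsub>G\<^esub> v) (Poly_Mapping.lookup p u * Poly_Mapping.lookup r v)),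
     one = Poly_Mapping.single \<one>\<^bsub>G\<^esub> 1,
     zero = 0,
     add = (+),
     smult = (\<lambda>c. Poly_Mapping.map ((*) c))\<rparr>"


section \<open>Algebras given by generators and relations\<close>

definition free_alg :: "(complex, 'g list \<Rightarrow>\<^sub>0 complex) module" where
  "free_alg = monoid_alg \<lparr>carrier = UNIV, mult = (@), one = []\<rparr>"

text \<open>
  \<open>Idl\<close> is the two-sided ideal generated by a set. In \<open>R\<close>, an element \<open>p\<close> stands for the
  relation \<open>p = 0\<close>.
\<close>

definition presented_alg ::
    "('g list \<Rightarrow>\<^sub>0 complex) set \<Rightarrow> (complex, ('g list \<Rightarrow>\<^sub>0 complex) set) module" where
  "presented_alg R = quot_alg free_alg (Idl\<^bsub>free_alg\<^esub> R)"

definition alg_gen ::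
    "('g list \<Rightarrow>\<^sub>0 complex) set \<Rightarrow> 'g \<Rightarrow> ('g list \<Rightarrow>\<^sub>0 complex) set" where
  "alg_gen R g = Idl\<^bsub>free_alg\<^esub> R +>\<^bsub>free_alg\<^esub> Poly_Mapping.single [g] 1"


section \<open>Tensor products of algebras\<close>

text \<open>
  The space underlying \<open>monoid_alg (A \<times>\<times> B)\<close> is the free vector space on
  \<open>carrier A \<times> carrier B\<close>, and its product is \<open>(a, b) (a', b') = (a a', b b')\<close>.
  The tensor product is its quotient by the span of the bilinearity relations.
\<close>

definition bilinear_relations ::
    "(complex, 'a, 'm) module_scheme \<Rightarrow> (complex, 'b, 'n) module_scheme \<Rightarrow>
      ('a \<times> 'b \<Rightarrow>\<^sub>0 complex) set" where
  "bilinear_relations A B =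
     {Poly_Mapping.single (a \<oplus>\<^bsub>A\<^esub> a', b) 1
        - (Poly_Mapping.single (a, b) 1 + Poly_Mapping.single (a', b) 1) | a a' b.
        a \<in> carrier A \<and> a' \<in> carrier A \<and> b \<in> carrier B} \<union>
     {Poly_Mapping.single (a, b \<oplus>\<^bsub>B\<^esub> b') 1
        - (Poly_Mapping.single (a, b) 1 + Poly_Mapping.single (a, b') 1) | a b b'.
        a \<in> carrier A \<and> b \<in> carrier B \<and> b' \<in> carrier B} \<union>
     {Poly_Mapping.single (c \<odot>\<^bsub>A\<^esub> a, b) 1 - Poly_Mapping.single (a, b) c | c a b.
        a \<in> carrier A \<and> b \<in> carrier B} \<union>
     {Poly_Mapping.single (a, c \<odot>\<^bsub>B\<^esub> b) 1 - Poly_Mapping.single (a, b) c | c a b.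
        a \<in> carrier A \<and> b \<in> carrier B}"

definition tensor_null ::
    "(complex, 'a, 'm) module_scheme \<Rightarrow> (complex, 'b, 'n) module_scheme \<Rightarrow>
      ('a \<times> 'b \<Rightarrow>\<^sub>0 complex) set" where
  "tensor_null A B = lin_span (monoid_alg (A \<times>\<times> B)) (bilinear_relations A B)"

definition tensor_alg ::
    "(complex, 'a, 'm) module_scheme \<Rightarrow> (complex, 'b, 'n) module_scheme \<Rightarrow>
      (complex, ('a \<times> 'b \<Rightarrow>\<^sub>0 complex) set) module" where
  "tensor_alg A B = quot_alg (monoid_alg (A \<times>\<times> B)) (tensor_null A B)"

definition pure_tensor ::
    "(complex, 'a, 'm) module_scheme \<Rightarrow> (complex, 'b, 'n) module_scheme \<Rightarrow>
      'a \<Rightarrow> 'b \<Rightarrow> ('a \<times> 'b \<Rightarrow>\<^sub>0 complex) set" where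
  "pure_tensor A B a b =
     tensor_null A B +>\<^bsub>monoid_alg (A \<times>\<times> B)\<^esub> Poly_Mapping.single (a, b) 1"


section \<open>Module algebras over Hopf algebras\<close>

record 'h hopf_alg = "(complex, 'h) module" +
  comult :: "'h \<Rightarrow> ('h \<times> 'h \<Rightarrow>\<^sub>0 complex) set"
  counit :: "'h \<Rightarrow> complex"
  antipode :: "'h \<Rightarrow> 'h"

text \<open>
  The multiplicativity condition is imposed for every way of writing \<open>\<Delta>(h)\<close> as a finite
  sum of pure tensors.
\<close>

definition module_alg_structures ::
    "('h, 'm) hopf_alg_scheme \<Rightarrow> (complex, 'a, 'n) module_scheme \<Rightarrow> ('h \<Rightarrow> 'a \<Rightarrow> 'a) set" where
  "module_alg_structures H A = {\<pi> \<in> alg_hom H (End_alg A).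
     (\<forall>h\<in>carrier H. \<forall>a\<in>carrier A. \<forall>b\<in>carrier A.
       \<forall>(n::nat) h' h''. h' \<in> {..<n} \<rightarrow> carrier H \<and> h'' \<in> {..<n} \<rightarrow> carrier H \<and>
         comult H h = (\<Oplus>\<^bsub>tensor_alg H H\<^esub> i\<in>{..<n}. pure_tensor H H (h' i) (h'' i)) \<longrightarrow>
         \<pi> h (a \<otimes>\<^bsub>A\<^esub> b) = (\<Oplus>\<^bsub>A\<^esub> i\<in>{..<n}. \<pi> (h' i) a \<otimes>\<^bsub>A\<^esub> \<pi> (h'' i) b)) \<and>
     (\<forall>h\<in>carrier H. \<pi> h \<one>\<^bsub>A\<^esub> = counit H h \<odot>\<^bsub>A\<^esub> \<one>\<^bsub>A\<^esub>)}"

definition isomorphic_structures ::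
    "('h, 'm) hopf_alg_scheme \<Rightarrow> (complex, 'a, 'n) module_scheme \<Rightarrow>
      ('h \<Rightarrow> 'a \<Rightarrow> 'a) \<Rightarrow> ('h \<Rightarrow> 'a \<Rightarrow> 'a) \<Rightarrow> bool" where
  "isomorphic_structures H A \<pi>\<^sub>1 \<pi>\<^sub>2 \<longleftrightarrow>
     (\<exists>\<Psi>\<in>alg_aut A. \<forall>h\<in>carrier H. \<forall>a\<in>carrier A.
        \<Psi> (\<pi>\<^sub>1 h (inv_into (carrier A) \<Psi> a)) = \<pi>\<^sub>2 h a)"


section \<open>The quantum plane\<close>

datatype qp_gen = GX | GY

definition qp_relations :: "complex \<Rightarrow> (qp_gen list \<Rightarrow>\<^sub>0 complex) set" where
  "qp_relations q = {Poly_Mapping.single [GY, GX] 1 - Poly_Mapping.single [GX, GY] q}"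

type_synonym qplane = "(qp_gen list \<Rightarrow>\<^sub>0 complex) set"

definition quantum_plane :: "complex \<Rightarrow> (complex, qplane) module" where
  "quantum_plane q = presented_alg (qp_relations q)"

definition qp_x :: "complex \<Rightarrow> qplane" where "qp_x q = alg_gen (qp_relations q) GX"
definition qp_y :: "complex \<Rightarrow> qplane" where "qp_y q = alg_gen (qp_relations q) GY"

definition qp_monom :: "complex \<Rightarrow> nat \<Rightarrow> nat \<Rightarrow> qplane" where
  "qp_monom q m n =
     qp_x q [^]\<^bsub>quantum_plane q\<^esub> m \<otimes>\<^bsub>quantum_plane q\<^esub> qp_y q [^]\<^bsub>quantum_plane q\<^esub> n"

definition qp_homogeneous :: "complex \<Rightarrow> nat \<Rightarrow> qplane set" where
  "qp_homogeneous q i = lin_span (quantum_plane q) {qp_monom q m n | m n. m + n = i}"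

definition qp_proj :: "complex \<Rightarrow> nat \<Rightarrow> qplane \<Rightarrow> qplane" where
  "qp_proj q i p = (THE u. u \<in> qp_homogeneous q i \<and>
     p \<ominus>\<^bsub>quantum_plane q\<^esub> u \<in> lin_span (quantum_plane q) (\<Union>j\<in>-{i}. qp_homogeneous q j))"


section \<open>The quantum group \<open>U\<^sub>q(sl\<^sub>2)\<close>\<close>

datatype uq_gen = GK | GKinv | GE | GF

definition uq_relations :: "complex \<Rightarrow> (uq_gen list \<Rightarrow>\<^sub>0 complex) set" where
  "uq_relations q = {
     Poly_Mapping.single [GKinv, GK] 1 - Poly_Mapping.single [] 1,
     Poly_Mapping.single [GK, GKinv] 1 - Poly_Mapping.single [] 1,
     Poly_Mapping.single [GK, GE] 1 - Poly_Mapping.single [GE, GK] (q ^ 2),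
     Poly_Mapping.single [GK, GF] 1 - Poly_Mapping.single [GF, GK] (1 / q ^ 2),
     (Poly_Mapping.single [GE, GF] 1 - Poly_Mapping.single [GF, GE] 1)
       - (Poly_Mapping.single [GK] (1 / (q - 1 / q)) - Poly_Mapping.single [GKinv] (1 / (q - 1 / q)))}"

type_synonym uq = "(uq_gen list \<Rightarrow>\<^sub>0 complex) set"

definition uq_alg :: "complex \<Rightarrow> (complex, uq) module" where
  "uq_alg q = presented_alg (uq_relations q)"

definition uq_k :: "complex \<Rightarrow> uq" where "uq_k q = alg_gen (uq_relations q) GK"
definition uq_kinv :: "complex \<Rightarrow> uq" where "uq_kinv q = alg_gen (uq_relations q) GKinv"
definition uq_e :: "complex \<Rightarrow> uq" where "uq_e q = alg_gen (uq_relations q) GE"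
definition uq_f :: "complex \<Rightarrow> uq" where "uq_f q = alg_gen (uq_relations q) GF"

text \<open>
  The structure maps are the unique algebra homomorphisms (antihomomorphism, in the case of
  the antipode) with the given values on generators.
\<close>

definition uq_comult :: "complex \<Rightarrow> uq \<Rightarrow> (uq \<times> uq \<Rightarrow>\<^sub>0 complex) set" where
  "uq_comult q = (let U = uq_alg q; T = tensor_alg U U; t = pure_tensor U U;
       k = uq_k q; k' = uq_kinv q; e = uq_e q; f = uq_f q in
     (THE \<Delta>. \<Delta> \<in> alg_hom U T \<and>
        \<Delta> k = t k k \<and>
        \<Delta> e = t \<one>\<^bsub>U\<^esub> e \<oplus>\<^bsub>T\<^esub> t e k \<and>
        \<Delta> f = t f \<one>\<^bsub>U\<^esub> \<oplus>\<^bsub>T\<^esub> t k' f))"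

definition uq_counit :: "complex \<Rightarrow> uq \<Rightarrow> complex" where
  "uq_counit q = (THE \<epsilon>. \<epsilon> \<in> alg_hom (uq_alg q) complex_alg \<and>
     \<epsilon> (uq_k q) = 1 \<and> \<epsilon> (uq_e q) = 0 \<and> \<epsilon> (uq_f q) = 0)"

definition uq_antipode :: "complex \<Rightarrow> uq \<Rightarrow> uq" where
  "uq_antipode q = (let U = uq_alg q; k = uq_k q; k' = uq_kinv q; e = uq_e q; f = uq_f q in
     (THE S. S \<in> alg_hom U (opposite_alg U) \<and>
        S k = k' \<and>
        S e = \<ominus>\<^bsub>U\<^esub> (e \<otimes>\<^bsub>U\<^esub> k') \<and>
        S f = \<ominus>\<^bsub>U\<^esub> (k \<otimes>\<^bsub>U\<^esub> f)))"

definition Uq_sl2 :: "complex \<Rightarrow> uq hopf_alg" where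
  "Uq_sl2 q = \<lparr>carrier = carrier (uq_alg q), mult = mult (uq_alg q), one = one (uq_alg q),
     zero = zero (uq_alg q), add = add (uq_alg q), smult = smult (uq_alg q),
     comult = uq_comult q, counit = uq_counit q, antipode = uq_antipode q\<rparr>"


section \<open>Structures on the quantum plane\<close>

text \<open>
  The structures in which the homogeneous components of degree 0 and 1 of the values of
  \<open>e\<close> and \<open>f\<close> on \<open>x\<close> and \<open>y\<close> all vanish.
\<close>

definition zero_zero_structures :: "complex \<Rightarrow> (uq \<Rightarrow> qplane \<Rightarrow> qplane) set" where
  "zero_zero_structures q = {\<pi> \<in> module_alg_structures (Uq_sl2 q) (quantum_plane q).
     \<forall>i\<in>{0, 1}. \<forall>u\<in>{uq_e q, uq_f q}. \<forall>z\<in>{qp_x q, qp_y q}.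
       qp_proj q i (\<pi> u z) = \<zero>\<^bsub>quantum_plane q\<^esub>}"

definition diagonal_values ::
    "complex \<Rightarrow> complex \<Rightarrow> complex \<Rightarrow> (uq \<Rightarrow> qplane \<Rightarrow> qplane) \<Rightarrow> bool" where
  "diagonal_values q \<sigma> \<tau> \<pi> \<longleftrightarrow>
     \<pi> (uq_k q) (qp_x q) = \<sigma> \<odot>\<^bsub>quantum_plane q\<^esub> qp_x q \<and>
     \<pi> (uq_k q) (qp_y q) = \<tau> \<odot>\<^bsub>quantum_plane q\<^esub> qp_y q \<and>
     \<pi> (uq_e q) (qp_x q) = \<zero>\<^bsub>quantum_plane q\<^esub> \<and>
     \<pi> (uq_e q) (qp_y q) = \<zero>\<^bsub>quantum_plane q\<^esub> \<and>
     \<pi> (uq_f q) (qp_x q) = \<zero>\<^bsub>quantum_plane q\<^esub> \<and>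
     \<pi> (uq_f q) (qp_y q) = \<zero>\<^bsub>quantum_plane q\<^esub>"

end

theory Submission
  imports Defs "HOL-Library.Product_Plus"
begin

text \<open>
  Why there are only four structures. The element \<open>k\<close> acts by an algebra automorphism, and every
  automorphism of the quantum plane rescales the generators, so \<open>k(x) = \<alpha> x\<close> and
  \<open>k(y) = \<beta> y\<close> (\<open>qpoly_automorphism_diagonal\<close>). The elements without components in degrees 0
  and 1 form a two-sided ideal \<open>J\<close>. Since \<open>e\<close> and \<open>f\<close> are skew derivations that send both
  generators into \<open>J\<close>, they send the whole algebra into \<open>J\<close>. Hence so does \<open>ef - fe\<close>; but this
  operator multiplies \<open>x\<close> by \<open>(\<alpha> - 1/\<alpha>) / (q - 1/q)\<close>, and \<open>x\<close> is not in \<open>J\<close>. Therefore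
  \<open>\<alpha>\<^sup>2 = 1\<close>, and likewise \<open>\<beta>\<^sup>2 = 1\<close>. Now every monomial is an eigenvector of \<open>k\<close> with
  eigenvalue 1 or -1, whereas \<open>ke = q\<^sup>2 ek\<close> says that \<open>e(x)\<close> has eigenvalue \<open>q\<^sup>2 \<alpha>\<close>, whose square
  \<open>q\<^sup>4\<close> is not 1. So \<open>e(x) = 0\<close>, and \<open>e(y)\<close>, \<open>f(x)\<close>, \<open>f(y)\<close> vanish for the same reason
  (\<open>high_degree_action_trivial\<close>).

  Why automorphisms are diagonal. All commutators lie in the ideal generated by \<open>xy\<close>, and
  \<open>xy\<close> is itself a multiple of the commutator of \<open>y\<close> and \<open>x\<close>. An automorphism and its inverse
  therefore both send \<open>xy\<close> to a multiple of \<open>xy\<close>, and since the plane is a domain whose only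
  units are scalars, the images \<open>X\<close>, \<open>Y\<close> of \<open>x\<close>, \<open>y\<close> satisfy \<open>XY = c xy\<close>. If a product is a
  monomial, then its largest and its smallest exponent in the lexicographic order coincide, which
  forces both factors to be monomials (\<open>qmul_eq_monomial\<close>). Of the four ways to factor
  \<open>xy\<close>, only \<open>X = a x\<close>, \<open>Y = b y\<close> satisfies \<open>YX = q XY\<close>.

  Why the four structures exist and differ. On each of them \<open>k\<close> acts by an automorphism \<open>D\<close>
  with \<open>D\<^sup>2 = 1\<close>, and \<open>e\<close>, \<open>f\<close> act by 0, which respects the relations of the quantum group. The
  compatibility with the product need only be checked on \<open>k\<close>, \<open>e\<close> and \<open>f\<close>
  (\<open>module_alg_structures_Uq_iff\<close>). An isomorphism of structures is given by an automorphism;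
  this is diagonal, so it preserves the eigenvalues of \<open>k\<close> on \<open>x\<close> and \<open>y\<close>.

  Both algebras are given by generators and relations, and the comultiplication and the counit by
  unique choice among homomorphisms, so everything about them comes from universal properties: of
  presented algebras (\<open>presented_alg_hom_exists\<close>, \<open>presented_alg_hom_eqI\<close>) and of tensor
  products (\<open>tensor_lift\<close>). Arguments with exponents need a basis, which an isomorphism of the
  quantum plane with a twisted monoid algebra on pairs of exponents provides (\<open>coords_qp_elem\<close>,
  \<open>qp_elem_coords\<close>).
\<close>

abbreviation keys :: "('u \<Rightarrow>\<^sub>0 'c::zero) \<Rightarrow> 'u set" where "keys \<equiv> Poly_Mapping.keys"
abbreviation lookup :: "('u \<Rightarrow>\<^sub>0 'c::zero) \<Rightarrow> 'u \<Rightarrow> 'c" where "lookup \<equiv> Poly_Mapping.lookup"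
abbreviation single :: "'u \<Rightarrow> 'c \<Rightarrow> ('u \<Rightarrow>\<^sub>0 'c::zero)" where "single \<equiv> Poly_Mapping.single"
text \<open>
  A constant of its own for the scalar multiplication: the simplifier would otherwise reorder the
  factors of the product under \<open>Poly_Mapping.map\<close>.
\<close>

definition scale :: "complex \<Rightarrow> ('u \<Rightarrow>\<^sub>0 complex) \<Rightarrow> ('u \<Rightarrow>\<^sub>0 complex)" where
  "scale c = Poly_Mapping.map ((*) c)"

section \<open>Complex algebras\<close>

locale calg = ring A for A :: "(complex, 'a, 'm) module_scheme" (structure) +
  assumes smult_closed [simp, intro]: "a \<in> carrier A \<Longrightarrow> c \<odot> a \<in> carrier A"
    and smult_add: "a \<in> carrier A \<Longrightarrow> b \<in> carrier A \<Longrightarrow> c \<odot> (a \<oplus> b) = c \<odot> a \<oplus> c \<odot> b"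
    and add_smult: "a \<in> carrier A \<Longrightarrow> (c + d) \<odot> a = c \<odot> a \<oplus> d \<odot> a"
    and smult_smult: "a \<in> carrier A \<Longrightarrow> c \<odot> (d \<odot> a) = (c * d) \<odot> a"
    and one_smult [simp]: "a \<in> carrier A \<Longrightarrow> 1 \<odot> a = a"
    and smult_mult_left: "a \<in> carrier A \<Longrightarrow> b \<in> carrier A \<Longrightarrow> (c \<odot> a) \<otimes> b = c \<odot> (a \<otimes> b)"
    and smult_mult_right: "a \<in> carrier A \<Longrightarrow> b \<in> carrier A \<Longrightarrow> a \<otimes> (c \<odot> b) = c \<odot> (a \<otimes> b)"
begin

lemma zero_smult [simp]: "a \<in> carrier A \<Longrightarrow> 0 \<odot> a = \<zero>"
  using add_smult[of a 0 0] add.l_cancel_one[of "0 \<odot> a" "0 \<odot> a"] by simp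

lemma smult_zero [simp]: "c \<odot> \<zero> = \<zero>"
  using smult_smult[of \<zero> c 0] by simp

lemma uminus_eq_smult: "a \<in> carrier A \<Longrightarrow> \<ominus> a = (-1) \<odot> a"
  using add_smult[of a "-1" 1] by (intro minus_equality) auto

lemma minus_eq_smult: "a \<in> carrier A \<Longrightarrow> b \<in> carrier A \<Longrightarrow> a \<ominus> b = a \<oplus> (-1) \<odot> b"
  by (simp add: a_minus_def uminus_eq_smult)

lemma minus_eq_zero_iff:
  assumes "a \<in> carrier A" "b \<in> carrier A"
  shows "a \<ominus> b = \<zero> \<longleftrightarrow> a = b"
  using assms minus_equality[of a "\<ominus> b"] by (auto simp: a_minus_def r_neg)

lemma smult_minus:
  "a \<in> carrier A \<Longrightarrow> b \<in> carrier A \<Longrightarrow> c \<odot> (a \<ominus> b) = c \<odot> a \<ominus> c \<odot> b"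
  by (simp add: minus_eq_smult smult_add smult_smult mult.commute)

lemma smult_cancel:
  assumes "a \<in> carrier A" "c \<odot> a = \<zero>" "c \<noteq> 0"
  shows "a = \<zero>"
proof -
  have "a = (inverse c * c) \<odot> a" using assms by simp
  also have "\<dots> = inverse c \<odot> (c \<odot> a)" using assms smult_smult by metis
  finally show ?thesis using assms by simp
qed

lemma smult_inj:
  assumes "a \<in> carrier A" "a \<noteq> \<zero>" "c \<odot> a = d \<odot> a"
  shows "c = d"
proof (rule ccontr)
  assume "c \<noteq> d"
  have "(c - d) \<odot> a = c \<odot> a \<oplus> (-1) \<odot> (d \<odot> a)"
    using assms(1) add_smult[of a c "- d"] by (simp add: smult_smult)
  also have "\<dots> = (1 + (-1)) \<odot> (d \<odot> a)"
    using assms by (simp only: add_smult smult_closed one_smult)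
  also have "\<dots> = \<zero>" using assms(1) by simp
  finally show False using smult_cancel[OF assms(1), of "c - d"] assms(2) \<open>c \<noteq> d\<close> by auto
qed

lemma finsum_smult:
  assumes "f \<in> S \<rightarrow> carrier A"
  shows "c \<odot> (\<Oplus>i\<in>S. f i) = (\<Oplus>i\<in>S. c \<odot> f i)"
  using assms
proof (induction S rule: infinite_finite_induct)
  case (insert i S)
  then have "f i \<in> carrier A" "f \<in> S \<rightarrow> carrier A" by auto
  with insert show ?case by (simp add: smult_add Pi_def)
qed auto

end


section \<open>Linear extension from a basis\<close>

lemma lookup_scale [simp]:
  fixes c :: complex
  shows "lookup (scale c p) u = c * lookup p u"
  by (simp add: scale_def Poly_Mapping.map.rep_eq when_def)

lemma scale_single [simp]:
  fixes c :: complex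
  shows "scale c (single u d) = single u (c * d)"
  by (rule poly_mapping_eqI) (simp add: lookup_single when_def)

lemma keys_scale: "keys (scale c p) \<subseteq> keys p"
  by (auto simp: in_keys_iff)

lemma scale_minus_one: "scale (-1) p = - p"
  by (rule poly_mapping_eqI) simp

lemma poly_mapping_induct_on [consumes 1, case_names zero add]:
  fixes p :: "'u \<Rightarrow>\<^sub>0 'c::ab_group_add"
  assumes "keys p \<subseteq> C" and "P 0"
    and step: "\<And>u c p. u \<in> C \<Longrightarrow> keys p \<subseteq> C \<Longrightarrow> P p \<Longrightarrow> P (single u c + p)"
  shows "P p"
  using assms(1)
proof (induction "card (keys p)" arbitrary: p)
  case 0
  then have "p = 0" by (simp add: keys_eq_empty)
  with assms(2) show ?case by simp
next
  case (Suc n)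
  then obtain u where u: "u \<in> keys p" by fastforce
  define r where "r = p - single u (lookup p u)"
  have keys: "keys r = keys p - {u}"
    by (auto simp: r_def in_keys_iff lookup_minus lookup_single when_def split: if_splits)
  then have "P r" using Suc u by (intro Suc.hyps) auto
  then have "P (single u (lookup p u) + r)"
    using Suc u keys by (intro step) auto
  then show ?case by (simp add: r_def)
qed

lemma poly_mapping_induct [case_names zero add]:
  fixes p :: "'u \<Rightarrow>\<^sub>0 'c::ab_group_add"
  assumes "P 0" and "\<And>u c p. P p \<Longrightarrow> P (single u c + p)"
  shows "P p"
  using subset_UNIV assms by (rule poly_mapping_induct_on)

definition lin_ext :: "(complex, 'b, 'm) module_scheme \<Rightarrow> ('u \<Rightarrow> 'b) \<Rightarrow> ('u \<Rightarrow>\<^sub>0 complex) \<Rightarrow> 'b" where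
  "lin_ext B \<phi> p = (\<Oplus>\<^bsub>B\<^esub> u\<in>keys p. lookup p u \<odot>\<^bsub>B\<^esub> \<phi> u)"

context calg
begin

lemma lin_ext_closed:
  assumes "\<phi> \<in> C \<rightarrow> carrier A" "keys p \<subseteq> C"
  shows "lin_ext A \<phi> p \<in> carrier A"
  unfolding lin_ext_def using assms by (intro finsum_closed) auto

lemma lin_ext_superset:
  assumes "\<phi> \<in> S \<rightarrow> carrier A" "keys p \<subseteq> S" "finite S"
  shows "lin_ext A \<phi> p = (\<Oplus>u\<in>S. lookup p u \<odot> \<phi> u)"
  unfolding lin_ext_def using assms
  by (intro add.finprod_mono_neutral_cong_left) (auto simp: in_keys_iff Pi_iff)

lemma lin_ext_zero [simp]: "lin_ext A \<phi> 0 = \<zero>"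
  by (simp add: lin_ext_def)

lemma lin_ext_single [simp]:
  assumes "\<phi> u \<in> carrier A"
  shows "lin_ext A \<phi> (single u c) = c \<odot> \<phi> u"
  using assms by (subst lin_ext_superset[where S = "{u}"]) auto

lemma lin_ext_add:
  assumes "\<phi> \<in> C \<rightarrow> carrier A" "keys p \<subseteq> C" "keys r \<subseteq> C"
  shows "lin_ext A \<phi> (p + r) = lin_ext A \<phi> p \<oplus> lin_ext A \<phi> r"
proof -
  let ?S = "keys p \<union> keys r"
  have \<phi>: "\<phi> \<in> ?S \<rightarrow> carrier A" using assms by auto
  show ?thesis
    using \<phi> keys_add[of p r]
    by (simp add: lin_ext_superset[where S = ?S] lookup_add Pi_iff)
      (subst finsum_addf[symmetric], auto simp: add_smult Pi_iff simp del: finsum_addf intro!: finsum_cong')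
qed

lemma lin_ext_scale:
  assumes "\<phi> \<in> C \<rightarrow> carrier A" "keys p \<subseteq> C"
  shows "lin_ext A \<phi> (scale c p) = c \<odot> lin_ext A \<phi> p"
proof -
  have \<phi>: "\<phi> \<in> keys p \<rightarrow> carrier A" using assms by auto
  show ?thesis
    unfolding lin_ext_superset[OF \<phi> keys_scale finite_keys]
      lin_ext_superset[OF \<phi> order_refl finite_keys]
    using \<phi> by (subst finsum_smult) (auto simp: smult_smult Pi_def intro!: finsum_cong')
qed

lemma lin_ext_diff:
  assumes "\<phi> \<in> C \<rightarrow> carrier A" "keys p \<subseteq> C" "keys r \<subseteq> C"
  shows "lin_ext A \<phi> (p - r) = lin_ext A \<phi> p \<ominus> lin_ext A \<phi> r"
proof -
  have eq: "p - r = p + scale (-1) r" by (simp add: scale_minus_one)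
  show ?thesis
    unfolding eq
    using lin_ext_add[OF assms(1,2), of "scale (-1) r"] keys_scale[of "-1" r]
      lin_ext_scale[OF assms(1,3)] lin_ext_closed[OF assms(1)] assms
    by (simp add: minus_eq_smult)
qed

end


section \<open>Twisted monoid algebras\<close>

text \<open>
  The free algebra, the product algebra underlying a tensor square and the coordinate model of the
  quantum plane are all spanned by a monoid whose product is multiplied by a scalar \<open>\<gamma> u v\<close>. Treating
  them together requires associativity to be proved only once.
\<close>

definition tw_mult ::
    "('u \<Rightarrow> 'u \<Rightarrow> 'u) \<Rightarrow> ('u \<Rightarrow> 'u \<Rightarrow> complex) \<Rightarrow>
      ('u \<Rightarrow>\<^sub>0 complex) \<Rightarrow> ('u \<Rightarrow>\<^sub>0 complex) \<Rightarrow> ('u \<Rightarrow>\<^sub>0 complex)" where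
  "tw_mult op \<gamma> p r = (\<Sum>u\<in>keys p. \<Sum>v\<in>keys r.
     single (op u v) (\<gamma> u v * (lookup p u * lookup r v)))"

lemma tw_mult_superset:
  assumes "keys p \<subseteq> S" "keys r \<subseteq> T" "finite S" "finite T"
  shows "tw_mult op \<gamma> p r =
    (\<Sum>u\<in>S. \<Sum>v\<in>T. single (op u v) (\<gamma> u v * (lookup p u * lookup r v)))"
proof -
  have "(\<Sum>v\<in>keys r. single (op u v) (\<gamma> u v * (lookup p u * lookup r v))) =
    (\<Sum>v\<in>T. single (op u v) (\<gamma> u v * (lookup p u * lookup r v)))" for u
    using assms by (intro sum.mono_neutral_left) (auto simp: in_keys_iff)
  then show ?thesis
    unfolding tw_mult_def using assms
    by (simp, intro sum.mono_neutral_left) (auto simp: in_keys_iff intro!: sum.neutral)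
qed

lemma tw_mult_single [simp]:
  "tw_mult op \<gamma> (single u a) (single v b) =
    single (op u v) (\<gamma> u v * (a * b))"
  by (subst tw_mult_superset[where S = "{u}" and T = "{v}"]) auto

lemma tw_mult_add_left: "tw_mult op \<gamma> (p + p') r = tw_mult op \<gamma> p r + tw_mult op \<gamma> p' r"
proof -
  let ?S = "keys p \<union> keys p'" and ?T = "keys r"
  show ?thesis
    using keys_add[of p p']
    by (simp add: tw_mult_superset[where S = ?S and T = ?T] lookup_add algebra_simps
        single_add sum.distrib)
qed

lemma tw_mult_add_right: "tw_mult op \<gamma> p (r + r') = tw_mult op \<gamma> p r + tw_mult op \<gamma> p r'"
proof -
  let ?S = "keys p" and ?T = "keys r \<union> keys r'"
  show ?thesis
    using keys_add[of r r']
    by (simp add: tw_mult_superset[where S = ?S and T = ?T] lookup_add algebra_simps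
        single_add sum.distrib)
qed

lemma tw_mult_zero [simp]: "tw_mult op \<gamma> 0 r = 0" "tw_mult op \<gamma> p 0 = 0"
  by (simp_all add: tw_mult_def)

lemma scale_add:
  "scale c (p + r) = scale c p + scale c r"
  by (rule poly_mapping_eqI) (simp add: lookup_add algebra_simps)

lemma scale_zero [simp]: "scale c 0 = 0"
  by (rule poly_mapping_eqI) simp

lemma tw_mult_scale_left:
  "tw_mult op \<gamma> (scale c p) r = scale c (tw_mult op \<gamma> p r)"
proof (induction p rule: poly_mapping_induct)
  case (add u d p)
  have "tw_mult op \<gamma> (single u (c * d)) r =
    scale c (tw_mult op \<gamma> (single u d) r)"
    by (induction r rule: poly_mapping_induct)
      (simp_all add: tw_mult_add_right scale_add mult_ac)
  with add show ?case by (simp add: tw_mult_add_left scale_add)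
qed simp

lemma tw_mult_scale_right:
  "tw_mult op \<gamma> p (scale c r) = scale c (tw_mult op \<gamma> p r)"
proof (induction p rule: poly_mapping_induct)
  case (add u d p)
  have "tw_mult op \<gamma> (single u d) (scale c r) =
    scale c (tw_mult op \<gamma> (single u d) r)"
    by (induction r rule: poly_mapping_induct)
      (simp_all add: tw_mult_add_right scale_add mult_ac)
  with add show ?case by (simp add: tw_mult_add_left scale_add)
qed simp

lemma tw_mult_diff:
  "tw_mult op \<gamma> p (r - r') = tw_mult op \<gamma> p r - tw_mult op \<gamma> p r'"
  "tw_mult op \<gamma> (p - p') r = tw_mult op \<gamma> p r - tw_mult op \<gamma> p' r"
  using tw_mult_add_right[of op \<gamma> p "r - r'" r'] tw_mult_add_left[of op \<gamma> "p - p'" p' r]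
  by (simp_all add: algebra_simps)

lemma keys_tw_mult:
  "keys (tw_mult op \<gamma> p r) \<subseteq>
    {op u v | u v. u \<in> keys p \<and> v \<in> keys r}"
proof
  fix w assume "w \<in> keys (tw_mult op \<gamma> p r)"
  then have "(\<Sum>u\<in>keys p. \<Sum>v\<in>keys r.
      lookup (single (op u v) (\<gamma> u v * (lookup p u * lookup r v))) w) \<noteq> 0"
    by (simp add: in_keys_iff tw_mult_def lookup_sum)
  then obtain u v where "u \<in> keys p" "v \<in> keys r"
    "lookup (single (op u v) (\<gamma> u v * (lookup p u * lookup r v))) w \<noteq> 0"
    by (meson sum.not_neutral_contains_not_neutral)
  then show "w \<in> {op u v | u v. u \<in> keys p \<and> v \<in> keys r}"
    by (auto simp: lookup_single when_def split: if_splits)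
qed

definition twisted_alg ::
    "('u, 'm) monoid_scheme \<Rightarrow> ('u \<Rightarrow> 'u \<Rightarrow> complex) \<Rightarrow> (complex, 'u \<Rightarrow>\<^sub>0 complex) module" where
  "twisted_alg G \<gamma> = \<lparr>carrier = {p. keys p \<subseteq> carrier G},
     mult = tw_mult (mult G) \<gamma>, one = single \<one>\<^bsub>G\<^esub> 1, zero = 0, add = (+),
     smult = scale\<rparr>"

lemma monoid_alg_eq_twisted_alg: "monoid_alg G = twisted_alg G (\<lambda>_ _. 1)"
  by (simp add: monoid_alg_def twisted_alg_def tw_mult_def scale_def fun_eq_iff)

text \<open>
  The cocycle condition is exactly associativity on basis elements.
\<close>

locale two_cocycle = monoid G for G :: "('u, 'm) monoid_scheme" (structure) +
  fixes \<gamma> :: "'u \<Rightarrow> 'u \<Rightarrow> complex"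
  assumes cocycle: "\<lbrakk>u \<in> carrier G; v \<in> carrier G; w \<in> carrier G\<rbrakk> \<Longrightarrow>
      \<gamma> u v * \<gamma> (u \<otimes> v) w = \<gamma> v w * \<gamma> u (v \<otimes> w)"
    and cocycle_one: "u \<in> carrier G \<Longrightarrow> \<gamma> \<one> u = 1" "u \<in> carrier G \<Longrightarrow> \<gamma> u \<one> = 1"
begin

lemma tw_mult_assoc:
  assumes "keys p \<subseteq> carrier G" "keys r \<subseteq> carrier G"
    "keys s \<subseteq> carrier G"
  shows "tw_mult (\<otimes>) \<gamma> (tw_mult (\<otimes>) \<gamma> p r) s = tw_mult (\<otimes>) \<gamma> p (tw_mult (\<otimes>) \<gamma> r s)"
  using assms(1)
proof (induction p rule: poly_mapping_induct_on)
  case (add u a p)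
  have "tw_mult (\<otimes>) \<gamma> (tw_mult (\<otimes>) \<gamma> (single u a) r) s =
    tw_mult (\<otimes>) \<gamma> (single u a) (tw_mult (\<otimes>) \<gamma> r s)"
    using assms(2)
  proof (induction r rule: poly_mapping_induct_on)
    case v: (add v b r)
    have "tw_mult (\<otimes>) \<gamma> (tw_mult (\<otimes>) \<gamma> (single u a) (single v b)) s =
      tw_mult (\<otimes>) \<gamma> (single u a) (tw_mult (\<otimes>) \<gamma> (single v b) s)"
      using assms(3)
    proof (induction s rule: poly_mapping_induct_on)
      case w: (add w c s)
      have "\<gamma> (u \<otimes> v) w * (\<gamma> u v * (a * b) * c) = (\<gamma> u v * \<gamma> (u \<otimes> v) w) * (a * b * c)"
        by (simp add: algebra_simps)
      also have "\<dots> = \<gamma> u (v \<otimes> w) * (a * (\<gamma> v w * (b * c)))"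
        using add.hyps(1) v.hyps(1) w.hyps(1) by (simp add: cocycle algebra_simps)
      finally show ?case
        using w add.hyps(1) v.hyps(1)
        by (simp only: tw_mult_add_right tw_mult_single m_assoc)
    qed simp
    with v show ?case by (simp add: tw_mult_add_left tw_mult_add_right)
  qed simp
  with add show ?case by (simp add: tw_mult_add_left)
qed simp

lemma tw_mult_one:
  assumes "keys p \<subseteq> carrier G"
  shows "tw_mult (\<otimes>) \<gamma> (single \<one> 1) p = p"
    and "tw_mult (\<otimes>) \<gamma> p (single \<one> 1) = p"
  using assms by (induction p rule: poly_mapping_induct_on)
    (simp_all add: tw_mult_add_left tw_mult_add_right cocycle_one)

lemma tw_mult_keys_closed:
  assumes "keys p \<subseteq> carrier G" "keys r \<subseteq> carrier G"
  shows "keys (tw_mult (\<otimes>) \<gamma> p r) \<subseteq> carrier G"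
  using keys_tw_mult[of "(\<otimes>)" \<gamma> p r] assms by auto

theorem twisted_alg_calg: "calg (twisted_alg G \<gamma>)"
proof -
  let ?A = "twisted_alg G \<gamma>"
  have "abelian_group ?A"
  proof (rule abelian_groupI)
    fix p assume p: "p \<in> carrier ?A"
    have "keys (- p) \<subseteq> carrier G" using p by (auto simp: twisted_alg_def in_keys_iff)
    then show "\<exists>r\<in>carrier ?A. r \<oplus>\<^bsub>?A\<^esub> p = \<zero>\<^bsub>?A\<^esub>"
      by (intro bexI[of _ "- p"]) (auto simp: twisted_alg_def)
  next
    fix p r assume "p \<in> carrier ?A" "r \<in> carrier ?A"
    then show "p \<oplus>\<^bsub>?A\<^esub> r \<in> carrier ?A"
      using keys_add[of p r] by (auto simp: twisted_alg_def)
  qed (auto simp: twisted_alg_def algebra_simps)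
  moreover have "Group.monoid ?A"
    by (rule monoidI) (auto simp: twisted_alg_def tw_mult_assoc tw_mult_one dest: tw_mult_keys_closed[THEN subsetD, rotated -1])
  ultimately have "ring ?A"
    by (rule ringI) (simp_all add: twisted_alg_def tw_mult_add_left tw_mult_add_right)
  moreover have "calg_axioms ?A"
  proof
    show "c \<odot>\<^bsub>?A\<^esub> a \<in> carrier ?A" if "a \<in> carrier ?A" for a c
      using that keys_scale[of c a] by (auto simp: twisted_alg_def)
  qed (auto simp: twisted_alg_def tw_mult_scale_left tw_mult_scale_right lookup_add algebra_simps
      intro: poly_mapping_eqI)
  ultimately show ?thesis by (rule calg.intro)
qed

end

text \<open>
  A linear map out of a twisted monoid algebra is multiplicative as soon as it is so on basis
  elements, where the cocycle appears as a scalar. With a trivial cocycle this gives the evaluation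
  of noncommutative polynomials, with a power of \<open>q\<close> the map from coefficients to the quantum plane.
\<close>

lemma (in calg) lin_ext_tw_mult:
  assumes \<phi>: "\<phi> \<in> C \<rightarrow> carrier A"
    and mult: "\<And>u v. u \<in> C \<Longrightarrow> v \<in> C \<Longrightarrow> op u v \<in> C \<and> \<phi> u \<otimes> \<phi> v = \<gamma> u v \<odot> \<phi> (op u v)"
    and p: "keys p \<subseteq> C" and r: "keys r \<subseteq> C"
  shows "lin_ext A \<phi> (tw_mult op \<gamma> p r) = lin_ext A \<phi> p \<otimes> lin_ext A \<phi> r"
proof -
  have keys: "keys (tw_mult op \<gamma> p r) \<subseteq> C"
    if "keys p \<subseteq> C" "keys r \<subseteq> C" for p r
    using keys_tw_mult[of op \<gamma> p r] mult that by blast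
  have \<phi>C: "\<phi> u \<in> carrier A" if "u \<in> C" for u using \<phi> that by auto
  note lin = lin_ext_add[OF \<phi>] lin_ext_closed[OF \<phi>]
  show ?thesis
    using p
  proof (induction p rule: poly_mapping_induct_on)
    case zero
    show ?case using lin_ext_closed[OF \<phi> r] by simp
  next
    case (add u a p)
    have u: "keys (single u a) \<subseteq> C" using add.hyps by simp
    have "lin_ext A \<phi> (tw_mult op \<gamma> (single u a) r) =
      lin_ext A \<phi> (single u a) \<otimes> lin_ext A \<phi> r"
      using r
    proof (induction r rule: poly_mapping_induct_on)
      case zero
      show ?case using lin_ext_closed[OF \<phi> u] by simp
    next
      case v: (add v b r)
      have vk: "keys (single v b) \<subseteq> C" using v.hyps by simp
      have "lin_ext A \<phi> (tw_mult op \<gamma> (single u a) (single v b)) =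
        lin_ext A \<phi> (single u a) \<otimes> lin_ext A \<phi> (single v b)"
        using mult[OF add.hyps(1) v.hyps(1)] \<phi>C add.hyps(1) v.hyps(1)
        by (simp add: smult_mult_left smult_mult_right smult_smult mult_ac)
      then show ?case
        using v.IH lin(1)[OF keys[OF u vk] keys[OF u v.hyps(2)]] lin(1)[OF vk v.hyps(2)]
          lin(2)[OF u] lin(2)[OF vk] lin(2)[OF v.hyps(2)]
        by (simp only: tw_mult_add_right r_distr)
    qed
    then show ?case
      using add.IH lin(1)[OF keys[OF u r] keys[OF add.hyps(2) r]] lin(1)[OF u add.hyps(2)]
        lin(2)[OF u] lin(2)[OF r] lin(2)[OF add.hyps(2)]
      by (simp only: tw_mult_add_left l_distr)
  qed
qed

lemma monoid_alg_calg:
  assumes "Group.monoid G"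
  shows "calg (monoid_alg G)"
proof -
  interpret two_cocycle G "\<lambda>_ _. 1"
    using assms by (simp add: two_cocycle_def two_cocycle_axioms_def)
  show ?thesis unfolding monoid_alg_eq_twisted_alg by (rule twisted_alg_calg)
qed


section \<open>Linear maps and algebra homomorphisms\<close>

definition lin_map ::
    "(complex, 'a, 'm) module_scheme \<Rightarrow> (complex, 'b, 'n) module_scheme \<Rightarrow> ('a \<Rightarrow> 'b) \<Rightarrow> bool" where
  "lin_map A B \<phi> \<longleftrightarrow> \<phi> \<in> carrier A \<rightarrow> carrier B \<and>
     (\<forall>a\<in>carrier A. \<forall>b\<in>carrier A. \<phi> (a \<oplus>\<^bsub>A\<^esub> b) = \<phi> a \<oplus>\<^bsub>B\<^esub> \<phi> b) \<and>
     (\<forall>c. \<forall>a\<in>carrier A. \<phi> (c \<odot>\<^bsub>A\<^esub> a) = c \<odot>\<^bsub>B\<^esub> \<phi> a)"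

lemma lin_mapD:
  assumes "lin_map A B \<phi>"
  shows "a \<in> carrier A \<Longrightarrow> \<phi> a \<in> carrier B"
    and "a \<in> carrier A \<Longrightarrow> b \<in> carrier A \<Longrightarrow> \<phi> (a \<oplus>\<^bsub>A\<^esub> b) = \<phi> a \<oplus>\<^bsub>B\<^esub> \<phi> b"
    and "a \<in> carrier A \<Longrightarrow> \<phi> (c \<odot>\<^bsub>A\<^esub> a) = c \<odot>\<^bsub>B\<^esub> \<phi> a"
  using assms by (auto simp: lin_map_def)

lemma lin_map_zero:
  assumes "lin_map A B \<phi>" "calg A" "calg B"
  shows "\<phi> \<zero>\<^bsub>A\<^esub> = \<zero>\<^bsub>B\<^esub>"
proof -
  interpret A: calg A by fact
  interpret B: calg B by fact
  show ?thesis
    using lin_mapD(1,3)[OF assms(1), of "\<zero>\<^bsub>A\<^esub>"] by (metis A.smult_zero A.zero_closed B.zero_smult)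
qed

lemma lin_map_minus:
  assumes "lin_map A B \<phi>" "calg A" "calg B" "a \<in> carrier A" "b \<in> carrier A"
  shows "\<phi> (a \<ominus>\<^bsub>A\<^esub> b) = \<phi> a \<ominus>\<^bsub>B\<^esub> \<phi> b"
proof -
  interpret A: calg A by fact
  interpret B: calg B by fact
  show ?thesis
    using assms(4,5) by (simp add: A.minus_eq_smult B.minus_eq_smult lin_mapD[OF assms(1)])
qed

lemma lin_map_finsum:
  assumes "lin_map A B \<phi>" "calg A" "calg B" "f \<in> S \<rightarrow> carrier A"
  shows "\<phi> (\<Oplus>\<^bsub>A\<^esub> i\<in>S. f i) = (\<Oplus>\<^bsub>B\<^esub> i\<in>S. \<phi> (f i))"
proof -
  interpret A: calg A by fact
  interpret B: calg B by fact
  show ?thesis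
    using assms(4)
    by (induction S rule: infinite_finite_induct)
      (simp_all add: lin_map_zero[OF assms(1-3)] lin_mapD[OF assms(1)] Pi_iff)
qed

lemma alg_hom_iff:
  "\<phi> \<in> alg_hom A B \<longleftrightarrow> lin_map A B \<phi> \<and> \<phi> \<in> extensional (carrier A) \<and> \<phi> \<one>\<^bsub>A\<^esub> = \<one>\<^bsub>B\<^esub> \<and>
     (\<forall>a\<in>carrier A. \<forall>b\<in>carrier A. \<phi> (a \<otimes>\<^bsub>A\<^esub> b) = \<phi> a \<otimes>\<^bsub>B\<^esub> \<phi> b)"
  by (auto simp: alg_hom_def lin_map_def ring_hom_def)

lemma alg_homD:
  assumes "\<phi> \<in> alg_hom A B"
  shows "lin_map A B \<phi>"
    and "\<phi> \<one>\<^bsub>A\<^esub> = \<one>\<^bsub>B\<^esub>"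
    and "a \<in> carrier A \<Longrightarrow> b \<in> carrier A \<Longrightarrow> \<phi> (a \<otimes>\<^bsub>A\<^esub> b) = \<phi> a \<otimes>\<^bsub>B\<^esub> \<phi> b"
  using assms by (auto simp: alg_hom_iff)


section \<open>Quotient algebras\<close>

context calg
begin

lemma ideal_smult:
  assumes "ideal I A" "i \<in> I"
  shows "c \<odot> i \<in> I"
proof -
  interpret I: ideal I A by fact
  have "c \<odot> i = (c \<odot> \<one>) \<otimes> i" using I.Icarr[OF assms(2)] by (simp add: smult_mult_left)
  then show ?thesis using I.I_l_closed[OF assms(2), of "c \<odot> \<one>"] by simp
qed

lemma quot_carrier: "carrier (quot_alg A I) = (\<lambda>a. I +> a) ` carrier A"
  by (auto simp: quot_alg_def FactRing_def A_RCOSETS_def')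

lemma quot_closed: "a \<in> carrier A \<Longrightarrow> I +> a \<in> carrier (quot_alg A I)"
  by (simp add: quot_carrier)

text \<open>
  For scalar multiples, the inclusion of the left side in the right side needs that \<open>I\<close> is closed
  under scalar multiplication, which holds because \<open>A\<close> has a unit.
\<close>

lemma quot_ops:
  assumes "ideal I A"
  shows "\<one>\<^bsub>quot_alg A I\<^esub> = I +> \<one>" and "\<zero>\<^bsub>quot_alg A I\<^esub> = I +> \<zero>"
    and "a \<in> carrier A \<Longrightarrow> b \<in> carrier A \<Longrightarrow> (I +> a) \<otimes>\<^bsub>quot_alg A I\<^esub> (I +> b) = I +> (a \<otimes> b)"
    and "a \<in> carrier A \<Longrightarrow> b \<in> carrier A \<Longrightarrow> (I +> a) \<oplus>\<^bsub>quot_alg A I\<^esub> (I +> b) = I +> (a \<oplus> b)"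
    and "a \<in> carrier A \<Longrightarrow> c \<odot>\<^bsub>quot_alg A I\<^esub> (I +> a) = I +> (c \<odot> a)"
proof -
  interpret I: ideal I A by fact
  show "\<one>\<^bsub>quot_alg A I\<^esub> = I +> \<one>" by (simp add: quot_alg_def FactRing_def)
  show "\<zero>\<^bsub>quot_alg A I\<^esub> = I +> \<zero>"
    using I.a_subset by (simp add: quot_alg_def FactRing_def)
  show "(I +> a) \<otimes>\<^bsub>quot_alg A I\<^esub> (I +> b) = I +> (a \<otimes> b)"
    if "a \<in> carrier A" "b \<in> carrier A"
    using that I.rcoset_mult_add by (simp add: quot_alg_def FactRing_def)
  show "(I +> a) \<oplus>\<^bsub>quot_alg A I\<^esub> (I +> b) = I +> (a \<oplus> b)"
    if "a \<in> carrier A" "b \<in> carrier A"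
    using that I.a_rcos_sum by (simp add: quot_alg_def FactRing_def)
  show "c \<odot>\<^bsub>quot_alg A I\<^esub> (I +> a) = I +> (c \<odot> a)" if a: "a \<in> carrier A"
  proof -
    have "h \<oplus> c \<odot> (h' \<oplus> a) \<in> I +> c \<odot> a" if h: "h \<in> I" "h' \<in> I" for h h'
    proof -
      have "h \<oplus> c \<odot> (h' \<oplus> a) = (h \<oplus> c \<odot> h') \<oplus> c \<odot> a"
        using a h I.Icarr by (simp add: smult_add a_assoc)
      moreover have "h \<oplus> c \<odot> h' \<in> I" using h ideal_smult[OF assms] by simp
      ultimately show ?thesis using a I.a_subset a_rcosI by simp
    qed
    then have "I <+> (\<lambda>a. c \<odot> a) ` (I +> a) \<subseteq> I +> c \<odot> a"
      unfolding set_add_def' a_r_coset_def'[of A I a] by blast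
    moreover have "h \<oplus> c \<odot> a \<in> I <+> (\<lambda>a. c \<odot> a) ` (I +> a)" if "h \<in> I" for h
      unfolding set_add_def' using that I.a_rcos_self[OF a] by blast
    then have "I +> c \<odot> a \<subseteq> I <+> (\<lambda>a. c \<odot> a) ` (I +> a)"
      unfolding a_r_coset_def'[of A I "c \<odot> a"] by blast
    ultimately show ?thesis by (simp add: quot_alg_def)
  qed
qed

theorem quot_calg:
  assumes "ideal I A"
  shows "calg (quot_alg A I)"
proof -
  let ?Q = "quot_alg A I"
  note ops = quot_ops[OF assms]
  have rep: "\<exists>a\<in>carrier A. X = I +> a" if "X \<in> carrier ?Q" for X
    using that by (auto simp: quot_carrier)
  note simps = ops quot_closed
  have "abelian_group ?Q"
  proof (rule abelian_groupI)
    fix X assume "X \<in> carrier ?Q"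
    then obtain a where a: "a \<in> carrier A" "X = I +> a" using rep by blast
    show "\<exists>Y\<in>carrier ?Q. Y \<oplus>\<^bsub>?Q\<^esub> X = \<zero>\<^bsub>?Q\<^esub>"
      using a by (intro bexI[of _ "I +> (\<ominus> a)"]) (simp_all add: simps l_neg)
  qed (auto simp: simps a_ac dest!: rep)
  moreover have "Group.monoid ?Q"
    by (rule monoidI) (auto simp: simps m_assoc dest!: rep)
  ultimately have "ring ?Q"
    by (rule ringI) (auto simp: simps l_distr r_distr dest!: rep)
  moreover have "calg_axioms ?Q"
    by unfold_locales (auto simp: simps smult_add add_smult smult_smult smult_mult_left
        smult_mult_right dest!: rep)
  ultimately show ?thesis by (rule calg.intro)
qed

lemma coset_eq_zero_iff:
  assumes "ideal I A" "a \<in> carrier A"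
  shows "I +> a = \<zero>\<^bsub>quot_alg A I\<^esub> \<longleftrightarrow> a \<in> I"
  using quotient_eq_iff_same_a_r_cos[OF assms(1,2) zero_closed] assms(2)
  by (simp add: quot_ops[OF assms(1)] a_minus_def)

end

text \<open>
  The choice of the representative is immaterial when \<open>\<phi>\<close> is constant on the cosets of \<open>I\<close>.
\<close>

definition quot_lift ::
    "(complex, 'a, 'm) module_scheme \<Rightarrow> 'a set \<Rightarrow> ('a \<Rightarrow> 'b) \<Rightarrow> 'a set \<Rightarrow> 'b" where
  "quot_lift A I \<phi> = (\<lambda>X\<in>carrier (quot_alg A I). \<phi> (SOME a. a \<in> carrier A \<and> X = I +>\<^bsub>A\<^esub> a))"

lemma quot_lift:
  assumes "calg A" "calg B" "ideal I A" and \<phi>: "lin_map A B \<phi>"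
    and ker: "\<And>i. i \<in> I \<Longrightarrow> \<phi> i = \<zero>\<^bsub>B\<^esub>"
  shows "a \<in> carrier A \<Longrightarrow> quot_lift A I \<phi> (I +>\<^bsub>A\<^esub> a) = \<phi> a"
    and "lin_map (quot_alg A I) B (quot_lift A I \<phi>)"
    and "quot_lift A I \<phi> \<in> extensional (carrier (quot_alg A I))"
proof -
  interpret A: calg A by fact
  interpret B: calg B by fact
  interpret I: ideal I A by fact
  show coset: "quot_lift A I \<phi> (I +>\<^bsub>A\<^esub> a) = \<phi> a" if a: "a \<in> carrier A" for a
  proof -
    define b where "b = (SOME b. b \<in> carrier A \<and> I +>\<^bsub>A\<^esub> a = I +>\<^bsub>A\<^esub> b)"
    have b: "b \<in> carrier A \<and> I +>\<^bsub>A\<^esub> a = I +>\<^bsub>A\<^esub> b"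
      unfolding b_def by (rule someI[of _ a]) (use a in simp)
    then have "a \<ominus>\<^bsub>A\<^esub> b \<in> I"
      using A.quotient_eq_iff_same_a_r_cos[OF assms(3) a] by blast
    then have "\<phi> a \<ominus>\<^bsub>B\<^esub> \<phi> b = \<zero>\<^bsub>B\<^esub>"
      using ker lin_map_minus[OF \<phi> assms(1,2) a] b by metis
    then have "\<phi> a = \<phi> b"
      using a b lin_mapD(1)[OF \<phi>] B.minus_eq_zero_iff by blast
    then show ?thesis using A.quot_closed[OF a] by (simp add: quot_lift_def b_def)
  qed
  show "lin_map (quot_alg A I) B (quot_lift A I \<phi>)"
    by (auto simp: lin_map_def A.quot_carrier A.quot_ops[OF assms(3)] coset lin_mapD[OF \<phi>])
  show "quot_lift A I \<phi> \<in> extensional (carrier (quot_alg A I))"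
    by (simp add: quot_lift_def)
qed


section \<open>Algebras given by generators and relations\<close>

definition word_eval :: "(complex, 'b, 'm) module_scheme \<Rightarrow> ('g \<Rightarrow> 'b) \<Rightarrow> 'g list \<Rightarrow> 'b" where
  "word_eval B g w = foldr (\<lambda>x b. g x \<otimes>\<^bsub>B\<^esub> b) w \<one>\<^bsub>B\<^esub>"

abbreviation free_eval ::
    "(complex, 'b, 'm) module_scheme \<Rightarrow> ('g \<Rightarrow> 'b) \<Rightarrow> ('g list \<Rightarrow>\<^sub>0 complex) \<Rightarrow> 'b" where
  "free_eval B g \<equiv> lin_ext B (word_eval B g)"

lemma word_eval_simps [simp]:
  "word_eval B g [] = \<one>\<^bsub>B\<^esub>" "word_eval B g (x # w) = g x \<otimes>\<^bsub>B\<^esub> word_eval B g w"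
  by (simp_all add: word_eval_def)

lemma free_alg_calg: "calg (free_alg :: (complex, 'g list \<Rightarrow>\<^sub>0 complex) module)"
  unfolding free_alg_def by (rule monoid_alg_calg) (simp add: monoid_def)

lemma free_alg_simps [simp]:
  "carrier free_alg = UNIV" "mult free_alg = tw_mult (@) (\<lambda>_ _. 1)" "one free_alg = single [] 1"
  "zero free_alg = 0" "add free_alg = (+)" "smult free_alg = scale"
  by (simp_all add: free_alg_def monoid_alg_eq_twisted_alg twisted_alg_def)

context calg
begin

lemma word_eval_closed [simp]:
  assumes "\<And>x. g x \<in> carrier A"
  shows "word_eval A g w \<in> carrier A"
  by (induction w) (use assms in simp_all)

lemma word_eval_append:
  assumes "\<And>x. g x \<in> carrier A"
  shows "word_eval A g (v @ w) = word_eval A g v \<otimes> word_eval A g w"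
  by (induction v) (use assms in \<open>simp_all add: m_assoc\<close>)

lemma free_eval_hom:
  assumes "\<And>x. g x \<in> carrier A"
  shows "lin_map free_alg A (free_eval A g)"
    and "free_eval A g (tw_mult (@) (\<lambda>_ _. 1) p r) = free_eval A g p \<otimes> free_eval A g r"
    and "free_eval A g (p - r) = free_eval A g p \<ominus> free_eval A g r"
proof -
  have w: "word_eval A g \<in> UNIV \<rightarrow> carrier A" using assms by simp
  show "lin_map free_alg A (free_eval A g)"
    using lin_ext_closed[OF w subset_UNIV] lin_ext_add[OF w subset_UNIV subset_UNIV]
      lin_ext_scale[OF w subset_UNIV] by (simp add: lin_map_def)
  show "free_eval A g (tw_mult (@) (\<lambda>_ _. 1) p r) = free_eval A g p \<otimes> free_eval A g r"
    by (rule lin_ext_tw_mult[OF w _ subset_UNIV subset_UNIV])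
      (use assms in \<open>simp add: word_eval_append\<close>)
  show "free_eval A g (p - r) = free_eval A g p \<ominus> free_eval A g r"
    by (rule lin_ext_diff[OF w subset_UNIV subset_UNIV])
qed

end

context
  fixes R :: "('g list \<Rightarrow>\<^sub>0 complex) set"
begin

interpretation F: calg "free_alg :: (complex, 'g list \<Rightarrow>\<^sub>0 complex) module"
  by (rule free_alg_calg)

lemma Idl_ideal: "ideal (Idl\<^bsub>free_alg\<^esub> R) free_alg"
  by (rule F.genideal_ideal) simp

theorem presented_alg_calg: "calg (presented_alg R)"
  unfolding presented_alg_def by (rule F.quot_calg[OF Idl_ideal])

interpretation P: calg "presented_alg R" by (rule presented_alg_calg)

lemma alg_gen_closed [simp]: "alg_gen R x \<in> carrier (presented_alg R)"
  by (simp add: alg_gen_def presented_alg_def F.quot_closed)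

text \<open>
  The projection from the free algebra is itself evaluation at the generators. This turns
  statements about cosets into statements about noncommutative polynomials in the generators.
\<close>

lemma coset_eq_free_eval: "Idl\<^bsub>free_alg\<^esub> R +>\<^bsub>free_alg\<^esub> p = free_eval (presented_alg R) (alg_gen R) p"
proof -
  let ?c = "\<lambda>p. Idl\<^bsub>free_alg\<^esub> R +>\<^bsub>free_alg\<^esub> p"
  note ops = F.quot_ops[OF Idl_ideal, folded presented_alg_def, simplified]
  note lin = lin_mapD(2,3)[OF P.free_eval_hom(1)[OF alg_gen_closed], simplified]
  have word: "?c (single w 1) = word_eval (presented_alg R) (alg_gen R) w" for w
  proof (induction w)
    case Nil
    show ?case using ops(1) by simp
  next
    case (Cons x w)
    have "?c (single (x # w) 1) = ?c (single [x] 1) \<otimes>\<^bsub>presented_alg R\<^esub> ?c (single w 1)"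
      by (subst ops(3)) simp
    with Cons show ?case by (simp add: alg_gen_def)
  qed
  show ?thesis
  proof (induction p rule: poly_mapping_induct)
    case zero
    show ?case using ops(2) by simp
  next
    case (add w a p)
    have "?c (single w a) = a \<odot>\<^bsub>presented_alg R\<^esub> ?c (single w 1)"
      by (subst ops(5)) simp
    then have "?c (single w a) = free_eval (presented_alg R) (alg_gen R) (single w a)"
      by (simp add: word)
    then show ?case using add ops(4)[of "single w a" p] by (simp add: lin(1))
  qed
qed

lemma presented_alg_carrier:
  "carrier (presented_alg R) = range (free_eval (presented_alg R) (alg_gen R))"
  by (auto simp: presented_alg_def F.quot_carrier coset_eq_free_eval[unfolded presented_alg_def])

lemma presented_alg_relation:
  assumes "r \<in> R"
  shows "free_eval (presented_alg R) (alg_gen R) r = \<zero>\<^bsub>presented_alg R\<^esub>"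
  using F.coset_eq_zero_iff[OF Idl_ideal] F.genideal_self[of R] assms
  by (auto simp: presented_alg_def coset_eq_free_eval[unfolded presented_alg_def])

theorem presented_alg_induct [consumes 1, case_names one gen add smult mult]:
  assumes "a \<in> carrier (presented_alg R)"
    and "P \<one>\<^bsub>presented_alg R\<^esub>" and gen: "\<And>x. P (alg_gen R x)"
    and add: "\<And>a b. a \<in> carrier (presented_alg R) \<Longrightarrow> b \<in> carrier (presented_alg R) \<Longrightarrow>
      P a \<Longrightarrow> P b \<Longrightarrow> P (a \<oplus>\<^bsub>presented_alg R\<^esub> b)"
    and smult: "\<And>c a. a \<in> carrier (presented_alg R) \<Longrightarrow> P a \<Longrightarrow> P (c \<odot>\<^bsub>presented_alg R\<^esub> a)"
    and mult: "\<And>a b. a \<in> carrier (presented_alg R) \<Longrightarrow> b \<in> carrier (presented_alg R) \<Longrightarrow>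
      P a \<Longrightarrow> P b \<Longrightarrow> P (a \<otimes>\<^bsub>presented_alg R\<^esub> b)"
  shows "P a"
proof -
  note lin = lin_mapD[OF P.free_eval_hom(1)[OF alg_gen_closed], simplified]
  have word: "P (word_eval (presented_alg R) (alg_gen R) w)" for w
    by (induction w) (simp_all add: assms(2) gen mult)
  have "P (free_eval (presented_alg R) (alg_gen R) p)" for p
  proof (induction p rule: poly_mapping_induct)
    case zero
    show ?case using smult[of "\<one>\<^bsub>presented_alg R\<^esub>" 0] assms(2) by simp
  next
    case (add w c p)
    have w: "word_eval (presented_alg R) (alg_gen R) w \<in> carrier (presented_alg R)" by simp
    show ?case
      using assms(4)[OF P.smult_closed[OF w] lin(1) smult[OF w word] add.IH, of c]
      by (simp add: lin(2))
  qed
  then show ?thesis using assms(1) presented_alg_carrier by auto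
qed

text \<open>
  The kernel of an evaluation homomorphism is an ideal; if it contains the relations, it contains
  the ideal that they generate, and the evaluation descends to the quotient.
\<close>

theorem presented_alg_hom_exists:
  assumes B: "calg B" and g: "\<And>x. g x \<in> carrier B"
    and rel: "\<And>r. r \<in> R \<Longrightarrow> free_eval B g r = \<zero>\<^bsub>B\<^esub>"
  shows "\<exists>\<phi>\<in>alg_hom (presented_alg R) B. \<forall>x. \<phi> (alg_gen R x) = g x"
proof -
  interpret B: calg B by fact
  let ?e = "free_eval B g" and ?I = "Idl\<^bsub>free_alg\<^esub> R"
  note hom = B.free_eval_hom[OF g]
  have "ring_hom_ring free_alg B ?e"
    using hom(2) lin_mapD[OF hom(1)]
    by (intro ring_hom_ringI F.ring_axioms B.ring_axioms) (auto simp: g)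
  then interpret e: ring_hom_ring free_alg B ?e .
  have "?I \<subseteq> a_kernel free_alg B ?e"
    using rel unfolding a_kernel_def'
    by (intro F.genideal_minimal e.kernel_is_ideal[unfolded a_kernel_def'] subsetI CollectI conjI)
      simp_all
  then have ker: "?e p = \<zero>\<^bsub>B\<^esub>" if "p \<in> ?I" for p
    using that unfolding a_kernel_def' by blast
  define \<phi> where "\<phi> = quot_lift free_alg ?I ?e"
  note lift = quot_lift[OF free_alg_calg B Idl_ideal hom(1) ker, folded \<phi>_def presented_alg_def]
  note ops = F.quot_ops[OF Idl_ideal, folded presented_alg_def, simplified]
  have rep: "\<exists>p. X = ?I +>\<^bsub>free_alg\<^esub> p" if "X \<in> carrier (presented_alg R)" for X
    using that by (auto simp: presented_alg_def F.quot_carrier)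
  have "\<phi> \<one>\<^bsub>presented_alg R\<^esub> = \<one>\<^bsub>B\<^esub>"
    using lift(1)[of "single [] 1"] ops(1) by simp
  moreover have "\<phi> (X \<otimes>\<^bsub>presented_alg R\<^esub> Y) = \<phi> X \<otimes>\<^bsub>B\<^esub> \<phi> Y"
    if "X \<in> carrier (presented_alg R)" "Y \<in> carrier (presented_alg R)" for X Y
  proof -
    obtain p r where "X = ?I +>\<^bsub>free_alg\<^esub> p" "Y = ?I +>\<^bsub>free_alg\<^esub> r"
      using rep \<open>X \<in> _\<close> \<open>Y \<in> _\<close> by metis
    then show ?thesis using lift(1) hom(2) ops(3) by simp
  qed
  ultimately have "\<phi> \<in> alg_hom (presented_alg R) B"
    using lift(2,3) by (simp add: alg_hom_iff)
  moreover have "\<phi> (alg_gen R x) = g x" for x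
    using lift(1)[of "single [x] 1"] g by (simp add: alg_gen_def)
  ultimately show ?thesis by blast
qed

theorem presented_alg_hom_eqI:
  assumes "\<phi> \<in> alg_hom (presented_alg R) B" "\<psi> \<in> alg_hom (presented_alg R) B"
    and "\<And>x. \<phi> (alg_gen R x) = \<psi> (alg_gen R x)"
  shows "\<phi> = \<psi>"
proof (rule extensionalityI)
  show "\<phi> \<in> extensional (carrier (presented_alg R))" "\<psi> \<in> extensional (carrier (presented_alg R))"
    using assms(1,2) by (simp_all add: alg_hom_iff)
  show "\<phi> a = \<psi> a" if "a \<in> carrier (presented_alg R)" for a
    using that
  proof (induction rule: presented_alg_induct)
  qed (simp_all add: assms(3) alg_homD(2,3)[OF assms(1)] alg_homD(2,3)[OF assms(2)]
      lin_mapD[OF alg_homD(1)[OF assms(1)]] lin_mapD[OF alg_homD(1)[OF assms(2)]])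
qed

end


section \<open>Tensor products\<close>

context calg
begin

lemma lin_span_closed:
  assumes "S \<subseteq> carrier A" "v \<in> lin_span A S"
  shows "v \<in> carrier A"
  using assms(2) by induction (use assms(1) in auto)

lemma lin_span_superset:
  assumes "S \<subseteq> carrier A" "v \<in> S"
  shows "v \<in> lin_span A S"
proof -
  have "1 \<odot> v \<oplus> \<zero> \<in> lin_span A S" using assms(2) lin_span.zero by (rule lin_span.step)
  then show ?thesis using assms by auto
qed

lemma lin_span_add:
  assumes S: "S \<subseteq> carrier A" and "v \<in> lin_span A S" "w \<in> lin_span A S"
  shows "v \<oplus> w \<in> lin_span A S"
  using assms(2)
proof induction
  case zero
  show ?case using assms lin_span_closed by simp
next
  case (step u v c)
  then have "(c \<odot> u \<oplus> v) \<oplus> w = c \<odot> u \<oplus> (v \<oplus> w)"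
    using lin_span_closed[OF S] assms by (intro a_assoc) auto
  with step show ?case by (simp add: lin_span.step)
qed

lemma lin_span_smult:
  assumes S: "S \<subseteq> carrier A" and "v \<in> lin_span A S"
  shows "d \<odot> v \<in> lin_span A S"
  using assms(2)
proof induction
  case zero
  show ?case by (simp add: lin_span.zero)
next
  case (step u v c)
  then have "d \<odot> (c \<odot> u \<oplus> v) = (d * c) \<odot> u \<oplus> d \<odot> v"
    using lin_span_closed[OF S] S by (auto simp: smult_add smult_smult)
  with step show ?case by (simp add: lin_span.step)
qed

lemma lin_span_ideal:
  assumes S: "S \<subseteq> carrier A"
    and l: "\<And>a s. a \<in> carrier A \<Longrightarrow> s \<in> S \<Longrightarrow> a \<otimes> s \<in> lin_span A S"
    and r: "\<And>a s. a \<in> carrier A \<Longrightarrow> s \<in> S \<Longrightarrow> s \<otimes> a \<in> lin_span A S"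
  shows "ideal (lin_span A S) A"
proof (rule idealI)
  show "subgroup (lin_span A S) (add_monoid A)"
  proof (rule add.subgroupI)
    show "\<ominus> v \<in> lin_span A S" if "v \<in> lin_span A S" for v
      using that lin_span_smult[OF S] lin_span_closed[OF S] by (simp add: uminus_eq_smult)
    show "lin_span A S \<noteq> {}" using lin_span.zero[of A S] by blast
  qed (use lin_span_closed[OF S] lin_span_add[OF S] in auto)
  fix v a assume v: "v \<in> lin_span A S" and a: "a \<in> carrier A"
  show "a \<otimes> v \<in> lin_span A S"
    using v
  proof induction
    case (step u v c)
    then show ?case
      using lin_span_closed[OF S] S a l[OF a] lin_span_add[OF S] lin_span_smult[OF S]
      by (auto simp: r_distr smult_mult_right)
  qed (simp add: a lin_span.zero)
  show "v \<otimes> a \<in> lin_span A S"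
    using v
  proof induction
    case (step u v c)
    then show ?case
      using lin_span_closed[OF S] S a r[OF a] lin_span_add[OF S] lin_span_smult[OF S]
      by (auto simp: l_distr smult_mult_left)
  qed (simp add: a lin_span.zero)
qed (rule ring_axioms)

end

locale calg_pair = A: calg A + B: calg B
  for A :: "(complex, 'a, 'm) module_scheme" and B :: "(complex, 'b, 'n) module_scheme"
begin

abbreviation "M \<equiv> monoid_alg (A \<times>\<times> B)"
abbreviation "T \<equiv> tensor_alg A B"
abbreviation "t \<equiv> pure_tensor A B"

lemma M_calg: "calg M"
  by (intro monoid_alg_calg DirProd_monoid A.monoid_axioms B.monoid_axioms)

sublocale M: calg M by (rule M_calg)

lemma single_closed: "a \<in> carrier A \<Longrightarrow> b \<in> carrier B \<Longrightarrow> single (a, b) c \<in> carrier M"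
  by (simp add: monoid_alg_eq_twisted_alg twisted_alg_def)

lemma M_simps:
  "carrier M = {p. keys p \<subseteq> carrier A \<times> carrier B}"
  "mult M = tw_mult (mult (A \<times>\<times> B)) (\<lambda>_ _. 1)" "one M = single (\<one>\<^bsub>A\<^esub>, \<one>\<^bsub>B\<^esub>) 1"
  "zero M = 0" "add M = (+)" "smult M = scale"
  by (simp_all add: monoid_alg_eq_twisted_alg twisted_alg_def)

lemma bilinear_relations_closed: "bilinear_relations A B \<subseteq> carrier M"
proof
  fix r assume r: "r \<in> bilinear_relations A B"
  have add: "p + r \<in> carrier M" if "p \<in> carrier M" "r \<in> carrier M" for p r
    using M.add.m_closed[OF that] by (simp add: M_simps(5))
  have diff: "p - r \<in> carrier M" if "p \<in> carrier M" "r \<in> carrier M" for p r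
    using that keys_diff[of p r] by (auto simp: M_simps)
  show "r \<in> carrier M"
    using r unfolding bilinear_relations_def
    by (elim UnE CollectE exE conjE) (simp_all add: add diff single_closed)
qed

lemma bilinear_relationsI:
  "\<lbrakk>a \<in> carrier A; a' \<in> carrier A; b \<in> carrier B\<rbrakk> \<Longrightarrow>
    single (a \<oplus>\<^bsub>A\<^esub> a', b) 1 - (single (a, b) 1 + single (a', b) 1) \<in> bilinear_relations A B"
  "\<lbrakk>a \<in> carrier A; b \<in> carrier B; b' \<in> carrier B\<rbrakk> \<Longrightarrow>
    single (a, b \<oplus>\<^bsub>B\<^esub> b') 1 - (single (a, b) 1 + single (a, b') 1) \<in> bilinear_relations A B"
  "\<lbrakk>a \<in> carrier A; b \<in> carrier B\<rbrakk> \<Longrightarrow>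
    single (c \<odot>\<^bsub>A\<^esub> a, b) 1 - single (a, b) c \<in> bilinear_relations A B"
  "\<lbrakk>a \<in> carrier A; b \<in> carrier B\<rbrakk> \<Longrightarrow>
    single (a, c \<odot>\<^bsub>B\<^esub> b) 1 - single (a, b) c \<in> bilinear_relations A B"
  unfolding bilinear_relations_def by blast+

text \<open>
  Multiplying a bilinearity relation by a pair \<open>(a0, b0)\<close> distributes over the relation and gives
  a relation of the same kind. This is why the bilinearity relations span an ideal.
\<close>

lemma single_mult_bilinear_relations:
  assumes "r \<in> bilinear_relations A B" "u \<in> carrier A \<times> carrier B"
  shows "single u 1 \<otimes>\<^bsub>M\<^esub> r \<in> bilinear_relations A B" "r \<otimes>\<^bsub>M\<^esub> single u 1 \<in> bilinear_relations A B"
proof -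
  obtain a0 b0 where u: "u = (a0, b0)" "a0 \<in> carrier A" "b0 \<in> carrier B" using assms(2) by auto
  have r: "(\<exists>a a' b. r = single (a \<oplus>\<^bsub>A\<^esub> a', b) 1 - (single (a, b) 1 + single (a', b) 1) \<and>
        a \<in> carrier A \<and> a' \<in> carrier A \<and> b \<in> carrier B) \<or>
      (\<exists>a b b'. r = single (a, b \<oplus>\<^bsub>B\<^esub> b') 1 - (single (a, b) 1 + single (a, b') 1) \<and>
        a \<in> carrier A \<and> b \<in> carrier B \<and> b' \<in> carrier B) \<or>
      (\<exists>c a b. r = single (c \<odot>\<^bsub>A\<^esub> a, b) 1 - single (a, b) c \<and> a \<in> carrier A \<and> b \<in> carrier B) \<or>
      (\<exists>c a b. r = single (a, c \<odot>\<^bsub>B\<^esub> b) 1 - single (a, b) c \<and> a \<in> carrier A \<and> b \<in> carrier B)"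
    using assms(1) unfolding bilinear_relations_def Un_iff mem_Collect_eq by argo
  note simps = u M_simps tw_mult_diff tw_mult_add_right tw_mult_add_left bilinear_relationsI
    A.r_distr B.r_distr A.smult_mult_right B.smult_mult_right
    A.l_distr B.l_distr A.smult_mult_left B.smult_mult_left
  show "single u 1 \<otimes>\<^bsub>M\<^esub> r \<in> bilinear_relations A B"
    using r by (elim disjE exE conjE) (simp_all add: simps)
  show "r \<otimes>\<^bsub>M\<^esub> single u 1 \<in> bilinear_relations A B"
    using r by (elim disjE exE conjE) (simp_all add: simps)
qed

lemma tensor_null_ideal: "ideal (tensor_null A B) M"
  unfolding tensor_null_def
proof (rule M.lin_span_ideal)
  show S: "bilinear_relations A B \<subseteq> carrier M" by (rule bilinear_relations_closed)
  fix p r assume p: "p \<in> carrier M" and r: "r \<in> bilinear_relations A B"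
  let ?L = "lin_span M (bilinear_relations A B)"
  have keys: "keys p \<subseteq> carrier A \<times> carrier B" using p by (simp add: M_simps)
  note span = M.lin_span_smult[OF S M.lin_span_superset[OF S]]
  show "p \<otimes>\<^bsub>M\<^esub> r \<in> ?L"
    using keys
  proof (induction p rule: poly_mapping_induct_on)
    case zero
    show ?case using lin_span.zero[of M] by (simp add: M_simps)
  next
    case (add u c p)
    have "(single u c + p) \<otimes>\<^bsub>M\<^esub> r = c \<odot>\<^bsub>M\<^esub> (single u 1 \<otimes>\<^bsub>M\<^esub> r) \<oplus>\<^bsub>M\<^esub> p \<otimes>\<^bsub>M\<^esub> r"
      by (simp add: M_simps tw_mult_add_left flip: tw_mult_scale_left)
    then show ?case
      using add single_mult_bilinear_relations(1)[OF r add.hyps(1)] by (simp add: lin_span.step)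
  qed
  show "r \<otimes>\<^bsub>M\<^esub> p \<in> ?L"
    using keys
  proof (induction p rule: poly_mapping_induct_on)
    case zero
    show ?case using lin_span.zero[of M] by (simp add: M_simps)
  next
    case (add u c p)
    have "r \<otimes>\<^bsub>M\<^esub> (single u c + p) = c \<odot>\<^bsub>M\<^esub> (r \<otimes>\<^bsub>M\<^esub> single u 1) \<oplus>\<^bsub>M\<^esub> r \<otimes>\<^bsub>M\<^esub> p"
      by (simp add: M_simps tw_mult_add_right flip: tw_mult_scale_right)
    then show ?case
      using add single_mult_bilinear_relations(2)[OF r add.hyps(1)] by (simp add: lin_span.step)
  qed
qed

theorem tensor_calg: "calg T"
  unfolding tensor_alg_def by (rule M.quot_calg[OF tensor_null_ideal])

sublocale T: calg T by (rule tensor_calg)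

lemmas tensor_ops = M.quot_ops[OF tensor_null_ideal, folded tensor_alg_def]

lemma tensor_closed [simp]: "a \<in> carrier A \<Longrightarrow> b \<in> carrier B \<Longrightarrow> t a b \<in> carrier T"
  unfolding pure_tensor_def tensor_alg_def by (intro M.quot_closed single_closed)

lemma tensor_mult:
  "\<lbrakk>a \<in> carrier A; b \<in> carrier B; a' \<in> carrier A; b' \<in> carrier B\<rbrakk> \<Longrightarrow>
    t a b \<otimes>\<^bsub>T\<^esub> t a' b' = t (a \<otimes>\<^bsub>A\<^esub> a') (b \<otimes>\<^bsub>B\<^esub> b')"
  unfolding pure_tensor_def by (subst tensor_ops(3)) (simp_all add: M_simps)

lemma tensor_one: "\<one>\<^bsub>T\<^esub> = t \<one>\<^bsub>A\<^esub> \<one>\<^bsub>B\<^esub>"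
  unfolding pure_tensor_def tensor_ops(1) by (simp add: M_simps)

lemma coset_single:
  assumes "a \<in> carrier A" "b \<in> carrier B"
  shows "tensor_null A B +>\<^bsub>M\<^esub> single (a, b) c = c \<odot>\<^bsub>T\<^esub> t a b"
  unfolding pure_tensor_def using assms by (subst tensor_ops(5)) (simp_all add: M_simps)

lemma coset_relation:
  assumes "p - r \<in> bilinear_relations A B" "p \<in> carrier M" "r \<in> carrier M"
  shows "tensor_null A B +>\<^bsub>M\<^esub> p = tensor_null A B +>\<^bsub>M\<^esub> r"
proof -
  have "p - r \<in> tensor_null A B"
    unfolding tensor_null_def using M.lin_span_superset[OF bilinear_relations_closed assms(1)] .
  moreover have "p \<ominus>\<^bsub>M\<^esub> r = p - r"
    using assms(2,3) by (simp add: M.minus_eq_smult) (simp add: M_simps scale_minus_one)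
  ultimately show ?thesis
    using M.quotient_eq_iff_same_a_r_cos[OF tensor_null_ideal assms(2,3)] by simp
qed

lemma tensor_add_left:
  assumes "a \<in> carrier A" "a' \<in> carrier A" "b \<in> carrier B"
  shows "t (a \<oplus>\<^bsub>A\<^esub> a') b = t a b \<oplus>\<^bsub>T\<^esub> t a' b"
  unfolding pure_tensor_def using assms
  by (subst tensor_ops(4); (intro coset_relation)?)
    (simp_all add: single_closed M_simps(5) bilinear_relationsI M.add.m_closed[unfolded M_simps(5)])

lemma tensor_add_right:
  assumes "a \<in> carrier A" "b \<in> carrier B" "b' \<in> carrier B"
  shows "t a (b \<oplus>\<^bsub>B\<^esub> b') = t a b \<oplus>\<^bsub>T\<^esub> t a b'"
  unfolding pure_tensor_def using assms
  by (subst tensor_ops(4); (intro coset_relation)?)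
    (simp_all add: single_closed M_simps(5) bilinear_relationsI M.add.m_closed[unfolded M_simps(5)])

lemma tensor_smult_left:
  assumes "a \<in> carrier A" "b \<in> carrier B"
  shows "t (c \<odot>\<^bsub>A\<^esub> a) b = c \<odot>\<^bsub>T\<^esub> t a b"
  unfolding coset_single[OF assms, symmetric] using assms
  unfolding pure_tensor_def by (intro coset_relation) (simp_all add: single_closed bilinear_relationsI)

lemma tensor_smult_right:
  assumes "a \<in> carrier A" "b \<in> carrier B"
  shows "t a (c \<odot>\<^bsub>B\<^esub> b) = c \<odot>\<^bsub>T\<^esub> t a b"
  unfolding coset_single[OF assms, symmetric] using assms
  unfolding pure_tensor_def by (intro coset_relation) (simp_all add: single_closed bilinear_relationsI)

lemma tensor_minus_left:
  "\<lbrakk>a \<in> carrier A; a' \<in> carrier A; b \<in> carrier B\<rbrakk> \<Longrightarrow> t (a \<ominus>\<^bsub>A\<^esub> a') b = t a b \<ominus>\<^bsub>T\<^esub> t a' b"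
  by (simp add: A.minus_eq_smult T.minus_eq_smult tensor_add_left tensor_smult_left)

lemma tensor_minus_right:
  "\<lbrakk>a \<in> carrier A; b \<in> carrier B; b' \<in> carrier B\<rbrakk> \<Longrightarrow> t a (b \<ominus>\<^bsub>B\<^esub> b') = t a b \<ominus>\<^bsub>T\<^esub> t a b'"
  by (simp add: B.minus_eq_smult T.minus_eq_smult tensor_add_right tensor_smult_right)

lemma tensor_induct [consumes 1, case_names zero add]:
  assumes "X \<in> carrier T" and "P \<zero>\<^bsub>T\<^esub>"
    and step: "\<And>a b c X. a \<in> carrier A \<Longrightarrow> b \<in> carrier B \<Longrightarrow> X \<in> carrier T \<Longrightarrow> P X \<Longrightarrow>
      P (c \<odot>\<^bsub>T\<^esub> t a b \<oplus>\<^bsub>T\<^esub> X)"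
  shows "P X"
proof -
  obtain p where p: "p \<in> carrier M" "X = tensor_null A B +>\<^bsub>M\<^esub> p"
    using assms(1) by (auto simp: tensor_alg_def M.quot_carrier)
  have "keys p \<subseteq> carrier A \<times> carrier B" using p(1) by (simp add: M_simps)
  then have "P (tensor_null A B +>\<^bsub>M\<^esub> p)"
  proof (induction p rule: poly_mapping_induct_on)
    case zero
    show ?case using assms(2) tensor_ops(2) by (simp add: M_simps)
  next
    case (add u c p)
    obtain a b where u: "u = (a, b)" "a \<in> carrier A" "b \<in> carrier B" using add.hyps(1) by auto
    have p: "p \<in> carrier M" using add.hyps(2) by (simp add: M_simps)
    have "tensor_null A B +>\<^bsub>M\<^esub> (single u c + p) = c \<odot>\<^bsub>T\<^esub> t a b \<oplus>\<^bsub>T\<^esub> (tensor_null A B +>\<^bsub>M\<^esub> p)"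
      using u p by (simp flip: coset_single add: tensor_ops(4) single_closed) (simp add: M_simps)
    then show ?case
      using step[OF u(2,3) _ add.IH] M.quot_closed[OF p] by (simp add: tensor_alg_def)
  qed
  with p show ?thesis by simp
qed

text \<open>
  The universal property of the tensor product as a vector space: \<open>\<beta>\<close> extends linearly to the free
  space on pairs, and bilinearity says that the extension kills the defining relations.
\<close>

theorem tensor_lift:
  assumes C: "calg C"
    and \<beta>1: "\<And>b. b \<in> carrier B \<Longrightarrow> lin_map A C (\<lambda>a. \<beta> a b)"
    and \<beta>2: "\<And>a. a \<in> carrier A \<Longrightarrow> lin_map B C (\<lambda>b. \<beta> a b)"
  shows "\<exists>L. lin_map T C L \<and> (\<forall>a\<in>carrier A. \<forall>b\<in>carrier B. L (t a b) = \<beta> a b)"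
proof -
  interpret C: calg C by fact
  let ?e = "lin_ext C (\<lambda>(a, b). \<beta> a b)"
  have cl: "\<beta> a b \<in> carrier C" if "a \<in> carrier A" "b \<in> carrier B" for a b
    using lin_mapD(1)[OF \<beta>1] that by blast
  then have \<phi>: "(\<lambda>(a, b). \<beta> a b) \<in> carrier A \<times> carrier B \<rightarrow> carrier C" by auto
  have e: "lin_map M C ?e"
    using C.lin_ext_closed[OF \<phi>] C.lin_ext_add[OF \<phi>] C.lin_ext_scale[OF \<phi>]
    by (simp add: lin_map_def M_simps)
  have single: "?e (single (a, b) c) = c \<odot>\<^bsub>C\<^esub> \<beta> a b" if "a \<in> carrier A" "b \<in> carrier B" for a b c
    using that cl by simp
  have rel: "?e r = \<zero>\<^bsub>C\<^esub>" if "r \<in> bilinear_relations A B" for r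
  proof -
    have eq: "?e (p - r) = \<zero>\<^bsub>C\<^esub>" if "p \<in> carrier M" "r \<in> carrier M" "?e p = ?e r" for p r
      using C.lin_ext_diff[OF \<phi>, of p r] that C.lin_ext_closed[OF \<phi>, of r]
      by (simp add: M_simps C.minus_eq_zero_iff)
    have add: "p + r \<in> carrier M \<and> ?e (p + r) = ?e p \<oplus>\<^bsub>C\<^esub> ?e r"
      if "p \<in> carrier M" "r \<in> carrier M" for p r
      using lin_mapD(2)[OF e that] M.add.m_closed[OF that] by (simp add: M_simps)
    show ?thesis
      using that unfolding bilinear_relations_def
      by (elim UnE) (auto simp: single_closed single add cl C.smult_smult
          lin_mapD[OF \<beta>1] lin_mapD[OF \<beta>2] intro!: eq)
  qed
  have null: "?e r = \<zero>\<^bsub>C\<^esub>" if "r \<in> tensor_null A B" for r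
    using that unfolding tensor_null_def
  proof (induction rule: lin_span.induct)
    case zero
    show ?case using lin_map_zero[OF e M_calg C] by simp
  next
    case (step v w c)
    then show ?case
      using bilinear_relations_closed M.lin_span_closed[OF bilinear_relations_closed] rel
      by (subst lin_mapD(2)[OF e]) (auto simp: lin_mapD(3)[OF e])
  qed
  note lift = quot_lift[OF M_calg C tensor_null_ideal e null]
  show ?thesis
    using lift(1)[OF _ single_closed] lift(2) single cl
    by (intro exI[of _ "quot_lift M (tensor_null A B) ?e"])
      (auto simp: tensor_alg_def pure_tensor_def)
qed

end


section \<open>Scalars and endomorphisms\<close>

lemma complex_alg_calg: "calg complex_alg"
proof -
  have "abelian_group complex_alg"
    by (rule abelian_groupI)
      (auto simp: complex_alg_def add.assoc intro: exI[of _ "- x" for x] left_minus)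
  moreover have "Group.monoid complex_alg"
    by (rule monoidI) (auto simp: complex_alg_def)
  ultimately have "ring complex_alg"
    by (rule ringI) (auto simp: complex_alg_def algebra_simps)
  moreover have "calg_axioms complex_alg"
    by unfold_locales (auto simp: complex_alg_def algebra_simps)
  ultimately show ?thesis by (rule calg.intro)
qed

lemma End_carrier_iff:
  "T \<in> carrier (End_alg A) \<longleftrightarrow> lin_map A A T \<and> T \<in> extensional (carrier A)"
  by (auto simp: End_alg_def lin_map_def PiE_def)

lemma End_simps:
  "\<one>\<^bsub>End_alg A\<^esub> = (\<lambda>a\<in>carrier A. a)" "\<zero>\<^bsub>End_alg A\<^esub> = (\<lambda>a\<in>carrier A. \<zero>\<^bsub>A\<^esub>)"
  "S \<otimes>\<^bsub>End_alg A\<^esub> T = (\<lambda>a\<in>carrier A. S (T a))"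
  "S \<oplus>\<^bsub>End_alg A\<^esub> T = (\<lambda>a\<in>carrier A. S a \<oplus>\<^bsub>A\<^esub> T a)"
  "c \<odot>\<^bsub>End_alg A\<^esub> T = (\<lambda>a\<in>carrier A. c \<odot>\<^bsub>A\<^esub> T a)"
  by (simp_all add: End_alg_def compose_def)

context calg
begin

lemma End_closed: "T \<in> carrier (End_alg A) \<Longrightarrow> a \<in> carrier A \<Longrightarrow> T a \<in> carrier A"
  by (auto simp: End_carrier_iff intro: lin_mapD(1))

lemma End_eqI:
  assumes "S \<in> carrier (End_alg A)" "T \<in> carrier (End_alg A)" "\<And>a. a \<in> carrier A \<Longrightarrow> S a = T a"
  shows "S = T"
  using assms by (auto simp: End_carrier_iff intro: extensionalityI)

lemma End_add_closed:
  "S \<in> carrier (End_alg A) \<Longrightarrow> T \<in> carrier (End_alg A) \<Longrightarrow> S \<oplus>\<^bsub>End_alg A\<^esub> T \<in> carrier (End_alg A)"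
  unfolding End_carrier_iff lin_map_def by (auto simp: End_simps smult_add Pi_iff a_ac)

lemma End_smult_closed:
  "T \<in> carrier (End_alg A) \<Longrightarrow> c \<odot>\<^bsub>End_alg A\<^esub> T \<in> carrier (End_alg A)"
  unfolding End_carrier_iff lin_map_def
  by (auto simp: End_simps smult_add smult_smult Pi_iff mult.commute)

lemma End_mult_closed:
  "S \<in> carrier (End_alg A) \<Longrightarrow> T \<in> carrier (End_alg A) \<Longrightarrow> S \<otimes>\<^bsub>End_alg A\<^esub> T \<in> carrier (End_alg A)"
  unfolding End_carrier_iff lin_map_def by (auto simp: End_simps Pi_iff)

theorem End_calg: "calg (End_alg A)"
proof -
  let ?E = "End_alg A"
  have one: "\<one>\<^bsub>?E\<^esub> \<in> carrier ?E" and zero: "\<zero>\<^bsub>?E\<^esub> \<in> carrier ?E"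
    by (auto simp: End_carrier_iff lin_map_def End_simps)
  have lin: "T (a \<oplus> b) = T a \<oplus> T b" "T (c \<odot> a) = c \<odot> T a"
    if "T \<in> carrier ?E" "a \<in> carrier A" "b \<in> carrier A" for T a b c
    using that by (auto simp: End_carrier_iff lin_mapD)
  note closed = one zero End_add_closed End_smult_closed End_mult_closed
  have "abelian_group ?E"
  proof (rule abelian_groupI)
    fix T assume T: "T \<in> carrier ?E"
    show "\<exists>S\<in>carrier ?E. S \<oplus>\<^bsub>?E\<^esub> T = \<zero>\<^bsub>?E\<^esub>"
      using End_smult_closed[OF T, of "-1"] End_closed[OF T]
      by (intro bexI[of _ "(-1) \<odot>\<^bsub>?E\<^esub> T"] End_eqI End_add_closed T zero)
        (simp_all add: End_simps l_neg flip: uminus_eq_smult)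
  next
    fix S T R assume S: "S \<in> carrier ?E" and T: "T \<in> carrier ?E" and R: "R \<in> carrier ?E"
    show "(S \<oplus>\<^bsub>?E\<^esub> T) \<oplus>\<^bsub>?E\<^esub> R = S \<oplus>\<^bsub>?E\<^esub> (T \<oplus>\<^bsub>?E\<^esub> R)"
      by (rule End_eqI) (simp_all add: S T R closed, simp add: End_simps End_closed S T R a_assoc)
    show "S \<oplus>\<^bsub>?E\<^esub> T = T \<oplus>\<^bsub>?E\<^esub> S"
      by (rule End_eqI) (simp_all add: S T closed, simp add: End_simps End_closed S T a_comm)
    show "\<zero>\<^bsub>?E\<^esub> \<oplus>\<^bsub>?E\<^esub> S = S"
      by (rule End_eqI) (simp_all add: S closed, simp add: End_simps End_closed S)
  qed (simp_all add: closed)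
  moreover have "Group.monoid ?E"
  proof (rule monoidI)
    fix S T R assume S: "S \<in> carrier ?E" and T: "T \<in> carrier ?E" and R: "R \<in> carrier ?E"
    show "(S \<otimes>\<^bsub>?E\<^esub> T) \<otimes>\<^bsub>?E\<^esub> R = S \<otimes>\<^bsub>?E\<^esub> (T \<otimes>\<^bsub>?E\<^esub> R)"
      by (rule End_eqI) (simp_all add: S T R closed, simp add: End_simps End_closed S T R)
    show "\<one>\<^bsub>?E\<^esub> \<otimes>\<^bsub>?E\<^esub> S = S"
      by (rule End_eqI) (simp_all add: S closed, simp add: End_simps End_closed S)
    show "S \<otimes>\<^bsub>?E\<^esub> \<one>\<^bsub>?E\<^esub> = S"
      by (rule End_eqI) (simp_all add: S closed, simp add: End_simps End_closed S)
  qed (simp_all add: closed)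
  ultimately have "ring ?E"
  proof (rule ringI)
    fix x y z assume xyz: "x \<in> carrier ?E" "y \<in> carrier ?E" "z \<in> carrier ?E"
    show "(x \<oplus>\<^bsub>?E\<^esub> y) \<otimes>\<^bsub>?E\<^esub> z = x \<otimes>\<^bsub>?E\<^esub> z \<oplus>\<^bsub>?E\<^esub> y \<otimes>\<^bsub>?E\<^esub> z"
      "z \<otimes>\<^bsub>?E\<^esub> (x \<oplus>\<^bsub>?E\<^esub> y) = z \<otimes>\<^bsub>?E\<^esub> x \<oplus>\<^bsub>?E\<^esub> z \<otimes>\<^bsub>?E\<^esub> y"
      using xyz by (auto simp: closed End_simps End_closed lin intro!: restrict_ext)
  qed
  moreover have "calg_axioms ?E"
  proof
    fix S T c d assume S: "S \<in> carrier ?E" and T: "T \<in> carrier ?E"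
    show "c \<odot>\<^bsub>?E\<^esub> S \<in> carrier ?E" using S by (rule End_smult_closed)
    show "S \<otimes>\<^bsub>?E\<^esub> (c \<odot>\<^bsub>?E\<^esub> T) = c \<odot>\<^bsub>?E\<^esub> (S \<otimes>\<^bsub>?E\<^esub> T)"
      using S T by (auto simp: closed End_simps End_closed lin intro!: restrict_ext)
    show "1 \<odot>\<^bsub>?E\<^esub> S = S"
      using S by (auto simp: closed intro!: End_eqI) (auto simp: End_simps End_closed)
  qed (auto simp: closed End_simps End_closed smult_add add_smult smult_smult intro!: restrict_ext)
  ultimately show ?thesis by (rule calg.intro)
qed

end


section \<open>The Hopf algebra structure of the quantum group\<close>

text \<open>
  The relations as equations in an arbitrary algebra: one predicate for the generators themselves and
  for their images under a homomorphism.
\<close>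

definition uq_equations ::
    "complex \<Rightarrow> (complex, 'b, 'm) module_scheme \<Rightarrow> 'b \<Rightarrow> 'b \<Rightarrow> 'b \<Rightarrow> 'b \<Rightarrow> bool" where
  "uq_equations q B k k' e f \<longleftrightarrow> k' \<otimes>\<^bsub>B\<^esub> k = \<one>\<^bsub>B\<^esub> \<and> k \<otimes>\<^bsub>B\<^esub> k' = \<one>\<^bsub>B\<^esub> \<and>
     k \<otimes>\<^bsub>B\<^esub> e = q ^ 2 \<odot>\<^bsub>B\<^esub> (e \<otimes>\<^bsub>B\<^esub> k) \<and> k \<otimes>\<^bsub>B\<^esub> f = (1 / q ^ 2) \<odot>\<^bsub>B\<^esub> (f \<otimes>\<^bsub>B\<^esub> k) \<and>
     e \<otimes>\<^bsub>B\<^esub> f \<ominus>\<^bsub>B\<^esub> f \<otimes>\<^bsub>B\<^esub> e = (1 / (q - 1 / q)) \<odot>\<^bsub>B\<^esub> (k \<ominus>\<^bsub>B\<^esub> k')"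

lemma (in calg) uq_equations_iff:
  assumes g: "\<And>x. g x \<in> carrier A"
  shows "(\<forall>r\<in>uq_relations q. free_eval A g r = \<zero>) \<longleftrightarrow> uq_equations q A (g GK) (g GKinv) (g GE) (g GF)"
proof -
  have single: "free_eval A g (single w c) = c \<odot> word_eval A g w" for w c
    using g by simp
  show ?thesis
    using g by (simp add: uq_relations_def uq_equations_def free_eval_hom(3)[OF g] single
        minus_eq_zero_iff smult_minus)
qed

theorem uq_alg_calg: "calg (uq_alg q)"
  unfolding uq_alg_def by (rule presented_alg_calg)

lemma uq_gens_closed [simp]:
  "uq_k q \<in> carrier (uq_alg q)" "uq_kinv q \<in> carrier (uq_alg q)"
  "uq_e q \<in> carrier (uq_alg q)" "uq_f q \<in> carrier (uq_alg q)"
  by (simp_all add: uq_alg_def uq_k_def uq_kinv_def uq_e_def uq_f_def)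

lemma uq_alg_equations: "uq_equations q (uq_alg q) (uq_k q) (uq_kinv q) (uq_e q) (uq_f q)"
  unfolding uq_alg_def uq_k_def uq_kinv_def uq_e_def uq_f_def
  by (subst calg.uq_equations_iff[OF presented_alg_calg, symmetric])
    (simp_all add: presented_alg_relation)

lemma uq_induct [consumes 1, case_names one k kinv e f add smult mult]:
  assumes "h \<in> carrier (uq_alg q)"
    and "P \<one>\<^bsub>uq_alg q\<^esub>" "P (uq_k q)" "P (uq_kinv q)" "P (uq_e q)" "P (uq_f q)"
    and "\<And>a b. a \<in> carrier (uq_alg q) \<Longrightarrow> b \<in> carrier (uq_alg q) \<Longrightarrow> P a \<Longrightarrow> P b \<Longrightarrow>
      P (a \<oplus>\<^bsub>uq_alg q\<^esub> b)"
    and "\<And>c a. a \<in> carrier (uq_alg q) \<Longrightarrow> P a \<Longrightarrow> P (c \<odot>\<^bsub>uq_alg q\<^esub> a)"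
    and "\<And>a b. a \<in> carrier (uq_alg q) \<Longrightarrow> b \<in> carrier (uq_alg q) \<Longrightarrow> P a \<Longrightarrow> P b \<Longrightarrow>
      P (a \<otimes>\<^bsub>uq_alg q\<^esub> b)"
  shows "P h"
proof -
  have "P (alg_gen (uq_relations q) x)" for x
    using assms(3-6) by (cases x) (simp_all add: uq_k_def uq_kinv_def uq_e_def uq_f_def)
  with assms show ?thesis
    unfolding uq_alg_def by (intro presented_alg_induct[of h "uq_relations q" P]) auto
qed

lemma uq_hom_exists:
  assumes B: "calg B" and "k \<in> carrier B" "k' \<in> carrier B" "e \<in> carrier B" "f \<in> carrier B"
    and eqs: "uq_equations q B k k' e f"
  shows "\<exists>\<phi>\<in>alg_hom (uq_alg q) B. \<phi> (uq_k q) = k \<and> \<phi> (uq_kinv q) = k' \<and>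
    \<phi> (uq_e q) = e \<and> \<phi> (uq_f q) = f"
proof -
  define g where "g x = (case x of GK \<Rightarrow> k | GKinv \<Rightarrow> k' | GE \<Rightarrow> e | GF \<Rightarrow> f)" for x
  have g: "g x \<in> carrier B" for x using assms by (simp add: g_def split: uq_gen.split)
  have "\<forall>r\<in>uq_relations q. free_eval B g r = \<zero>\<^bsub>B\<^esub>"
    using calg.uq_equations_iff[OF B, of g q] g eqs by (simp add: g_def[of GK] g_def[of GKinv] g_def[of GE] g_def[of GF])
  then obtain \<phi> where "\<phi> \<in> alg_hom (uq_alg q) B" "\<And>x. \<phi> (alg_gen (uq_relations q) x) = g x"
    unfolding uq_alg_def using presented_alg_hom_exists[OF B, of g "uq_relations q"] g by metis
  then show ?thesis
    by (intro bexI[of _ \<phi>]) (simp_all add: uq_k_def uq_kinv_def uq_e_def uq_f_def g_def)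
qed

lemma uq_hom_equations:
  assumes \<phi>: "\<phi> \<in> alg_hom (uq_alg q) B" and B: "calg B"
  shows "uq_equations q B (\<phi> (uq_k q)) (\<phi> (uq_kinv q)) (\<phi> (uq_e q)) (\<phi> (uq_f q))"
proof -
  interpret U: calg "uq_alg q" by (rule uq_alg_calg)
  note eqs = uq_alg_equations[of q, unfolded uq_equations_def]
  note hom = lin_map_minus[OF alg_homD(1)[OF \<phi>] uq_alg_calg B] lin_mapD(3)[OF alg_homD(1)[OF \<phi>]]
    alg_homD(2,3)[OF \<phi>]
  show ?thesis
    using eqs by (simp add: uq_equations_def flip: hom)
qed

text \<open>
  A homomorphism sends \<open>k'\<close> to the inverse of the image of \<open>k\<close>, so the images of the other three
  generators determine it.
\<close>

lemma uq_hom_eqI: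
  assumes \<phi>: "\<phi> \<in> alg_hom (uq_alg q) B" and \<psi>: "\<psi> \<in> alg_hom (uq_alg q) B" and B: "calg B"
    and k: "\<phi> (uq_k q) = \<psi> (uq_k q)" and "\<phi> (uq_e q) = \<psi> (uq_e q)" "\<phi> (uq_f q) = \<psi> (uq_f q)"
  shows "\<phi> = \<psi>"
proof -
  interpret B: calg B by fact
  have cl: "\<phi> (uq_kinv q) \<in> carrier B" "\<psi> (uq_kinv q) \<in> carrier B" "\<psi> (uq_k q) \<in> carrier B"
    by (simp_all add: lin_mapD(1)[OF alg_homD(1)[OF \<phi>]] lin_mapD(1)[OF alg_homD(1)[OF \<psi>]])
  have "\<phi> (uq_kinv q) = \<phi> (uq_kinv q) \<otimes>\<^bsub>B\<^esub> (\<psi> (uq_k q) \<otimes>\<^bsub>B\<^esub> \<psi> (uq_kinv q))"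
    using uq_hom_equations[OF \<psi> B] cl by (simp add: uq_equations_def)
  also have "\<dots> = (\<phi> (uq_kinv q) \<otimes>\<^bsub>B\<^esub> \<phi> (uq_k q)) \<otimes>\<^bsub>B\<^esub> \<psi> (uq_kinv q)"
    using cl by (simp add: k B.m_assoc)
  also have "\<dots> = \<psi> (uq_kinv q)"
    using uq_hom_equations[OF \<phi> B] cl by (simp add: uq_equations_def)
  finally have k': "\<phi> (uq_kinv q) = \<psi> (uq_kinv q)" .
  show ?thesis
  proof (rule presented_alg_hom_eqI[OF \<phi>[unfolded uq_alg_def] \<psi>[unfolded uq_alg_def]])
    show "\<phi> (alg_gen (uq_relations q) x) = \<psi> (alg_gen (uq_relations q) x)" for x
      using assms(4-6) k'
      by (cases x) (simp_all add: uq_k_def uq_kinv_def uq_e_def uq_f_def)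
  qed
qed

context
  fixes q :: complex
  assumes q0: "q \<noteq> 0"
begin

interpretation U: calg "uq_alg q" by (rule uq_alg_calg)
interpretation P: calg_pair "uq_alg q" "uq_alg q" ..

text \<open>
  The proposed images of the generators satisfy the defining relations in the tensor square, so the
  homomorphism that defines \<open>uq_comult\<close> exists. The only relation with content is the last one.
  In the commutator of \<open>1 \<otimes> e + e \<otimes> k\<close> and \<open>f \<otimes> 1 + k' \<otimes> f\<close> the terms \<open>f \<otimes> e\<close> cancel, and so do
  \<open>ek' \<otimes> kf\<close> and \<open>k'e \<otimes> fk\<close>, since the powers of \<open>q\<close> from moving \<open>k'\<close> past \<open>e\<close> and \<open>k\<close> past \<open>f\<close> are
  inverse to each other. What remains is \<open>k' \<otimes> [e, f] + [e, f] \<otimes> k\<close>, a telescoping sum.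
\<close>

lemma uq_comult:
  fixes t T U
  defines "t \<equiv> pure_tensor (uq_alg q) (uq_alg q)" and "T \<equiv> tensor_alg (uq_alg q) (uq_alg q)"
    and "U \<equiv> uq_alg q"
  shows "uq_comult q \<in> alg_hom U T"
    and "uq_comult q (uq_k q) = t (uq_k q) (uq_k q)"
    and "uq_comult q (uq_kinv q) = t (uq_kinv q) (uq_kinv q)"
    and "uq_comult q (uq_e q) = t \<one>\<^bsub>U\<^esub> (uq_e q) \<oplus>\<^bsub>T\<^esub> t (uq_e q) (uq_k q)"
    and "uq_comult q (uq_f q) = t (uq_f q) \<one>\<^bsub>U\<^esub> \<oplus>\<^bsub>T\<^esub> t (uq_kinv q) (uq_f q)"
proof -
  define k k' e f where "k = uq_k q" and "k' = uq_kinv q" and "e = uq_e q" and "f = uq_f q"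
  have cl [simp]: "k \<in> carrier U" "k' \<in> carrier U" "e \<in> carrier U" "f \<in> carrier U"
    by (simp_all add: k_def k'_def e_def f_def U_def)
  have eqs: "k' \<otimes>\<^bsub>U\<^esub> k = \<one>\<^bsub>U\<^esub>" "k \<otimes>\<^bsub>U\<^esub> k' = \<one>\<^bsub>U\<^esub>" "k \<otimes>\<^bsub>U\<^esub> e = q ^ 2 \<odot>\<^bsub>U\<^esub> (e \<otimes>\<^bsub>U\<^esub> k)"
    "k \<otimes>\<^bsub>U\<^esub> f = (1 / q ^ 2) \<odot>\<^bsub>U\<^esub> (f \<otimes>\<^bsub>U\<^esub> k)"
    "e \<otimes>\<^bsub>U\<^esub> f \<ominus>\<^bsub>U\<^esub> f \<otimes>\<^bsub>U\<^esub> e = (1 / (q - 1 / q)) \<odot>\<^bsub>U\<^esub> (k \<ominus>\<^bsub>U\<^esub> k')"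
    using uq_alg_equations[of q] by (simp_all add: uq_equations_def k_def k'_def e_def f_def U_def)
  note U = U.ring_axioms[folded U_def]
  interpret U: calg U unfolding U_def by (rule uq_alg_calg)
  interpret T: calg T unfolding T_def by (rule P.tensor_calg)
  note tc [simp] = P.tensor_closed[folded t_def T_def U_def]
  note mult = P.tensor_mult[folded t_def T_def U_def]
  note addl = P.tensor_add_left[folded t_def T_def U_def] and addr = P.tensor_add_right[folded t_def T_def U_def]
  note smult = P.tensor_smult_left[folded t_def T_def U_def] P.tensor_smult_right[folded t_def T_def U_def]
  note minus = P.tensor_minus_left[folded t_def T_def U_def] P.tensor_minus_right[folded t_def T_def U_def]
  let ?c = "1 / (q - 1 / q)"
  let ?K = "t k k" and ?K' = "t k' k'" and ?E = "t \<one>\<^bsub>U\<^esub> e \<oplus>\<^bsub>T\<^esub> t e k" and ?F = "t f \<one>\<^bsub>U\<^esub> \<oplus>\<^bsub>T\<^esub> t k' f"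
  have k'e: "e \<otimes>\<^bsub>U\<^esub> k' = q ^ 2 \<odot>\<^bsub>U\<^esub> (k' \<otimes>\<^bsub>U\<^esub> e)"
  proof -
    have "e \<otimes>\<^bsub>U\<^esub> k' = k' \<otimes>\<^bsub>U\<^esub> (k \<otimes>\<^bsub>U\<^esub> e) \<otimes>\<^bsub>U\<^esub> k'"
      by (simp add: eqs(1) flip: U.m_assoc)
    also have "\<dots> = q ^ 2 \<odot>\<^bsub>U\<^esub> (k' \<otimes>\<^bsub>U\<^esub> (e \<otimes>\<^bsub>U\<^esub> (k \<otimes>\<^bsub>U\<^esub> k')))"
      by (simp add: eqs(3) U.smult_mult_left U.smult_mult_right U.m_assoc)
    finally show ?thesis by (simp add: eqs(2))
  qed
  have swap: "t (e \<otimes>\<^bsub>U\<^esub> k') (k \<otimes>\<^bsub>U\<^esub> f) = t (k' \<otimes>\<^bsub>U\<^esub> e) (f \<otimes>\<^bsub>U\<^esub> k)"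
    using q0 by (simp add: k'e eqs(4) smult T.smult_smult)
  have EF: "?E \<otimes>\<^bsub>T\<^esub> ?F = (t f e \<oplus>\<^bsub>T\<^esub> t (k' \<otimes>\<^bsub>U\<^esub> e) (f \<otimes>\<^bsub>U\<^esub> k)) \<oplus>\<^bsub>T\<^esub>
      (t k' (e \<otimes>\<^bsub>U\<^esub> f) \<oplus>\<^bsub>T\<^esub> t (e \<otimes>\<^bsub>U\<^esub> f) k)"
    by (simp add: T.l_distr T.r_distr mult swap T.a_ac)
  have FE: "?F \<otimes>\<^bsub>T\<^esub> ?E = (t f e \<oplus>\<^bsub>T\<^esub> t (k' \<otimes>\<^bsub>U\<^esub> e) (f \<otimes>\<^bsub>U\<^esub> k)) \<oplus>\<^bsub>T\<^esub>
      (t k' (f \<otimes>\<^bsub>U\<^esub> e) \<oplus>\<^bsub>T\<^esub> t (f \<otimes>\<^bsub>U\<^esub> e) k)"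
    by (simp add: T.l_distr T.r_distr mult T.a_ac)
  have cancel: "(z \<oplus>\<^bsub>T\<^esub> (a \<oplus>\<^bsub>T\<^esub> b)) \<ominus>\<^bsub>T\<^esub> (z \<oplus>\<^bsub>T\<^esub> (a' \<oplus>\<^bsub>T\<^esub> b')) = (a \<ominus>\<^bsub>T\<^esub> a') \<oplus>\<^bsub>T\<^esub> (b \<ominus>\<^bsub>T\<^esub> b')"
    if "z \<in> carrier T" "a \<in> carrier T" "b \<in> carrier T" "a' \<in> carrier T" "b' \<in> carrier T" for z a b a' b'
    using that by algebra
  have telescope: "(a \<ominus>\<^bsub>T\<^esub> b) \<oplus>\<^bsub>T\<^esub> (z \<ominus>\<^bsub>T\<^esub> a) = z \<ominus>\<^bsub>T\<^esub> b"
    if "z \<in> carrier T" "a \<in> carrier T" "b \<in> carrier T" for z a b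
    using that by algebra
  have "?E \<otimes>\<^bsub>T\<^esub> ?F \<ominus>\<^bsub>T\<^esub> ?F \<otimes>\<^bsub>T\<^esub> ?E =
      t k' (e \<otimes>\<^bsub>U\<^esub> f \<ominus>\<^bsub>U\<^esub> f \<otimes>\<^bsub>U\<^esub> e) \<oplus>\<^bsub>T\<^esub> t (e \<otimes>\<^bsub>U\<^esub> f \<ominus>\<^bsub>U\<^esub> f \<otimes>\<^bsub>U\<^esub> e) k"
    unfolding EF FE by (subst cancel) (simp_all add: minus)
  also have "\<dots> = ?c \<odot>\<^bsub>T\<^esub> ((t k' k \<ominus>\<^bsub>T\<^esub> t k' k') \<oplus>\<^bsub>T\<^esub> (t k k \<ominus>\<^bsub>T\<^esub> t k' k))"
    unfolding eqs(5) by (simp add: smult minus T.smult_add)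
  also have "\<dots> = ?c \<odot>\<^bsub>T\<^esub> (?K \<ominus>\<^bsub>T\<^esub> ?K')" by (subst telescope) simp_all
  finally have comm: "?E \<otimes>\<^bsub>T\<^esub> ?F \<ominus>\<^bsub>T\<^esub> ?F \<otimes>\<^bsub>T\<^esub> ?E = ?c \<odot>\<^bsub>T\<^esub> (?K \<ominus>\<^bsub>T\<^esub> ?K')" .
  have "?K \<in> carrier T" "?K' \<in> carrier T" "?E \<in> carrier T" "?F \<in> carrier T" by simp_all
  note clT = this[unfolded k_def k'_def e_def f_def]
  have "uq_equations q T ?K ?K' ?E ?F"
    using comm unfolding uq_equations_def
    by (simp add: mult eqs smult T.smult_add T.l_distr T.r_distr P.tensor_one[folded t_def T_def U_def])
  then obtain \<Delta> where \<Delta>: "\<Delta> \<in> alg_hom U T" "\<Delta> k = ?K" "\<Delta> k' = ?K'" "\<Delta> e = ?E" "\<Delta> f = ?F"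
    using uq_hom_exists[OF T.calg_axioms, of ?K ?K' ?E ?F q] clT
    by (auto simp: k_def k'_def e_def f_def U_def[symmetric])
  have "uq_comult q = \<Delta>"
    unfolding uq_comult_def Let_def
  proof (rule the_equality, goal_cases)
    case 1
    show ?case using \<Delta> unfolding k_def k'_def e_def f_def U_def T_def t_def by blast
  next
    case (2 \<Delta>')
    then show ?case
      using \<Delta> unfolding k_def k'_def e_def f_def U_def T_def t_def
      by (intro uq_hom_eqI[OF _ _ P.tensor_calg, of \<Delta>' q \<Delta>]) auto
  qed
  with \<Delta> show "uq_comult q \<in> alg_hom U T"
    and "uq_comult q (uq_k q) = t (uq_k q) (uq_k q)"
    and "uq_comult q (uq_kinv q) = t (uq_kinv q) (uq_kinv q)"
    and "uq_comult q (uq_e q) = t \<one>\<^bsub>U\<^esub> (uq_e q) \<oplus>\<^bsub>T\<^esub> t (uq_e q) (uq_k q)"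
    and "uq_comult q (uq_f q) = t (uq_f q) \<one>\<^bsub>U\<^esub> \<oplus>\<^bsub>T\<^esub> t (uq_kinv q) (uq_f q)"
    by (simp_all add: k_def k'_def e_def f_def)
qed

lemma uq_counit:
  shows "uq_counit q \<in> alg_hom (uq_alg q) complex_alg"
    and "uq_counit q (uq_k q) = 1" "uq_counit q (uq_kinv q) = 1"
    and "uq_counit q (uq_e q) = 0" "uq_counit q (uq_f q) = 0"
proof -
  interpret C: calg complex_alg by (rule complex_alg_calg)
  have minus: "a \<ominus>\<^bsub>complex_alg\<^esub> b = a - b" for a b
    using C.minus_eq_smult[of a b] by (simp add: complex_alg_def)
  have "uq_equations q complex_alg 1 1 0 0"
    unfolding uq_equations_def minus by (simp add: complex_alg_def)
  then obtain \<epsilon> where \<epsilon>: "\<epsilon> \<in> alg_hom (uq_alg q) complex_alg" "\<epsilon> (uq_k q) = 1"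
    "\<epsilon> (uq_kinv q) = 1" "\<epsilon> (uq_e q) = 0" "\<epsilon> (uq_f q) = 0"
    using uq_hom_exists[OF complex_alg_calg, of 1 1 0 0 q] by (auto simp: complex_alg_def)
  have "uq_counit q = \<epsilon>"
    unfolding uq_counit_def
  proof (rule the_equality, goal_cases)
    case (2 \<epsilon>')
    then show ?case using \<epsilon> by (intro uq_hom_eqI[OF _ _ complex_alg_calg, of \<epsilon>' q \<epsilon>]) auto
  qed (use \<epsilon> in blast)
  with \<epsilon> show "uq_counit q \<in> alg_hom (uq_alg q) complex_alg"
    "uq_counit q (uq_k q) = 1" "uq_counit q (uq_kinv q) = 1"
    "uq_counit q (uq_e q) = 0" "uq_counit q (uq_f q) = 0" by simp_all
qed

end


section \<open>Module algebras over the quantum group\<close>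

lemma Uq_simps:
  "carrier (Uq_sl2 q) = carrier (uq_alg q)" "comult (Uq_sl2 q) = uq_comult q"
  "counit (Uq_sl2 q) = uq_counit q"
  by (simp_all add: Uq_sl2_def)

lemma alg_hom_Uq: "alg_hom (Uq_sl2 q) B = alg_hom (uq_alg q) B"
  by (simp add: alg_hom_def ring_hom_def Uq_sl2_def)

lemma monoid_alg_Uq:
  "monoid_alg (Uq_sl2 q \<times>\<times> Uq_sl2 q) = monoid_alg (uq_alg q \<times>\<times> uq_alg q)"
  by (simp add: monoid_alg_def DirProd_def Uq_sl2_def)

lemma tensor_null_Uq: "tensor_null (Uq_sl2 q) (Uq_sl2 q) = tensor_null (uq_alg q) (uq_alg q)"
proof -
  have "bilinear_relations (Uq_sl2 q) (Uq_sl2 q) = bilinear_relations (uq_alg q) (uq_alg q)"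
    by (simp add: bilinear_relations_def Uq_sl2_def)
  then show ?thesis by (simp add: tensor_null_def monoid_alg_Uq)
qed

lemma tensor_alg_Uq: "tensor_alg (Uq_sl2 q) (Uq_sl2 q) = tensor_alg (uq_alg q) (uq_alg q)"
  by (simp add: tensor_alg_def tensor_null_Uq monoid_alg_Uq)

lemma pure_tensor_Uq: "pure_tensor (Uq_sl2 q) (Uq_sl2 q) = pure_tensor (uq_alg q) (uq_alg q)"
  by (simp add: pure_tensor_def tensor_null_Uq monoid_alg_Uq fun_eq_iff)

text \<open>
  What the module algebra axioms say for the generators: \<open>k\<close> acts by an endomorphism, and \<open>e\<close> and
  \<open>f\<close> act by skew derivations.
\<close>

definition skew_leibniz ::
    "complex \<Rightarrow> (complex, 'a, 'n) module_scheme \<Rightarrow> (uq \<Rightarrow> 'a \<Rightarrow> 'a) \<Rightarrow> bool" where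
  "skew_leibniz q A \<pi> \<longleftrightarrow> (\<forall>a\<in>carrier A. \<forall>b\<in>carrier A.
       \<pi> (uq_k q) (a \<otimes>\<^bsub>A\<^esub> b) = \<pi> (uq_k q) a \<otimes>\<^bsub>A\<^esub> \<pi> (uq_k q) b \<and>
       \<pi> (uq_e q) (a \<otimes>\<^bsub>A\<^esub> b) = a \<otimes>\<^bsub>A\<^esub> \<pi> (uq_e q) b \<oplus>\<^bsub>A\<^esub> \<pi> (uq_e q) a \<otimes>\<^bsub>A\<^esub> \<pi> (uq_k q) b \<and>
       \<pi> (uq_f q) (a \<otimes>\<^bsub>A\<^esub> b) = \<pi> (uq_f q) a \<otimes>\<^bsub>A\<^esub> b \<oplus>\<^bsub>A\<^esub> \<pi> (uq_kinv q) a \<otimes>\<^bsub>A\<^esub> \<pi> (uq_f q) b) \<and>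
     \<pi> (uq_k q) \<one>\<^bsub>A\<^esub> = \<one>\<^bsub>A\<^esub> \<and> \<pi> (uq_e q) \<one>\<^bsub>A\<^esub> = \<zero>\<^bsub>A\<^esub> \<and> \<pi> (uq_f q) \<one>\<^bsub>A\<^esub> = \<zero>\<^bsub>A\<^esub>"

text \<open>
  Only a representation; compatibility with the product of \<open>A\<close> enters as \<open>skew_leibniz\<close>.
\<close>

locale uq_action =
  fixes q :: complex and A :: "(complex, 'a, 'n) module_scheme" (structure)
    and \<pi> :: "uq \<Rightarrow> 'a \<Rightarrow> 'a"
  assumes q0: "q \<noteq> 0" and A: "calg A" and hom: "\<pi> \<in> alg_hom (uq_alg q) (End_alg A)"
begin

sublocale A: calg A by (rule A)
sublocale U: calg "uq_alg q" by (rule uq_alg_calg)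
sublocale tensor: calg_pair "uq_alg q" "uq_alg q" ..

abbreviation "U \<equiv> uq_alg q"

lemma act_End: "h \<in> carrier U \<Longrightarrow> \<pi> h \<in> carrier (End_alg A)"
  using lin_mapD(1)[OF alg_homD(1)[OF hom]] .

lemma act_lin: "h \<in> carrier U \<Longrightarrow> lin_map A A (\<pi> h)"
  using act_End by (simp add: End_carrier_iff)

lemma act_closed [simp]: "h \<in> carrier U \<Longrightarrow> a \<in> carrier A \<Longrightarrow> \<pi> h a \<in> carrier A"
  using act_lin by (rule lin_mapD(1))

lemmas act_simps = lin_mapD(2,3)[OF act_lin]

lemma act_one [simp]: "a \<in> carrier A \<Longrightarrow> \<pi> \<one>\<^bsub>U\<^esub> a = a"
  by (simp add: alg_homD(2)[OF hom] End_simps)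

lemma act_mult: "h \<in> carrier U \<Longrightarrow> g \<in> carrier U \<Longrightarrow> a \<in> carrier A \<Longrightarrow> \<pi> (h \<otimes>\<^bsub>U\<^esub> g) a = \<pi> h (\<pi> g a)"
  by (simp add: alg_homD(3)[OF hom] End_simps)

lemma act_add:
  "h \<in> carrier U \<Longrightarrow> g \<in> carrier U \<Longrightarrow> a \<in> carrier A \<Longrightarrow> \<pi> (h \<oplus>\<^bsub>U\<^esub> g) a = \<pi> h a \<oplus> \<pi> g a"
  by (simp add: lin_mapD(2)[OF alg_homD(1)[OF hom]] End_simps)

lemma act_smult: "h \<in> carrier U \<Longrightarrow> a \<in> carrier A \<Longrightarrow> \<pi> (c \<odot>\<^bsub>U\<^esub> h) a = c \<odot> \<pi> h a"
  by (simp add: lin_mapD(3)[OF alg_homD(1)[OF hom]] End_simps)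

lemma act_minus:
  "h \<in> carrier U \<Longrightarrow> g \<in> carrier U \<Longrightarrow> a \<in> carrier A \<Longrightarrow> \<pi> (h \<ominus>\<^bsub>U\<^esub> g) a = \<pi> h a \<ominus> \<pi> g a"
  by (simp add: U.minus_eq_smult A.minus_eq_smult act_add act_smult)

lemma act_k_kinv [simp]:
  assumes "a \<in> carrier A"
  shows "\<pi> (uq_k q) (\<pi> (uq_kinv q) a) = a" "\<pi> (uq_kinv q) (\<pi> (uq_k q) a) = a"
  using uq_alg_equations[of q] assms by (simp_all add: uq_equations_def flip: act_mult)

text \<open>
  The linear extension of \<open>h \<otimes> g \<mapsto> h(a) g(b)\<close> to the tensor square. Because it is defined on all
  of the tensor square, the value at \<open>\<Delta>(h)\<close> does not depend on how \<open>\<Delta>(h)\<close> is written as a sum of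
  pure tensors.
\<close>

definition tensor_action :: "'a \<Rightarrow> 'a \<Rightarrow> (uq \<times> uq \<Rightarrow>\<^sub>0 complex) set \<Rightarrow> 'a" where
  "tensor_action a b = (SOME L. lin_map (tensor_alg U U) A L \<and>
     (\<forall>h\<in>carrier U. \<forall>g\<in>carrier U. L (pure_tensor U U h g) = \<pi> h a \<otimes> \<pi> g b))"

lemma tensor_action:
  assumes "a \<in> carrier A" "b \<in> carrier A"
  shows "lin_map (tensor_alg U U) A (tensor_action a b)"
    and "h \<in> carrier U \<Longrightarrow> g \<in> carrier U \<Longrightarrow> tensor_action a b (pure_tensor U U h g) = \<pi> h a \<otimes> \<pi> g b"
proof -
  have "\<exists>L. lin_map (tensor_alg U U) A L \<and>
      (\<forall>h\<in>carrier U. \<forall>g\<in>carrier U. L (pure_tensor U U h g) = \<pi> h a \<otimes> \<pi> g b)"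
    using assms
    by (intro tensor.tensor_lift A) (auto simp: lin_map_def act_add act_smult A.l_distr A.r_distr
        A.smult_mult_left A.smult_mult_right)
  from someI_ex[OF this] show "lin_map (tensor_alg U U) A (tensor_action a b)"
    and "h \<in> carrier U \<Longrightarrow> g \<in> carrier U \<Longrightarrow> tensor_action a b (pure_tensor U U h g) = \<pi> h a \<otimes> \<pi> g b"
    unfolding tensor_action_def by blast+
qed

lemma tensor_action_mult_tensor:
  assumes ab: "a \<in> carrier A" "b \<in> carrier A" and hg: "h \<in> carrier U" "g \<in> carrier U"
    and X: "X \<in> carrier (tensor_alg U U)"
  shows "tensor_action a b (X \<otimes>\<^bsub>tensor_alg U U\<^esub> pure_tensor U U h g) = tensor_action (\<pi> h a) (\<pi> g b) X"
  using X
proof (induction rule: tensor.tensor_induct)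
  case zero
  show ?case
    using assms lin_map_zero[OF tensor_action(1) tensor.tensor_calg A] by simp
next
  case (add h' g' c X)
  note lin = lin_mapD(2,3)[OF tensor_action(1)[OF ab]]
    and lin' = lin_mapD(2,3)[OF tensor_action(1)[OF act_closed[OF hg(1) ab(1)] act_closed[OF hg(2) ab(2)]]]
  show ?case
    using add hg ab
    by (simp add: tensor.T.l_distr tensor.T.smult_mult_left tensor.tensor_mult lin lin' tensor_action(2) act_mult)
qed

definition comult_compatible :: "uq \<Rightarrow> bool" where
  "comult_compatible h \<longleftrightarrow> (\<forall>a\<in>carrier A. \<forall>b\<in>carrier A. tensor_action a b (uq_comult q h) = \<pi> h (a \<otimes> b))"

lemma comult_closed: "h \<in> carrier U \<Longrightarrow> uq_comult q h \<in> carrier (tensor_alg U U)"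
  using lin_mapD(1)[OF alg_homD(1)[OF uq_comult(1)[OF q0]]] .

lemma comult_compatible_mult_tensor:
  assumes h: "h \<in> carrier U" "comult_compatible h" and ab: "a \<in> carrier A" "b \<in> carrier A"
    and Y: "Y \<in> carrier (tensor_alg U U)"
  shows "tensor_action a b (uq_comult q h \<otimes>\<^bsub>tensor_alg U U\<^esub> Y) = \<pi> h (tensor_action a b Y)"
  using Y
proof (induction rule: tensor.tensor_induct)
  case zero
  show ?case
    using comult_closed[OF h(1)] lin_map_zero[OF tensor_action(1)[OF ab] tensor.tensor_calg A]
      lin_map_zero[OF act_lin[OF h(1)] A A] by simp
next
  case (add h' g' c Y)
  note lin = lin_mapD[OF tensor_action(1)[OF ab]]
  show ?case
    using add h ab comult_closed[OF h(1)]
    by (simp add: tensor.T.r_distr tensor.T.smult_mult_right lin tensor_action(2) act_simps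
        tensor_action_mult_tensor) (simp add: comult_compatible_def)
qed

text \<open>
  Multiplying by \<open>s' \<otimes> s''\<close> on the right replaces \<open>(a, b)\<close> by \<open>(s'(a), s''(b))\<close>, so the condition on \<open>h\<close>, applied to these elements, shows
  that multiplying by \<open>\<Delta>(h)\<close> on the left amounts to applying \<open>h\<close> to the result; then the
  condition on \<open>g\<close> applies.
\<close>

lemma comult_compatible_mult:
  assumes "h \<in> carrier U" "g \<in> carrier U" "comult_compatible h" "comult_compatible g"
  shows "comult_compatible (h \<otimes>\<^bsub>U\<^esub> g)"
  using assms comult_compatible_mult_tensor[OF assms(1,3) _ _ comult_closed[OF assms(2)]]
  by (auto simp: comult_compatible_def alg_homD(3)[OF uq_comult(1)[OF q0]] act_mult)

lemma skew_leibniz_kinv: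
  assumes "skew_leibniz q A \<pi>" and ab: "a \<in> carrier A" "b \<in> carrier A"
  shows "\<pi> (uq_kinv q) (a \<otimes> b) = \<pi> (uq_kinv q) a \<otimes> \<pi> (uq_kinv q) b"
proof -
  have "a \<otimes> b = \<pi> (uq_k q) (\<pi> (uq_kinv q) a \<otimes> \<pi> (uq_kinv q) b)"
    using assms by (simp add: skew_leibniz_def)
  then show ?thesis using act_k_kinv(2) ab by (metis A.m_closed act_closed uq_gens_closed(2))
qed

lemma skew_leibniz_imp_compatible:
  assumes leibniz: "skew_leibniz q A \<pi>" and h: "h \<in> carrier U"
  shows "comult_compatible h" "\<pi> h \<one> = uq_counit q h \<odot> \<one>"
proof -
  note Lb = leibniz[unfolded skew_leibniz_def]
  note \<Delta> = uq_comult[OF q0] and \<Delta>lin = lin_mapD(2,3)[OF alg_homD(1)[OF uq_comult(1)[OF q0]]]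
  note kinv = skew_leibniz_kinv[OF leibniz]
  show "comult_compatible h"
    using h
  proof (induction rule: uq_induct)
    case one
    show ?case
      by (simp add: comult_compatible_def alg_homD(2)[OF \<Delta>(1)] tensor.tensor_one tensor_action(2))
  next
    case (add h g)
    then show ?case
      by (auto simp: comult_compatible_def \<Delta>lin lin_mapD(2)[OF tensor_action(1)] comult_closed act_add)
  next
    case (smult c h)
    then show ?case
      by (auto simp: comult_compatible_def \<Delta>lin lin_mapD(3)[OF tensor_action(1)] comult_closed act_smult)
  next
    case (mult h g)
    then show ?case by (simp add: comult_compatible_mult)
  qed (use Lb kinv in \<open>simp_all add: comult_compatible_def \<Delta> tensor_action(2) lin_mapD(2)[OF tensor_action(1)]\<close>)
  note \<epsilon> = uq_counit[OF q0] and \<epsilon>lin = lin_mapD(2,3)[OF alg_homD(1)[OF uq_counit(1)[OF q0]]]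
  have kinv1: "\<pi> (uq_kinv q) \<one> = \<one>"
    using Lb act_k_kinv(2)[OF A.one_closed] by simp
  show "\<pi> h \<one> = uq_counit q h \<odot> \<one>"
    using h
  proof (induction rule: uq_induct)
    case one
    show ?case using alg_homD(2)[OF \<epsilon>(1)] by (simp add: complex_alg_def)
  next
    case (add h g)
    then show ?case using \<epsilon>lin(1)[of h g]
      by (simp add: complex_alg_def act_add A.add_smult)
  next
    case (smult c h)
    then show ?case using \<epsilon>lin(2)[of h c]
      by (simp add: complex_alg_def act_smult A.smult_smult)
  next
    case (mult h g)
    then show ?case using alg_homD(3)[OF \<epsilon>(1), of h g]
      by (simp add: complex_alg_def act_mult act_simps A.smult_smult mult.commute)
  qed (use Lb kinv1 in \<open>simp_all add: \<epsilon>\<close>)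
qed

end

text \<open>
  From left to right, \<open>\<Delta>(k)\<close>, \<open>\<Delta>(e)\<close> and \<open>\<Delta>(f)\<close> are written as sums of one or two pure tensors.
  From right to left, the elements that are compatible with the product form a subalgebra, which
  contains the generators.
\<close>

theorem module_alg_structures_Uq_iff:
  assumes q0: "q \<noteq> 0" and A: "calg A"
  shows "\<pi> \<in> module_alg_structures (Uq_sl2 q) A \<longleftrightarrow>
    \<pi> \<in> alg_hom (uq_alg q) (End_alg A) \<and> skew_leibniz q A \<pi>"
proof (cases "\<pi> \<in> alg_hom (uq_alg q) (End_alg A)")
  case False
  then show ?thesis by (simp add: module_alg_structures_def alg_hom_Uq)
next
  case True
  then interpret uq_action q A \<pi> using q0 A by (simp add: uq_action_def)
  show ?thesis
  proof
    assume "\<pi> \<in> module_alg_structures (Uq_sl2 q) A"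
    then have mult: "\<pi> h (a \<otimes>\<^bsub>A\<^esub> b) = (\<Oplus>\<^bsub>A\<^esub> i\<in>{..<n}. \<pi> (h' i) a \<otimes>\<^bsub>A\<^esub> \<pi> (h'' i) b)"
      if "h \<in> carrier U" "a \<in> carrier A" "b \<in> carrier A" "h' \<in> {..<n} \<rightarrow> carrier U"
        "h'' \<in> {..<n} \<rightarrow> carrier U"
        "uq_comult q h = (\<Oplus>\<^bsub>tensor_alg U U\<^esub> i\<in>{..<n}. pure_tensor U U (h' i) (h'' i))"
      for h a b and n :: nat and h' h''
      using that unfolding module_alg_structures_def Uq_simps tensor_alg_Uq pure_tensor_Uq by blast
    have unit: "\<pi> h \<one>\<^bsub>A\<^esub> = uq_counit q h \<odot>\<^bsub>A\<^esub> \<one>\<^bsub>A\<^esub>" if "h \<in> carrier U" for h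
      using that \<open>\<pi> \<in> module_alg_structures (Uq_sl2 q) A\<close>
      unfolding module_alg_structures_def Uq_simps by blast
    have one_term: "\<pi> h (a \<otimes>\<^bsub>A\<^esub> b) = \<pi> h1 a \<otimes>\<^bsub>A\<^esub> \<pi> h2 b"
      if "uq_comult q h = pure_tensor U U h1 h2" "h \<in> carrier U" "h1 \<in> carrier U" "h2 \<in> carrier U"
        "a \<in> carrier A" "b \<in> carrier A" for h h1 h2 a b
      using mult[of h a b "\<lambda>_. h1" 1 "\<lambda>_. h2"] that by (simp add: lessThan_Suc)
    \<comment> \<open>Index 1 carries the first summand: the sum over \<open>{..<2}\<close> unfolds from its last index.\<close>
    have two_terms: "\<pi> h (a \<otimes>\<^bsub>A\<^esub> b) = \<pi> h1 a \<otimes>\<^bsub>A\<^esub> \<pi> h2 b \<oplus>\<^bsub>A\<^esub> \<pi> g1 a \<otimes>\<^bsub>A\<^esub> \<pi> g2 b"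
      if "uq_comult q h = pure_tensor U U h1 h2 \<oplus>\<^bsub>tensor_alg U U\<^esub> pure_tensor U U g1 g2"
        "h \<in> carrier U" "h1 \<in> carrier U" "h2 \<in> carrier U" "g1 \<in> carrier U" "g2 \<in> carrier U"
        "a \<in> carrier A" "b \<in> carrier A" for h h1 h2 g1 g2 a b
      using mult[of h a b "\<lambda>i. if i = 1 then h1 else g1" 2 "\<lambda>i. if i = 1 then h2 else g2"] that
      by (simp add: lessThan_Suc numeral_2_eq_2 Pi_iff)
    note \<Delta> = uq_comult[OF q0]
    have "skew_leibniz q A \<pi>"
      using one_term[OF \<Delta>(2)] two_terms[OF \<Delta>(4)] two_terms[OF \<Delta>(5)] unit
      by (simp add: skew_leibniz_def uq_counit[OF q0])
    with True show "\<pi> \<in> alg_hom (uq_alg q) (End_alg A) \<and> skew_leibniz q A \<pi>" by blast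
  next
    assume "\<pi> \<in> alg_hom (uq_alg q) (End_alg A) \<and> skew_leibniz q A \<pi>"
    then have leibniz: "skew_leibniz q A \<pi>" by blast
    have "\<pi> h (a \<otimes>\<^bsub>A\<^esub> b) = (\<Oplus>\<^bsub>A\<^esub> i\<in>{..<n}. \<pi> (h' i) a \<otimes>\<^bsub>A\<^esub> \<pi> (h'' i) b)"
      if "h \<in> carrier U" "a \<in> carrier A" "b \<in> carrier A" "h' \<in> {..<n} \<rightarrow> carrier U"
        "h'' \<in> {..<n} \<rightarrow> carrier U"
        "uq_comult q h = (\<Oplus>\<^bsub>tensor_alg U U\<^esub> i\<in>{..<n}. pure_tensor U U (h' i) (h'' i))"
      for h a b and n :: nat and h' h''
    proof -
      have "\<pi> h (a \<otimes>\<^bsub>A\<^esub> b) = tensor_action a b (uq_comult q h)"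
        using skew_leibniz_imp_compatible(1)[OF leibniz] that(1-3) by (simp add: comult_compatible_def)
      also have "\<dots> = (\<Oplus>\<^bsub>A\<^esub> i\<in>{..<n}. tensor_action a b (pure_tensor U U (h' i) (h'' i)))"
        unfolding that(6) using that
        by (intro lin_map_finsum[OF tensor_action(1) tensor.tensor_calg A]) (auto simp: Pi_iff)
      also have "\<dots> = (\<Oplus>\<^bsub>A\<^esub> i\<in>{..<n}. \<pi> (h' i) a \<otimes>\<^bsub>A\<^esub> \<pi> (h'' i) b)"
        using that by (intro A.finsum_cong') (auto simp: Pi_iff tensor_action(2))
      finally show ?thesis .
    qed
    then show "\<pi> \<in> module_alg_structures (Uq_sl2 q) A"
      using True skew_leibniz_imp_compatible(2)[OF leibniz]
      unfolding module_alg_structures_def Uq_simps tensor_alg_Uq pure_tensor_Uq alg_hom_Uq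
      by blast
  qed
qed


section \<open>Quantum polynomials in coordinates\<close>

abbreviation qmul :: "complex \<Rightarrow> (nat \<times> nat \<Rightarrow>\<^sub>0 complex) \<Rightarrow> (nat \<times> nat \<Rightarrow>\<^sub>0 complex) \<Rightarrow> (nat \<times> nat \<Rightarrow>\<^sub>0 complex)" where
  "qmul q \<equiv> tw_mult (+) (\<lambda>u v. q ^ (snd u * fst v))"

definition exponent_monoid :: "(nat \<times> nat) monoid" where
  "exponent_monoid = \<lparr>carrier = UNIV, mult = (+), one = 0\<rparr>"

abbreviation qpoly_alg :: "complex \<Rightarrow> (complex, nat \<times> nat \<Rightarrow>\<^sub>0 complex) module" where
  "qpoly_alg q \<equiv> twisted_alg exponent_monoid (\<lambda>u v. q ^ (snd u * fst v))"

interpretation qpoly: two_cocycle exponent_monoid "\<lambda>u v. q ^ (snd u * fst v)" for q :: complex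
  by unfold_locales
    (auto simp: exponent_monoid_def algebra_simps zero_prod_def simp flip: power_add)

lemma qpoly_alg_simps [simp]:
  "carrier (qpoly_alg q) = UNIV" "mult (qpoly_alg q) = qmul q" "one (qpoly_alg q) = single 0 1"
  "zero (qpoly_alg q) = 0" "add (qpoly_alg q) = (+)" "smult (qpoly_alg q) = scale"
  by (simp_all add: twisted_alg_def exponent_monoid_def)

lemma qmul_assoc: "qmul q (qmul q p r) s = qmul q p (qmul q r s)"
  using qpoly.tw_mult_assoc[of p r s q] by (simp add: exponent_monoid_def)

lemma qmul_one: "qmul q (single 0 1) p = p" "qmul q p (single 0 1) = p"
  using qpoly.tw_mult_one[of p q] by (simp_all add: exponent_monoid_def)

abbreviation qX :: "nat \<times> nat \<Rightarrow>\<^sub>0 complex" where "qX \<equiv> single (1, 0) 1"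
abbreviation qY :: "nat \<times> nat \<Rightarrow>\<^sub>0 complex" where "qY \<equiv> single (0, 1) 1"

lemma lookup_qmul:
  "lookup (qmul q p r) w = (\<Sum>(u, v)\<in>keys p \<times> keys r.
     if u + v = w then q ^ (snd u * fst v) * (lookup p u * lookup r v) else 0)"
  by (simp add: tw_mult_def lookup_sum lookup_single when_def sum.cartesian_product
      case_prod_unfold)

text \<open>
  An additive weight that separates exponents plays the part of a monomial order: the leading term
  of a product is the product of the leading terms, with a nonzero power of \<open>q\<close>. The lowest terms
  are treated by negating the weight.
\<close>

lemma lookup_qmul_extremal:
  fixes f :: "nat \<times> nat \<Rightarrow> int"
  assumes q: "q \<noteq> 0"
    and f: "\<And>u v. f (u + v) = f u + f v" "inj_on f (keys p \<union> keys r)"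
    and u: "u \<in> keys p" "\<And>u'. u' \<in> keys p \<Longrightarrow> f u' \<le> f u"
    and v: "v \<in> keys r" "\<And>v'. v' \<in> keys r \<Longrightarrow> f v' \<le> f v"
  shows "lookup (qmul q p r) (u + v) \<noteq> 0"
proof -
  have only: "u' = u \<and> v' = v" if "u' \<in> keys p" "v' \<in> keys r" "u' + v' = u + v" for u' v'
  proof -
    have "f u' + f v' = f u + f v" using f(1) that(3) by metis
    then have "f u' = f u" "f v' = f v" using u(2)[OF that(1)] v(2)[OF that(2)] by linarith+
    then show ?thesis using f(2) u(1) v(1) that by (auto dest: inj_onD)
  qed
  have "lookup (qmul q p r) (u + v) = (\<Sum>(u', v')\<in>{(u, v)}.
     if u' + v' = u + v then q ^ (snd u' * fst v') * (lookup p u' * lookup r v') else 0)"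
    unfolding lookup_qmul
  proof (intro sum.mono_neutral_right ballI)
    fix x assume x: "x \<in> keys p \<times> keys r - {(u, v)}"
    then have "fst x + snd x \<noteq> u + v" using only[of "fst x" "snd x"] by (cases x) auto
    then show "(case x of (u', v') \<Rightarrow> if u' + v' = u + v
        then q ^ (snd u' * fst v') * (lookup p u' * lookup r v') else 0) = 0"
      by (simp add: case_prod_unfold)
  qed (use u(1) v(1) in auto)
  then show ?thesis using q u(1) v(1) by (simp add: in_keys_iff)
qed

text \<open>
  On finitely many exponents the lexicographic order is given by \<open>N m + n\<close> for large \<open>N\<close>.
\<close>

lemma lex_weight_exists:
  fixes S :: "(nat \<times> nat) set"
  assumes "finite S"
  shows "\<exists>f :: nat \<times> nat \<Rightarrow> int. (\<forall>u v. f (u + v) = f u + f v) \<and> inj_on f S"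
proof -
  obtain N where N: "\<And>u. u \<in> S \<Longrightarrow> snd u < N"
    using finite_nat_set_iff_bounded[of "snd ` S"] assms by auto
  define f where "f u = int (N * fst u + snd u)" for u :: "nat \<times> nat"
  have "u = v" if "u \<in> S" "v \<in> S" "f u = f v" for u v
  proof -
    have eq: "N * fst u + snd u = N * fst v + snd v" 
      using that(3) unfolding f_def of_nat_eq_iff .
    have "fst u = (N * fst u + snd u) div N" "fst v = (N * fst v + snd v) div N"
      using N[OF that(1)] N[OF that(2)] by simp_all
    then show ?thesis using eq by (simp add: prod_eq_iff)
  qed
  then have "inj_on f S" by (rule inj_onI)
  moreover have "f (u + v) = f u + f v" for u v by (simp add: f_def algebra_simps)
  ultimately show ?thesis by blast
qed

lemma keys_maximum:
  fixes f :: "'u \<Rightarrow> int"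
  assumes "p \<noteq> 0"
  shows "\<exists>u\<in>keys p. \<forall>u'\<in>keys p. f u' \<le> f u"
proof -
  have "finite (f ` keys p)" "f ` keys p \<noteq> {}" using assms by auto
  then have "Max (f ` keys p) \<in> f ` keys p" by (rule Max_in)
  then obtain u where "u \<in> keys p" "f u = Max (f ` keys p)" by auto
  then show ?thesis by (intro bexI[of _ u]) auto
qed

lemma qmul_eq_zero:
  assumes "q \<noteq> 0" "qmul q p r = 0"
  shows "p = 0 \<or> r = 0"
proof (rule ccontr)
  assume ne: "\<not> (p = 0 \<or> r = 0)"
  obtain f :: "nat \<times> nat \<Rightarrow> int" where f: "\<And>u v. f (u + v) = f u + f v" "inj_on f (keys p \<union> keys r)"
    using lex_weight_exists[OF finite_UnI[OF finite_keys finite_keys]] by blast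
  obtain u v where "u \<in> keys p" "\<forall>u'\<in>keys p. f u' \<le> f u" "v \<in> keys r" "\<forall>v'\<in>keys r. f v' \<le> f v"
    using keys_maximum[of p f] keys_maximum[of r f] ne by blast
  then have "lookup (qmul q p r) (u + v) \<noteq> 0"
    using lookup_qmul_extremal[OF assms(1) f] by blast
  then show False using assms(2) by simp
qed

text \<open>
  The largest weight of the product is the sum of the largest weights of the factors, and the same
  holds for the smallest weights. If the two agree for the product, they agree for each factor.
\<close>

lemma qmul_eq_monomial:
  assumes q: "q \<noteq> 0" and prod: "qmul q p r = single w c" "c \<noteq> 0"
  shows "\<exists>u a v b. p = single u a \<and> r = single v b \<and> u + v = w \<and> a \<noteq> 0 \<and> b \<noteq> 0"
proof -
  have "single w c \<noteq> 0" using prod(2) by (simp flip: keys_eq_empty)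
  then have ne: "p \<noteq> 0" "r \<noteq> 0" using prod(1) by auto
  obtain f :: "nat \<times> nat \<Rightarrow> int" where f: "\<And>u v. f (u + v) = f u + f v" "inj_on f (keys p \<union> keys r)"
    using lex_weight_exists[OF finite_UnI[OF finite_keys finite_keys]] by blast
  define g where "g u = - f u" for u
  have g: "\<And>u v. g (u + v) = g u + g v" "inj_on g (keys p \<union> keys r)"
    using f by (auto simp: g_def inj_on_def)
  obtain u v where uv: "u \<in> keys p" "\<forall>u'\<in>keys p. f u' \<le> f u" "v \<in> keys r" "\<forall>v'\<in>keys r. f v' \<le> f v"
    using keys_maximum[of p f] keys_maximum[of r f] ne by blast
  obtain s t where st: "s \<in> keys p" "\<forall>u'\<in>keys p. g u' \<le> g s" "t \<in> keys r" "\<forall>v'\<in>keys r. g v' \<le> g t"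
    using keys_maximum[of p g] keys_maximum[of r g] ne by blast
  have "lookup (qmul q p r) (u + v) \<noteq> 0" "lookup (qmul q p r) (s + t) \<noteq> 0"
    by (rule lookup_qmul_extremal[OF q f]; use uv in blast)
      (rule lookup_qmul_extremal[OF q g]; use st in blast)
  then have w: "u + v = w" "s + t = w"
    by (simp_all add: prod lookup_single when_def split: if_splits)
  then have "f u + f v = f s + f t" using f(1) by metis
  moreover have "f s \<le> f u" "f t \<le> f v" using uv st by blast+
  ultimately have eq: "f s = f u" "f t = f v" by linarith+
  have "f u' = f u" if "u' \<in> keys p" for u'
    using that uv(2) st(2) eq by (force simp: g_def)
  then have "keys p = {u}" using f(2) uv(1) by (auto dest: inj_onD)
  moreover have "f v' = f v" if "v' \<in> keys r" for v'
    using that uv(4) st(4) eq by (force simp: g_def)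
  then have "keys r = {v}" using f(2) uv(3) by (auto dest: inj_onD)
  moreover have "p = single u (lookup p u)" if "keys p = {u}" for p :: "nat \<times> nat \<Rightarrow>\<^sub>0 complex" and u
    by (rule poly_mapping_eqI) (use that in \<open>auto simp: lookup_single when_def in_keys_iff\<close>)
  ultimately show ?thesis using w(1) uv by (metis in_keys_iff)
qed

text \<open>
  Modulo \<open>x\<close>, and also modulo \<open>y\<close>, the quantum plane is commutative.
\<close>

lemma keys_commutator: "keys (qmul q p r - qmul q r p) \<subseteq> {u. fst u \<ge> 1 \<and> snd u \<ge> 1}"
proof -
  let ?C = "{u :: nat \<times> nat. fst u \<ge> 1 \<and> snd u \<ge> 1}"
  have sum: "keys (a + b) \<subseteq> ?C" if "keys a \<subseteq> ?C" "keys b \<subseteq> ?C" for a b :: "nat \<times> nat \<Rightarrow>\<^sub>0 complex"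
    using that keys_add[of a b] by blast
  show ?thesis
  proof (induction p rule: poly_mapping_induct)
    case (add u a p)
    have "keys (qmul q (single u a) r - qmul q r (single u a)) \<subseteq> ?C"
    proof (induction r rule: poly_mapping_induct)
      case v: (add v b r)
      have "qmul q (single u a) (single v b) - qmul q (single v b) (single u a) =
          single (u + v) ((q ^ (snd u * fst v) - q ^ (snd v * fst u)) * (a * b))"
        by (simp add: single_diff[symmetric] algebra_simps)
      moreover have "u + v \<in> ?C" if "q ^ (snd u * fst v) - q ^ (snd v * fst u) \<noteq> 0"
        using that by (cases "snd u * fst v = 0"; cases "snd v * fst u = 0") auto
      ultimately have "keys (qmul q (single u a) (single v b) - qmul q (single v b) (single u a)) \<subseteq> ?C"
        by (cases "q ^ (snd u * fst v) - q ^ (snd v * fst u) = 0") simp_all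
      from sum[OF this v] show ?case
        by (simp add: tw_mult_add_left tw_mult_add_right algebra_simps)
    qed simp
    from sum[OF this add] show ?case
      by (simp add: tw_mult_add_left tw_mult_add_right algebra_simps)
  qed simp
qed

lemma multiple_of_XY:
  assumes "q \<noteq> 0" "keys p \<subseteq> {u. fst u \<ge> 1 \<and> snd u \<ge> 1}"
  shows "\<exists>s. p = qmul q (single (1, 1) 1) s"
  using assms(2)
proof (induction p rule: poly_mapping_induct_on)
  case zero
  show ?case by (intro exI[of _ 0]) simp
next
  case (add u c p)
  then obtain s where s: "p = qmul q (single (1, 1) 1) s" by blast
  \<comment> \<open>For \<open>u = (m, n)\<close>: moving \<open>y\<close> past \<open>x\<close> \<open>m - 1\<close> times costs the factor \<open>q\<close> to that power.\<close>
  have "single u c = qmul q (single (1, 1) 1) (single (fst u - 1, snd u - 1) (c / q ^ (fst u - 1)))"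
    using add.hyps(1) assms(1) by (simp add: prod_eq_iff)
  then have "single u c + p =
      qmul q (single (1, 1) 1) (single (fst u - 1, snd u - 1) (c / q ^ (fst u - 1)) + s)"
    by (simp only: tw_mult_add_right s)
  then show ?case by blast
qed


section \<open>Automorphisms are diagonal\<close>

text \<open>
  Unital algebra endomorphisms of \<open>qpoly_alg q\<close>. Since its carrier is the whole type, plain functions
  suffice.
\<close>

definition qpoly_endo :: "complex \<Rightarrow> ((nat \<times> nat \<Rightarrow>\<^sub>0 complex) \<Rightarrow> (nat \<times> nat \<Rightarrow>\<^sub>0 complex)) \<Rightarrow> bool" where
  "qpoly_endo q \<psi> \<longleftrightarrow> (\<forall>p r. \<psi> (p + r) = \<psi> p + \<psi> r) \<and> (\<forall>c p. \<psi> (scale c p) = scale c (\<psi> p)) \<and>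
     (\<forall>p r. \<psi> (qmul q p r) = qmul q (\<psi> p) (\<psi> r)) \<and> \<psi> (single 0 1) = single 0 1"

lemma qpoly_endoD:
  assumes "qpoly_endo q \<psi>"
  shows "\<psi> (p + r) = \<psi> p + \<psi> r" "\<psi> (scale c p) = scale c (\<psi> p)"
    "\<psi> (qmul q p r) = qmul q (\<psi> p) (\<psi> r)" "\<psi> (single 0 1) = single 0 1" "\<psi> 0 = 0"
proof -
  show add: "\<psi> (p + r) = \<psi> p + \<psi> r" for p r using assms by (simp add: qpoly_endo_def)
  show "\<psi> 0 = 0" using add[of 0 0] by simp
qed (use assms in \<open>simp_all add: qpoly_endo_def\<close>)

text \<open>
  Applying the endomorphism to \<open>yx - xy = (q - 1) xy\<close> shows that \<open>(q - 1) \<psi>(xy)\<close> is a commutator.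
\<close>

lemma endo_XY_multiple:
  assumes q: "q \<noteq> 0" "q \<noteq> 1" and \<psi>: "qpoly_endo q \<psi>"
  shows "\<exists>s. \<psi> (single (1, 1) 1) = qmul q (single (1, 1) 1) s"
proof -
  have XY: "\<psi> (single (1, 1) 1) = qmul q (\<psi> qX) (\<psi> qY)"
    using qpoly_endoD(3)[OF \<psi>, of qX qY] by simp
  have "single (1, 1) q = scale q (single (1, 1) 1 :: nat \<times> nat \<Rightarrow>\<^sub>0 complex)" by simp
  then have "\<psi> (single (1, 1) q) = scale q (\<psi> (single (1, 1) 1))"
    using qpoly_endoD(2)[OF \<psi>] by metis
  then have YX: "qmul q (\<psi> qY) (\<psi> qX) = scale q (\<psi> (single (1, 1) 1))"
    using qpoly_endoD(3)[OF \<psi>, of qY qX] by simp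
  have comm: "scale (q - 1) (\<psi> (single (1, 1) 1)) = qmul q (\<psi> qY) (\<psi> qX) - qmul q (\<psi> qX) (\<psi> qY)"
    unfolding YX XY[symmetric] by (rule poly_mapping_eqI) (simp add: lookup_minus algebra_simps)
  have "keys (scale (q - 1) (\<psi> (single (1, 1) 1))) \<subseteq> {u. fst u \<ge> 1 \<and> snd u \<ge> 1}"
    unfolding comm by (rule keys_commutator)
  moreover have "keys (scale (q - 1) p) = keys p" for p :: "nat \<times> nat \<Rightarrow>\<^sub>0 complex"
    using q(2) by (auto simp: in_keys_iff)
  ultimately show ?thesis by (intro multiple_of_XY[OF q(1)]) simp
qed

theorem qpoly_automorphism_diagonal:
  assumes q: "q \<noteq> 0" "\<And>n::nat. n > 0 \<Longrightarrow> q ^ n \<noteq> 1"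
    and \<psi>: "qpoly_endo q \<psi>" and \<psi>': "qpoly_endo q \<psi>'" and inv: "\<And>p. \<psi> (\<psi>' p) = p"
  shows "\<exists>\<alpha> \<beta>. \<alpha> \<noteq> 0 \<and> \<beta> \<noteq> 0 \<and> \<psi> qX = scale \<alpha> qX \<and> \<psi> qY = scale \<beta> qY"
proof -
  let ?XY = "single (1, 1) 1 :: nat \<times> nat \<Rightarrow>\<^sub>0 complex"
  have q1: "q \<noteq> 1" using q(2)[of 1] by simp
  have single_ne: "?XY \<noteq> 0" by (simp flip: keys_eq_empty)
  \<comment> \<open>Applying \<open>\<psi>\<close> to \<open>\<psi>'(xy) = xy s'\<close> gives \<open>xy = xy s \<psi>(s')\<close>, so \<open>s\<close> is a unit, that is, a scalar.\<close>
  obtain s where s: "\<psi> ?XY = qmul q ?XY s" using endo_XY_multiple[OF q(1) q1 \<psi>] by blast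
  obtain s' where s': "\<psi>' ?XY = qmul q ?XY s'" using endo_XY_multiple[OF q(1) q1 \<psi>'] by blast
  have "?XY = \<psi> (qmul q ?XY s')" unfolding s'[symmetric] by (rule inv[symmetric])
  also have "\<dots> = qmul q ?XY (qmul q s (\<psi> s'))"
    by (simp only: qpoly_endoD(3)[OF \<psi>] s qmul_assoc)
  finally have "qmul q ?XY (qmul q s (\<psi> s') - single 0 1) = 0"
    unfolding tw_mult_diff qmul_one by simp
  then have "qmul q s (\<psi> s') - single 0 1 = 0"
    using qmul_eq_zero[OF q(1)] single_ne by blast
  then have "qmul q s (\<psi> s') = single 0 1" by simp
  then obtain u a v where "s = single u a" "u + v = 0" "a \<noteq> 0"
    using qmul_eq_monomial[OF q(1) _ one_neq_zero] by blast
  moreover from \<open>u + v = 0\<close> have "u = 0" by (simp add: prod_eq_iff)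
  ultimately have s: "s = single 0 a" "a \<noteq> 0" by simp_all
  have prod: "qmul q (\<psi> qX) (\<psi> qY) = single (1, 1) a"
    using qpoly_endoD(3)[OF \<psi>, of qX qY] \<open>\<psi> ?XY = _\<close> by (simp add: s)
  then obtain u b v c where uv: "\<psi> qX = single u b" "\<psi> qY = single v c" "u + v = (1, 1)" "b \<noteq> 0" "c \<noteq> 0"
    using qmul_eq_monomial[OF q(1) _ s(2)] by blast
  have "single (1, 1) q = scale q (single (1, 1) 1 :: nat \<times> nat \<Rightarrow>\<^sub>0 complex)" by simp
  then have "\<psi> (single (1, 1) q) = scale q (\<psi> ?XY)"
    using qpoly_endoD(2)[OF \<psi>] by metis
  then have YX: "qmul q (\<psi> qY) (\<psi> qX) = scale q (qmul q (\<psi> qX) (\<psi> qY))"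
    using qpoly_endoD(3)[OF \<psi>, of qY qX] qpoly_endoD(3)[OF \<psi>, of qX qY] by simp
  \<comment> \<open>The relation \<open>YX = q XY\<close> for the monomials \<open>X\<close> and \<open>Y\<close> with exponents \<open>u\<close> and \<open>v\<close>.\<close>
  have pow: "q ^ (snd v * fst u) = q ^ (1 + snd u * fst v)"
    using arg_cong[OF YX, of "\<lambda>p. lookup p (u + v)"] uv by (simp add: add.commute[of v u])
  obtain i j k l where ijkl: "u = (i, j)" "v = (k, l)" by (cases u, cases v)
  have sums: "i + k = 1" "j + l = 1" using uv(3) by (simp_all add: ijkl)
  have "i = 1 \<and> j = 0"
  proof (rule ccontr)
    assume "\<not> (i = 1 \<and> j = 0)"
    then consider "i = 0" "k = 1" "j = 0" "l = 1" | "i = 0" "k = 1" "j = 1" "l = 0"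
      | "i = 1" "k = 0" "j = 1" "l = 0"
      using sums by (cases i; cases j) auto
    then show False
      using pow q(2)[of 1] q(2)[of 2] by cases (simp_all add: ijkl power2_eq_square)
  qed
  with sums have "u = (1, 0)" "v = (0, 1)" by (simp_all add: ijkl)
  with uv show ?thesis by (intro exI[of _ b] exI[of _ c]) simp
qed

lemma diagonal_endo_lookup:
  assumes \<psi>: "qpoly_endo q \<psi>" and X: "\<psi> qX = scale \<alpha> qX" and Y: "\<psi> qY = scale \<beta> qY"
  shows "lookup (\<psi> p) (m, n) = \<alpha> ^ m * \<beta> ^ n * lookup p (m, n)"
proof -
  have monom: "\<psi> (single (m, n) 1) = single (m, n) (\<alpha> ^ m * \<beta> ^ n)" for m n
  proof (induction m)
    case 0
    show ?case
    proof (induction n)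
      case 0
      show ?case using qpoly_endoD(4)[OF \<psi>] by (simp add: zero_prod_def)
    next
      case (Suc n)
      have "single (0, Suc n) 1 = qmul q qY (single (0, n) 1)" by simp
      with Suc show ?case by (simp only: qpoly_endoD(3)[OF \<psi>] Y) simp
    qed
  next
    case (Suc m)
    have "single (Suc m, n) 1 = qmul q qX (single (m, n) 1)" by simp
    with Suc show ?case by (simp only: qpoly_endoD(3)[OF \<psi>] X) (simp add: mult.assoc)
  qed
  show ?thesis
  proof (induction p rule: poly_mapping_induct)
    case zero
    show ?case by (simp add: qpoly_endoD(5)[OF \<psi>])
  next
    case (add u c p)
    have "\<psi> (single u 1) = single u (\<alpha> ^ fst u * \<beta> ^ snd u)"
      using monom[of "fst u" "snd u"] by simp
    moreover have "\<psi> (single u c) = scale c (\<psi> (single u 1))"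
      by (simp flip: qpoly_endoD(2)[OF \<psi>])
    ultimately have "lookup (\<psi> (single u c)) (m, n) = \<alpha> ^ m * \<beta> ^ n * lookup (single u c) (m, n)"
      by (auto simp: lookup_single when_def)
    with add show ?case by (simp add: qpoly_endoD(1)[OF \<psi>] lookup_add distrib_left)
  qed
qed


section \<open>Degree-raising actions are trivial\<close>

definition high_degree :: "(nat \<times> nat \<Rightarrow>\<^sub>0 complex) \<Rightarrow> bool" where
  "high_degree p \<longleftrightarrow> (\<forall>u\<in>keys p. fst u + snd u \<ge> 2)"

lemma high_degree_add: "high_degree p \<Longrightarrow> high_degree r \<Longrightarrow> high_degree (p + r)"
  using keys_add[of p r] by (auto simp: high_degree_def)

lemma high_degree_scale: "high_degree p \<Longrightarrow> high_degree (scale c p)"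
  using keys_scale[of c p] by (auto simp: high_degree_def)

lemma high_degree_qmul: "high_degree p \<or> high_degree r \<Longrightarrow> high_degree (qmul q p r)"
  using keys_tw_mult[of "(+)" "\<lambda>u v. q ^ (snd u * fst v)" p r]
  by (fastforce simp: high_degree_def)

text \<open>
  The elements of high degree form a two-sided ideal, so by the Leibniz rule it is enough that the
  generators are sent there. The twists \<open>\<theta>\<close> and \<open>\<eta>\<close> may be arbitrary functions; this covers \<open>e\<close>,
  which is twisted on the right, and \<open>f\<close>, which is twisted on the left.
\<close>

lemma skew_derivation_high_degree:
  fixes D \<theta> \<eta> :: "(nat \<times> nat \<Rightarrow>\<^sub>0 complex) \<Rightarrow> (nat \<times> nat \<Rightarrow>\<^sub>0 complex)"
  assumes add: "\<And>p r. D (p + r) = D p + D r" and scale: "\<And>c p. D (scale c p) = scale c (D p)"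
    and leibniz: "\<And>p r. D (qmul q p r) = qmul q (\<theta> p) (D r) + qmul q (D p) (\<eta> r)"
    and one: "D (single 0 1) = 0" and X: "high_degree (D qX)" and Y: "high_degree (D qY)"
  shows "high_degree (D p)"
proof -
  have monom: "high_degree (D (single (m, n) 1))" for m n
  proof (induction m)
    case 0
    show ?case
    proof (induction n)
      case 0
      show ?case using one by (simp add: zero_prod_def high_degree_def)
    next
      case (Suc n)
      have "single (0, Suc n) 1 = qmul q qY (single (0, n) 1)" by simp
      then have "D (single (0, Suc n) 1) =
          qmul q (\<theta> qY) (D (single (0, n) 1)) + qmul q (D qY) (\<eta> (single (0, n) 1))"
        using leibniz by metis
      then show ?case using Suc Y by (simp add: high_degree_add high_degree_qmul)
    qed
  next
    case (Suc m)
    have "single (Suc m, n) 1 = qmul q qX (single (m, n) 1)" by simp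
    then have "D (single (Suc m, n) 1) =
        qmul q (\<theta> qX) (D (single (m, n) 1)) + qmul q (D qX) (\<eta> (single (m, n) 1))"
      using leibniz by metis
    then show ?case using Suc X by (simp add: high_degree_add high_degree_qmul)
  qed
  show ?thesis
  proof (induction p rule: poly_mapping_induct)
    case zero
    have "D 0 = 0" using add[of 0 0] by simp
    then show ?case by (simp add: high_degree_def)
  next
    case (add u c p)
    have "D (single u c) = scale c (D (single (fst u, snd u) 1))" by (simp flip: scale)
    then have "high_degree (D (single u c))" using monom[of "fst u" "snd u"] by (simp add: high_degree_scale)
    with add show ?case by (simp add: assms(1) high_degree_add)
  qed
qed

theorem high_degree_action_trivial:
  fixes K K' E F :: "(nat \<times> nat \<Rightarrow>\<^sub>0 complex) \<Rightarrow> (nat \<times> nat \<Rightarrow>\<^sub>0 complex)"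
  assumes q: "q \<noteq> 0" "\<And>n::nat. n > 0 \<Longrightarrow> q ^ n \<noteq> 1"
    and K: "qpoly_endo q K" and K': "qpoly_endo q K'"
    and inv: "\<And>p. K (K' p) = p" "\<And>p. K' (K p) = p"
    and E: "\<And>p r. E (p + r) = E p + E r" "\<And>c p. E (scale c p) = scale c (E p)"
      "\<And>p r. E (qmul q p r) = qmul q p (E r) + qmul q (E p) (K r)" "E (single 0 1) = 0"
    and F: "\<And>p r. F (p + r) = F p + F r" "\<And>c p. F (scale c p) = scale c (F p)"
      "\<And>p r. F (qmul q p r) = qmul q (F p) r + qmul q (K' p) (F r)" "F (single 0 1) = 0"
    and KE: "\<And>p. K (E p) = scale (q ^ 2) (E (K p))"
    and KF: "\<And>p. K (F p) = scale (1 / q ^ 2) (F (K p))"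
    and EF: "\<And>p. E (F p) - F (E p) = scale (1 / (q - 1 / q)) (K p - K' p)"
    and deg: "high_degree (E qX)" "high_degree (E qY)" "high_degree (F qX)" "high_degree (F qY)"
  shows "\<exists>\<sigma>\<in>{1, -1}. \<exists>\<tau>\<in>{1, -1}. K qX = scale \<sigma> qX \<and> K qY = scale \<tau> qY \<and>
    E qX = 0 \<and> E qY = 0 \<and> F qX = 0 \<and> F qY = 0"
proof -
  obtain \<alpha> \<beta> where \<alpha>\<beta>: "\<alpha> \<noteq> 0" "\<beta> \<noteq> 0" "K qX = scale \<alpha> qX" "K qY = scale \<beta> qY"
    using qpoly_automorphism_diagonal[OF q K K' inv(1)] by blast
  have Elow: "high_degree (E p)" for p
    by (rule skew_derivation_high_degree[where \<theta> = "\<lambda>p. p" and \<eta> = K, OF E(1-4) deg(1,2)])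
  have Flow: "high_degree (F p)" for p
    by (rule skew_derivation_high_degree[where q = q and \<theta> = K' and \<eta> = "\<lambda>p. p", OF F(1,2) _ F(4) deg(3,4)])
      (simp add: F(3) add.commute)
  have qq: "q - 1 / q \<noteq> 0"
    using q(1) q(2)[of 2] by (auto simp: field_simps power2_eq_square)
  \<comment> \<open>The coefficient of \<open>ef - fe\<close> at a generator vanishes, but it is also \<open>(c - 1/c) / (q - 1/q)\<close>.\<close>
  have square: "c * c = 1" if c: "c \<noteq> 0" "K (single u 1) = scale c (single u 1)" "fst u + snd u < 2" for c u
  proof -
    have low: "lookup p u = 0" if "high_degree p" for p
      using that c(3) by (meson high_degree_def in_keys_iff not_le)
    have "K (scale (1 / c) (single u 1)) = single u 1"
      unfolding qpoly_endoD(2)[OF K] c(2) using c(1) by simp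
    then have "K' (single u 1) = scale (1 / c) (single u 1)" using inv(2) by metis
    then have "lookup (E (F (single u 1)) - F (E (single u 1))) u = (c - 1 / c) / (q - 1 / q)"
      unfolding EF by (simp add: c lookup_minus)
    moreover have "lookup (E (F (single u 1))) u = 0" "lookup (F (E (single u 1))) u = 0"
      using low[OF Elow] low[OF Flow] by blast+
    ultimately have "c - 1 / c = 0" using qq by (simp add: lookup_minus)
    then show ?thesis using c(1) by (simp add: field_simps)
  qed
  have \<alpha>2: "\<alpha> * \<alpha> = 1" and \<beta>2: "\<beta> * \<beta> = 1"
    using square[of \<alpha> "(1, 0)"] square[of \<beta> "(0, 1)"] \<alpha>\<beta> by simp_all
  have q4: "q ^ 2 * q ^ 2 \<noteq> 1" using q(2)[of 4] by (simp flip: power_add)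
  \<comment> \<open>The eigenvalue \<open>\<kappa> c\<close> of \<open>k\<close> at \<open>D z\<close> has square \<open>\<kappa>\<^sup>2\<close>, unlike the eigenvalues at monomials.\<close>
  have vanish: "D z = 0"
    if D: "\<And>c p. D (scale c p) = scale c (D p)" and KD: "K (D z) = scale \<kappa> (D (K z))"
      and z: "K z = scale c z" and c: "c * c = 1" and \<kappa>: "\<kappa> * \<kappa> \<noteq> 1"
    for D :: "(nat \<times> nat \<Rightarrow>\<^sub>0 complex) \<Rightarrow> (nat \<times> nat \<Rightarrow>\<^sub>0 complex)" and \<kappa> z c
  proof (rule poly_mapping_eqI)
    fix u :: "nat \<times> nat"
    obtain m n where u: "u = (m, n)" by (cases u)
    have "\<alpha> ^ m * \<beta> ^ n * lookup (D z) u = \<kappa> * (c * lookup (D z) u)"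
      using arg_cong[OF KD, of "\<lambda>p. lookup p u"]
      by (simp add: u z D diagonal_endo_lookup[OF K \<alpha>\<beta>(3,4)])
    moreover have "\<alpha> ^ m * \<beta> ^ n \<noteq> \<kappa> * c"
    proof
      assume eq: "\<alpha> ^ m * \<beta> ^ n = \<kappa> * c"
      have "(\<alpha> ^ m * \<beta> ^ n) * (\<alpha> ^ m * \<beta> ^ n) = (\<alpha> * \<alpha>) ^ m * (\<beta> * \<beta>) ^ n"
        by (simp add: power_mult_distrib algebra_simps)
      then have "\<kappa> * c * (\<kappa> * c) = 1" using \<alpha>2 \<beta>2 eq by simp
      moreover have "\<kappa> * c * (\<kappa> * c) = \<kappa> * \<kappa> * (c * c)" by (simp add: algebra_simps)
      ultimately show False using c \<kappa> by simp
    qed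
    ultimately show "lookup (D z) u = lookup 0 u" by (simp add: mult.assoc[symmetric])
  qed
  have q4': "1 / q ^ 2 * (1 / q ^ 2) \<noteq> 1" using q4 q(1) by (simp add: field_simps)
  have "E qX = 0" "E qY = 0" "F qX = 0" "F qY = 0"
    using vanish[OF E(2) KE \<alpha>\<beta>(3) \<alpha>2 q4] vanish[OF E(2) KE \<alpha>\<beta>(4) \<beta>2 q4]
      vanish[OF F(2) KF \<alpha>\<beta>(3) \<alpha>2 q4'] vanish[OF F(2) KF \<alpha>\<beta>(4) \<beta>2 q4'] by blast+
  moreover have "\<alpha> \<in> {1, -1}" "\<beta> \<in> {1, -1}"
    using \<alpha>2 \<beta>2 by (simp_all add: square_eq_1_iff)
  ultimately show ?thesis using \<alpha>\<beta>(3,4) by blast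
qed


section \<open>The quantum plane in coordinates\<close>

lemma quantum_plane_calg: "calg (quantum_plane q)"
  unfolding quantum_plane_def by (rule presented_alg_calg)

lemma qp_gens_closed [simp]: "qp_x q \<in> carrier (quantum_plane q)" "qp_y q \<in> carrier (quantum_plane q)"
  by (simp_all add: qp_x_def qp_y_def quantum_plane_def)

lemma (in calg) qp_relations_iff:
  assumes "\<And>z. g z \<in> carrier A"
  shows "(\<forall>r\<in>qp_relations q. free_eval A g r = \<zero>) \<longleftrightarrow> g GY \<otimes> g GX = q \<odot> (g GX \<otimes> g GY)"
  using assms by (simp add: qp_relations_def free_eval_hom(3) minus_eq_zero_iff)

lemma qp_yx: "qp_y q \<otimes>\<^bsub>quantum_plane q\<^esub> qp_x q = q \<odot>\<^bsub>quantum_plane q\<^esub> (qp_x q \<otimes>\<^bsub>quantum_plane q\<^esub> qp_y q)"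
  unfolding quantum_plane_def qp_x_def qp_y_def
  by (subst calg.qp_relations_iff[OF presented_alg_calg, symmetric])
    (simp_all add: presented_alg_relation)

lemma qp_induct [consumes 1, case_names one x y add smult mult]:
  assumes "a \<in> carrier (quantum_plane q)"
    and "P \<one>\<^bsub>quantum_plane q\<^esub>" "P (qp_x q)" "P (qp_y q)"
    and "\<And>a b. a \<in> carrier (quantum_plane q) \<Longrightarrow> b \<in> carrier (quantum_plane q) \<Longrightarrow> P a \<Longrightarrow> P b \<Longrightarrow>
      P (a \<oplus>\<^bsub>quantum_plane q\<^esub> b)"
    and "\<And>c a. a \<in> carrier (quantum_plane q) \<Longrightarrow> P a \<Longrightarrow> P (c \<odot>\<^bsub>quantum_plane q\<^esub> a)"
    and "\<And>a b. a \<in> carrier (quantum_plane q) \<Longrightarrow> b \<in> carrier (quantum_plane q) \<Longrightarrow> P a \<Longrightarrow> P b \<Longrightarrow>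
      P (a \<otimes>\<^bsub>quantum_plane q\<^esub> b)"
  shows "P a"
proof -
  have "P (alg_gen (qp_relations q) z)" for z
    using assms(3,4) by (cases z) (simp_all add: qp_x_def qp_y_def)
  with assms show ?thesis
    unfolding quantum_plane_def by (intro presented_alg_induct[of a "qp_relations q" P]) auto
qed

lemma qp_hom_exists:
  assumes B: "calg B" and "x \<in> carrier B" "y \<in> carrier B" and "y \<otimes>\<^bsub>B\<^esub> x = q \<odot>\<^bsub>B\<^esub> (x \<otimes>\<^bsub>B\<^esub> y)"
  shows "\<exists>\<phi>\<in>alg_hom (quantum_plane q) B. \<phi> (qp_x q) = x \<and> \<phi> (qp_y q) = y"
proof -
  define g where "g z = (case z of GX \<Rightarrow> x | GY \<Rightarrow> y)" for z
  have g: "g z \<in> carrier B" for z using assms by (simp add: g_def split: qp_gen.split)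
  have "\<forall>r\<in>qp_relations q. free_eval B g r = \<zero>\<^bsub>B\<^esub>"
    using calg.qp_relations_iff[OF B, of g q] g assms(4) by (simp add: g_def[of GX] g_def[of GY])
  then obtain \<phi> where "\<phi> \<in> alg_hom (quantum_plane q) B" "\<And>z. \<phi> (alg_gen (qp_relations q) z) = g z"
    unfolding quantum_plane_def using presented_alg_hom_exists[OF B, of g "qp_relations q"] g by metis
  then show ?thesis by (intro bexI[of _ \<phi>]) (simp_all add: qp_x_def qp_y_def g_def)
qed

lemma qp_hom_eqI:
  assumes "\<phi> \<in> alg_hom (quantum_plane q) B" "\<psi> \<in> alg_hom (quantum_plane q) B"
    and "\<phi> (qp_x q) = \<psi> (qp_x q)" "\<phi> (qp_y q) = \<psi> (qp_y q)"
  shows "\<phi> = \<psi>"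
  using assms(1,2) unfolding quantum_plane_def
proof (rule presented_alg_hom_eqI)
  show "\<phi> (alg_gen (qp_relations q) z) = \<psi> (alg_gen (qp_relations q) z)" for z
    using assms(3,4) by (cases z) (simp_all add: qp_x_def qp_y_def)
qed

text \<open>
  The homomorphism given by the universal property of the quantum plane; it is unique, and it is
  bijective with inverse \<open>qp_elem\<close>, so the ordered monomials form a basis.
\<close>

definition coords :: "complex \<Rightarrow> qplane \<Rightarrow> (nat \<times> nat \<Rightarrow>\<^sub>0 complex)" where
  "coords q = (SOME \<phi>. \<phi> \<in> alg_hom (quantum_plane q) (qpoly_alg q) \<and> \<phi> (qp_x q) = qX \<and> \<phi> (qp_y q) = qY)"

definition qp_elem :: "complex \<Rightarrow> (nat \<times> nat \<Rightarrow>\<^sub>0 complex) \<Rightarrow> qplane" where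
  "qp_elem q = lin_ext (quantum_plane q) (\<lambda>u. qp_monom q (fst u) (snd u))"

context
  fixes q :: complex
begin

interpretation A: calg "quantum_plane q" by (rule quantum_plane_calg)

abbreviation (input) "plane \<equiv> quantum_plane q"

lemma coords_hom:
  "coords q \<in> alg_hom plane (qpoly_alg q)" "coords q (qp_x q) = qX" "coords q (qp_y q) = qY"
proof -
  have "\<exists>\<phi>\<in>alg_hom plane (qpoly_alg q). \<phi> (qp_x q) = qX \<and> \<phi> (qp_y q) = qY"
    by (rule qp_hom_exists[OF qpoly.twisted_alg_calg]) simp_all
  then have "\<exists>\<phi>. \<phi> \<in> alg_hom plane (qpoly_alg q) \<and> \<phi> (qp_x q) = qX \<and> \<phi> (qp_y q) = qY" by blast
  from someI_ex[OF this] show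
    "coords q \<in> alg_hom plane (qpoly_alg q)" "coords q (qp_x q) = qX" "coords q (qp_y q) = qY"
    unfolding coords_def by blast+
qed

lemmas coords_simps =
  lin_mapD(2,3)[OF alg_homD(1)[OF coords_hom(1)], simplified]
  alg_homD(2,3)[OF coords_hom(1), simplified]

lemma qp_monom_closed [simp]: "qp_monom q m n \<in> carrier plane"
  by (simp add: qp_monom_def)

lemma y_pow_x_pow:
  "qp_y q [^]\<^bsub>plane\<^esub> n \<otimes>\<^bsub>plane\<^esub> qp_x q [^]\<^bsub>plane\<^esub> m = q ^ (n * m) \<odot>\<^bsub>plane\<^esub> (qp_x q [^]\<^bsub>plane\<^esub> m \<otimes>\<^bsub>plane\<^esub> qp_y q [^]\<^bsub>plane\<^esub> n)"
    for m n :: nat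
proof -
  let ?x = "qp_x q" and ?y = "qp_y q"
  have yx: "?y [^]\<^bsub>plane\<^esub> n \<otimes>\<^bsub>plane\<^esub> ?x = q ^ n \<odot>\<^bsub>plane\<^esub> (?x \<otimes>\<^bsub>plane\<^esub> ?y [^]\<^bsub>plane\<^esub> n)" for n :: nat
  proof (induction n)
    case (Suc n)
    have "?y [^]\<^bsub>plane\<^esub> Suc n \<otimes>\<^bsub>plane\<^esub> ?x = ?y [^]\<^bsub>plane\<^esub> n \<otimes>\<^bsub>plane\<^esub> (?y \<otimes>\<^bsub>plane\<^esub> ?x)"
      by (simp add: A.m_assoc)
    also have "\<dots> = q \<odot>\<^bsub>plane\<^esub> ((?y [^]\<^bsub>plane\<^esub> n \<otimes>\<^bsub>plane\<^esub> ?x) \<otimes>\<^bsub>plane\<^esub> ?y)"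
      by (simp add: qp_yx A.smult_mult_right A.m_assoc)
    also have "\<dots> = q ^ Suc n \<odot>\<^bsub>plane\<^esub> (?x \<otimes>\<^bsub>plane\<^esub> ?y [^]\<^bsub>plane\<^esub> Suc n)"
      by (simp add: Suc A.smult_mult_left A.smult_smult A.m_assoc)
    finally show ?case .
  qed simp
  show ?thesis
  proof (induction m)
    case (Suc m)
    have "?y [^]\<^bsub>plane\<^esub> n \<otimes>\<^bsub>plane\<^esub> ?x [^]\<^bsub>plane\<^esub> Suc m = (?y [^]\<^bsub>plane\<^esub> n \<otimes>\<^bsub>plane\<^esub> ?x [^]\<^bsub>plane\<^esub> m) \<otimes>\<^bsub>plane\<^esub> ?x"
      by (simp add: A.m_assoc)
    also have "\<dots> = q ^ (n * m) \<odot>\<^bsub>plane\<^esub> (?x [^]\<^bsub>plane\<^esub> m \<otimes>\<^bsub>plane\<^esub> (?y [^]\<^bsub>plane\<^esub> n \<otimes>\<^bsub>plane\<^esub> ?x))"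
      by (simp add: Suc A.smult_mult_left A.m_assoc)
    also have "\<dots> = q ^ (n * Suc m) \<odot>\<^bsub>plane\<^esub> (?x [^]\<^bsub>plane\<^esub> Suc m \<otimes>\<^bsub>plane\<^esub> ?y [^]\<^bsub>plane\<^esub> n)"
      by (simp add: yx A.smult_mult_right A.smult_smult A.m_assoc power_add mult.commute)
    finally show ?case .
  qed simp
qed

lemma qp_monom_mult:
  "qp_monom q m n \<otimes>\<^bsub>plane\<^esub> qp_monom q m' n' = q ^ (n * m') \<odot>\<^bsub>plane\<^esub> qp_monom q (m + m') (n + n')"
proof -
  let ?x = "qp_x q" and ?y = "qp_y q"
  have "qp_monom q m n \<otimes>\<^bsub>plane\<^esub> qp_monom q m' n' =
      ?x [^]\<^bsub>plane\<^esub> m \<otimes>\<^bsub>plane\<^esub> (?y [^]\<^bsub>plane\<^esub> n \<otimes>\<^bsub>plane\<^esub> ?x [^]\<^bsub>plane\<^esub> m') \<otimes>\<^bsub>plane\<^esub> ?y [^]\<^bsub>plane\<^esub> n'"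
    by (simp add: qp_monom_def A.m_assoc)
  also have "\<dots> = q ^ (n * m') \<odot>\<^bsub>plane\<^esub> ((?x [^]\<^bsub>plane\<^esub> m \<otimes>\<^bsub>plane\<^esub> ?x [^]\<^bsub>plane\<^esub> m') \<otimes>\<^bsub>plane\<^esub> (?y [^]\<^bsub>plane\<^esub> n \<otimes>\<^bsub>plane\<^esub> ?y [^]\<^bsub>plane\<^esub> n'))"
    by (simp add: y_pow_x_pow A.smult_mult_left A.smult_mult_right A.m_assoc)
  finally show ?thesis by (simp add: qp_monom_def A.nat_pow_mult)
qed

lemma qp_elem_hom: "qp_elem q \<in> alg_hom (qpoly_alg q) plane"
proof -
  let ?\<phi> = "\<lambda>u. qp_monom q (fst u) (snd u)"
  have \<phi>: "?\<phi> \<in> UNIV \<rightarrow> carrier plane" by simp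
  have "lin_map (qpoly_alg q) plane (qp_elem q)"
    using A.lin_ext_closed[OF \<phi>] A.lin_ext_add[OF \<phi>] A.lin_ext_scale[OF \<phi>]
    by (simp add: lin_map_def qp_elem_def)
  moreover have "qp_elem q (qmul q p r) = qp_elem q p \<otimes>\<^bsub>plane\<^esub> qp_elem q r" for p r
    unfolding qp_elem_def
    by (rule A.lin_ext_tw_mult[OF \<phi> _ subset_UNIV subset_UNIV]) (simp add: qp_monom_mult)
  moreover have "qp_elem q (single 0 1) = \<one>\<^bsub>plane\<^esub>"
    by (simp add: qp_elem_def del: single_one) (simp add: qp_monom_def)
  ultimately show ?thesis by (simp add: alg_hom_iff)
qed

lemmas qp_elem_simps =
  lin_mapD[OF alg_homD(1)[OF qp_elem_hom], simplified]
  alg_homD(2,3)[OF qp_elem_hom, simplified]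

lemma qp_elem_zero: "qp_elem q 0 = \<zero>\<^bsub>plane\<^esub>"
  by (simp add: qp_elem_def)

lemma qp_elem_single: "qp_elem q (single u c) = c \<odot>\<^bsub>plane\<^esub> qp_monom q (fst u) (snd u)"
  by (simp add: qp_elem_def)

lemma qp_elem_gens: "qp_elem q qX = qp_x q" "qp_elem q qY = qp_y q"
  unfolding qp_elem_single by (simp_all add: qp_monom_def)

lemma coords_qp_elem [simp]: "coords q (qp_elem q p) = p"
proof -
  have pow: "coords q (a [^]\<^bsub>plane\<^esub> Suc n) = qmul q (coords q (a [^]\<^bsub>plane\<^esub> n)) (coords q a)"
    if "a \<in> carrier plane" for a n
    using that by (simp add: coords_simps)
  have x: "coords q (qp_x q [^]\<^bsub>plane\<^esub> m) = single (m, 0) 1" for m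
    by (induction m) (simp_all add: pow coords_hom coords_simps zero_prod_def
        del: A.nat_pow_Suc single_one flip: single_one)
  have y: "coords q (qp_y q [^]\<^bsub>plane\<^esub> n) = single (0, n) 1" for n
    by (induction n) (simp_all add: pow coords_hom coords_simps zero_prod_def
        del: A.nat_pow_Suc single_one flip: single_one)
  have monom: "coords q (qp_monom q m n) = single (m, n) 1" for m n
    by (simp add: qp_monom_def coords_simps x y)
  show ?thesis
  proof (induction p rule: poly_mapping_induct)
    case zero
    show ?case using coords_simps(2)[of "\<zero>\<^bsub>plane\<^esub>" 0] by (simp add: qp_elem_zero) (simp add: poly_mapping_eq_iff fun_eq_iff)
  next
    case (add u c p)
    then show ?case by (simp add: qp_elem_simps(1,2) coords_simps qp_elem_single monom)
  qed
qed

lemma qp_elem_coords [simp]: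
  assumes "a \<in> carrier plane"
  shows "qp_elem q (coords q a) = a"
  using assms
  by (induction rule: qp_induct)
    (simp_all add: coords_simps coords_hom(2,3) qp_elem_gens[unfolded One_nat_def] qp_elem_simps)

lemma coords_eq_iff: "a \<in> carrier plane \<Longrightarrow> b \<in> carrier plane \<Longrightarrow> coords q a = coords q b \<longleftrightarrow> a = b"
  using qp_elem_coords by metis

lemma coords_zero [simp]: "coords q \<zero>\<^bsub>plane\<^esub> = 0"
  using coords_qp_elem[of 0] by (simp add: qp_elem_zero)

lemma coords_minus: "a \<in> carrier plane \<Longrightarrow> b \<in> carrier plane \<Longrightarrow> coords q (a \<ominus>\<^bsub>plane\<^esub> b) = coords q a - coords q b"
  by (simp add: A.minus_eq_smult coords_simps scale_minus_one)

lemma qp_gens_nonzero: "qp_x q \<noteq> \<zero>\<^bsub>plane\<^esub>" "qp_y q \<noteq> \<zero>\<^bsub>plane\<^esub>"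
proof -
  have "qX \<noteq> 0" "qY \<noteq> 0" by (simp_all flip: keys_eq_empty)
  then show "qp_x q \<noteq> \<zero>\<^bsub>plane\<^esub>" "qp_y q \<noteq> \<zero>\<^bsub>plane\<^esub>"
    using coords_hom(2,3) coords_zero by metis+
qed

text \<open>
  Used for a single homogeneous component, where \<open>S\<close> consists of monomials, and for the sum of all
  other components, where \<open>S\<close> is a union of subspaces.
\<close>

lemma lin_span_monomials:
  assumes S: "S \<subseteq> qp_elem q ` {p. keys p \<subseteq> C}" and C: "\<And>u. u \<in> C \<Longrightarrow> qp_monom q (fst u) (snd u) \<in> S"
  shows "lin_span plane S = qp_elem q ` {p. keys p \<subseteq> C}"
proof
  show "lin_span plane S \<subseteq> qp_elem q ` {p. keys p \<subseteq> C}"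
  proof
    fix v assume "v \<in> lin_span plane S"
    then show "v \<in> qp_elem q ` {p. keys p \<subseteq> C}"
    proof induction
      case zero
      show ?case by (rule image_eqI[of _ _ 0]) (simp_all add: qp_elem_zero)
    next
      case (step v w c)
      obtain p r where pr: "v = qp_elem q p" "keys p \<subseteq> C" "w = qp_elem q r" "keys r \<subseteq> C"
        using step S by blast
      have "keys (scale c p + r) \<subseteq> C"
        using pr keys_add[of "scale c p" r] keys_scale[of c p] by blast
      moreover have "c \<odot>\<^bsub>plane\<^esub> v \<oplus>\<^bsub>plane\<^esub> w = qp_elem q (scale c p + r)"
        by (simp add: pr qp_elem_simps)
      ultimately show ?case by blast
    qed
  qed
  have "qp_elem q p \<in> lin_span plane S" if "keys p \<subseteq> C" for p
    using that
  proof (induction p rule: poly_mapping_induct_on)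
    case zero
    show ?case by (simp add: qp_elem_zero lin_span.zero)
  next
    case (add u c p)
    then show ?case by (simp add: qp_elem_simps qp_elem_single lin_span.step C)
  qed
  then show "qp_elem q ` {p. keys p \<subseteq> C} \<subseteq> lin_span plane S" by blast
qed

lemma qp_homogeneous_eq: "qp_homogeneous q i = qp_elem q ` {p. keys p \<subseteq> {u. fst u + snd u = i}}"
  unfolding qp_homogeneous_def
proof (rule lin_span_monomials)
  have "qp_monom q m n = qp_elem q (single (m, n) 1)" for m n by (simp add: qp_elem_single)
  then show "{qp_monom q m n |m n. m + n = i} \<subseteq> qp_elem q ` {p. keys p \<subseteq> {u. fst u + snd u = i}}"
    by auto
qed auto

lemma other_degrees_eq:
  "lin_span plane (\<Union>j\<in>-{i}. qp_homogeneous q j) = qp_elem q ` {p. keys p \<subseteq> {u. fst u + snd u \<noteq> i}}"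
proof (rule lin_span_monomials)
  show "(\<Union>j\<in>-{i}. qp_homogeneous q j) \<subseteq> qp_elem q ` {p. keys p \<subseteq> {u. fst u + snd u \<noteq> i}}"
    unfolding qp_homogeneous_eq by (intro UN_least image_mono) auto
  fix u :: "nat \<times> nat" assume u: "u \<in> {u. fst u + snd u \<noteq> i}"
  have "qp_monom q (fst u) (snd u) \<in> qp_homogeneous q (fst u + snd u)"
    unfolding qp_homogeneous_eq by (rule image_eqI[of _ _ "single u 1"]) (simp_all add: qp_elem_single)
  then show "qp_monom q (fst u) (snd u) \<in> (\<Union>j\<in>-{i}. qp_homogeneous q j)" using u by blast
qed

lemma qp_proj_eq_zero_iff:
  assumes a: "a \<in> carrier plane"
  shows "qp_proj q i a = \<zero>\<^bsub>plane\<^esub> \<longleftrightarrow> (\<forall>u. fst u + snd u = i \<longrightarrow> lookup (coords q a) u = 0)"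
proof -
  let ?p = "coords q a"
  \<comment> \<open>The component of degree \<open>i\<close>; the definite description picks it by linear independence.\<close>
  define r where "r = (\<Sum>u\<in>{u \<in> keys ?p. fst u + snd u = i}. single u (lookup ?p u))"
  have "finite {u \<in> keys ?p. fst u + snd u = i}" by simp
  then have r: "lookup r u = (if fst u + snd u = i then lookup ?p u else 0)" for u
    by (auto simp: r_def lookup_sum lookup_single when_def in_keys_iff)
  have "qp_proj q i a = qp_elem q r"
    unfolding qp_proj_def qp_homogeneous_eq other_degrees_eq
  proof (rule the_equality)
    have "a \<ominus>\<^bsub>plane\<^esub> qp_elem q r = qp_elem q (?p - r)"
      using a by (simp add: coords_minus qp_elem_simps(1) flip: coords_eq_iff)
    then show "qp_elem q r \<in> qp_elem q ` {p. keys p \<subseteq> {u. fst u + snd u = i}} \<and>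
        a \<ominus>\<^bsub>plane\<^esub> qp_elem q r \<in> qp_elem q ` {p. keys p \<subseteq> {u. fst u + snd u \<noteq> i}}"
      by (auto intro!: imageI simp: in_keys_iff lookup_minus r split: if_splits)
  next
    fix v assume v: "v \<in> qp_elem q ` {p. keys p \<subseteq> {u. fst u + snd u = i}} \<and>
        a \<ominus>\<^bsub>plane\<^esub> v \<in> qp_elem q ` {p. keys p \<subseteq> {u. fst u + snd u \<noteq> i}}"
    then obtain s t where s: "v = qp_elem q s" "keys s \<subseteq> {u. fst u + snd u = i}"
      and t: "a \<ominus>\<^bsub>plane\<^esub> v = qp_elem q t" "keys t \<subseteq> {u. fst u + snd u \<noteq> i}" by auto
    have "?p - s = t"
      using arg_cong[OF t(1), of "coords q"] a s(1) by (simp add: coords_minus qp_elem_simps(1))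
    then have sum: "lookup ?p u = lookup s u + lookup t u" for u
      by (metis add.commute diff_add_cancel lookup_add)
    have "lookup s u = lookup r u" for u
    proof -
      have "fst u + snd u = i" if "u \<in> keys s" using that s(2) by blast
      moreover have "fst u + snd u \<noteq> i" if "u \<in> keys t" using that t(2) by blast
      ultimately show ?thesis using sum[of u] by (auto simp: r in_keys_iff)
    qed
    then show "v = qp_elem q r" using s(1) poly_mapping_eqI by metis
  qed
  moreover have "qp_elem q r = \<zero>\<^bsub>plane\<^esub> \<longleftrightarrow> r = 0"
    using coords_qp_elem qp_elem_zero by metis
  moreover have "r = 0 \<longleftrightarrow> (\<forall>u. lookup r u = 0)"
    by (auto intro: poly_mapping_eqI)
  ultimately show ?thesis by (simp add: r)
qed

lemma high_degree_coords_iff: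
  assumes "a \<in> carrier plane"
  shows "high_degree (coords q a) \<longleftrightarrow> (\<forall>i\<in>{0, 1}. qp_proj q i a = \<zero>\<^bsub>plane\<^esub>)"
proof -
  have "high_degree (coords q a) \<longleftrightarrow> (\<forall>u. fst u + snd u < 2 \<longrightarrow> lookup (coords q a) u = 0)"
    unfolding high_degree_def in_keys_iff Ball_def using not_le by blast
  also have "\<dots> \<longleftrightarrow> (\<forall>i\<in>{0, 1}. \<forall>u. fst u + snd u = i \<longrightarrow> lookup (coords q a) u = 0)"
    by (auto simp: less_2_cases_iff)
  finally show ?thesis using qp_proj_eq_zero_iff[OF assms] by simp
qed


section \<open>Classification\<close>

definition in_coords :: "(qplane \<Rightarrow> qplane) \<Rightarrow> (nat \<times> nat \<Rightarrow>\<^sub>0 complex) \<Rightarrow> (nat \<times> nat \<Rightarrow>\<^sub>0 complex)" where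
  "in_coords \<phi> p = coords q (\<phi> (qp_elem q p))"

lemma in_coords_lin:
  assumes "lin_map plane plane \<phi>"
  shows "in_coords \<phi> (p + r) = in_coords \<phi> p + in_coords \<phi> r"
    and "in_coords \<phi> (scale c p) = scale c (in_coords \<phi> p)"
  by (simp_all add: in_coords_def qp_elem_simps lin_mapD[OF assms] coords_simps)

lemma in_coords_endo:
  assumes "lin_map plane plane \<phi>" "\<phi> \<one>\<^bsub>plane\<^esub> = \<one>\<^bsub>plane\<^esub>"
    "\<And>a b. a \<in> carrier plane \<Longrightarrow> b \<in> carrier plane \<Longrightarrow> \<phi> (a \<otimes>\<^bsub>plane\<^esub> b) = \<phi> a \<otimes>\<^bsub>plane\<^esub> \<phi> b"
  shows "qpoly_endo q (in_coords \<phi>)"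
  unfolding qpoly_endo_def
  using in_coords_lin[OF assms(1)]
  by (auto simp: in_coords_def qp_elem_simps assms(2,3) coords_simps lin_mapD(1)[OF assms(1)])

lemma in_coords_comp:
  assumes "lin_map plane plane \<psi>"
  shows "in_coords \<phi> (in_coords \<psi> p) = coords q (\<phi> (\<psi> (qp_elem q p)))"
  by (simp add: in_coords_def qp_elem_simps lin_mapD[OF assms])

lemma in_coords_gens:
  "in_coords \<phi> qX = coords q (\<phi> (qp_x q))" "in_coords \<phi> qY = coords q (\<phi> (qp_y q))"
  by (simp_all only: in_coords_def qp_elem_gens)

lemma coords_eq_scale_gens:
  assumes "a \<in> carrier plane"
  shows "coords q a = scale c qX \<longleftrightarrow> a = c \<odot>\<^bsub>plane\<^esub> qp_x q" "coords q a = scale c qY \<longleftrightarrow> a = c \<odot>\<^bsub>plane\<^esub> qp_y q"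
proof -
  have "coords q (c \<odot>\<^bsub>plane\<^esub> qp_x q) = scale c qX" "coords q (c \<odot>\<^bsub>plane\<^esub> qp_y q) = scale c qY"
    by (simp_all add: coords_simps(2) coords_hom(2,3))
  then show "coords q a = scale c qX \<longleftrightarrow> a = c \<odot>\<^bsub>plane\<^esub> qp_x q" "coords q a = scale c qY \<longleftrightarrow> a = c \<odot>\<^bsub>plane\<^esub> qp_y q"
    using coords_eq_iff[OF assms] by (metis A.smult_closed qp_gens_closed)+
qed

lemma diagonal_values_inj:
  assumes "diagonal_values q \<sigma> \<tau> \<pi>" "diagonal_values q \<sigma>' \<tau>' \<pi>"
  shows "\<sigma> = \<sigma>'" "\<tau> = \<tau>'"
  using assms A.smult_inj[OF qp_gens_closed(1) qp_gens_nonzero(1)]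
    A.smult_inj[OF qp_gens_closed(2) qp_gens_nonzero(2)]
  by (simp_all add: diagonal_values_def)

context
  assumes q0: "q \<noteq> 0" and qn: "\<And>n::nat. n > 0 \<Longrightarrow> q ^ n \<noteq> 1"
begin

lemma structures_iff:
  "\<pi> \<in> module_alg_structures (Uq_sl2 q) plane \<longleftrightarrow> uq_action q plane \<pi> \<and> skew_leibniz q plane \<pi>"
  by (simp add: module_alg_structures_Uq_iff[OF q0 A.calg_axioms] uq_action_def q0 A.calg_axioms)

theorem zero_zero_diagonal:
  assumes "\<pi> \<in> zero_zero_structures q"
  shows "\<exists>\<sigma>\<in>{1, -1}. \<exists>\<tau>\<in>{1, -1}. diagonal_values q \<sigma> \<tau> \<pi>"
proof -
  have \<pi>: "\<pi> \<in> module_alg_structures (Uq_sl2 q) plane"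
    and low: "\<And>i u z. i \<in> {0, 1} \<Longrightarrow> u \<in> {uq_e q, uq_f q} \<Longrightarrow> z \<in> {qp_x q, qp_y q} \<Longrightarrow>
      qp_proj q i (\<pi> u z) = \<zero>\<^bsub>plane\<^esub>"
    using assms unfolding zero_zero_structures_def by blast+
  interpret uq_action q plane \<pi> using \<pi> structures_iff by blast
  have L: "skew_leibniz q plane \<pi>" using \<pi> structures_iff by blast
  note Lb = L[unfolded skew_leibniz_def]
  have kinv: "\<pi> (uq_kinv q) (a \<otimes>\<^bsub>plane\<^esub> b) = \<pi> (uq_kinv q) a \<otimes>\<^bsub>plane\<^esub> \<pi> (uq_kinv q) b"
    if "a \<in> carrier plane" "b \<in> carrier plane" for a b
    using skew_leibniz_kinv[OF L that] .
  have kinv1: "\<pi> (uq_kinv q) \<one>\<^bsub>plane\<^esub> = \<one>\<^bsub>plane\<^esub>"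
    using Lb act_k_kinv(2)[OF A.one_closed] by simp
  let ?T = "\<lambda>h. in_coords (\<pi> h)"
  note comp = in_coords_comp[OF act_lin]
  note eqs = uq_alg_equations[of q, unfolded uq_equations_def, THEN conjunct2, THEN conjunct2]
  note eqs = eqs[THEN conjunct1] eqs[THEN conjunct2, THEN conjunct1] eqs[THEN conjunct2, THEN conjunct2]
  have elem: "qp_elem q p \<in> carrier plane" for p by (rule qp_elem_simps)
  have acts: "\<pi> (uq_k q) (\<pi> (uq_e q) a) = q ^ 2 \<odot>\<^bsub>plane\<^esub> \<pi> (uq_e q) (\<pi> (uq_k q) a)"
    "\<pi> (uq_k q) (\<pi> (uq_f q) a) = (1 / q ^ 2) \<odot>\<^bsub>plane\<^esub> \<pi> (uq_f q) (\<pi> (uq_k q) a)"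
    "\<pi> (uq_e q) (\<pi> (uq_f q) a) \<ominus>\<^bsub>plane\<^esub> \<pi> (uq_f q) (\<pi> (uq_e q) a) =
      (1 / (q - 1 / q)) \<odot>\<^bsub>plane\<^esub> (\<pi> (uq_k q) a \<ominus>\<^bsub>plane\<^esub> \<pi> (uq_kinv q) a)" if a: "a \<in> carrier plane" for a
    using arg_cong[OF eqs(1), of "\<lambda>h. \<pi> h a"] arg_cong[OF eqs(2), of "\<lambda>h. \<pi> h a"]
      arg_cong[OF eqs(3), of "\<lambda>h. \<pi> h a"] a
    by (simp_all add: act_smult act_minus act_mult)
  have "\<exists>\<sigma>\<in>{1, -1}. \<exists>\<tau>\<in>{1, -1}. ?T (uq_k q) qX = scale \<sigma> qX \<and> ?T (uq_k q) qY = scale \<tau> qY \<and>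
    ?T (uq_e q) qX = 0 \<and> ?T (uq_e q) qY = 0 \<and> ?T (uq_f q) qX = 0 \<and> ?T (uq_f q) qY = 0"
  proof (rule high_degree_action_trivial[OF q0 qn, where K' = "?T (uq_kinv q)"])
    show "qpoly_endo q (?T (uq_k q))" "qpoly_endo q (?T (uq_kinv q))"
      using Lb kinv kinv1 by (intro in_coords_endo act_lin; simp)+
    show "?T (uq_e q) (qmul q p r) = qmul q p (?T (uq_e q) r) + qmul q (?T (uq_e q) p) (?T (uq_k q) r)"
      "?T (uq_f q) (qmul q p r) = qmul q (?T (uq_f q) p) r + qmul q (?T (uq_kinv q) p) (?T (uq_f q) r)"
      for p r
      using Lb elem by (simp_all add: in_coords_def qp_elem_simps coords_simps)
    show "?T (uq_e q) (single 0 1) = 0" "?T (uq_f q) (single 0 1) = 0"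
      using Lb by (simp_all add: in_coords_def qp_elem_simps)
    show "high_degree (?T (uq_e q) qX)" "high_degree (?T (uq_e q) qY)"
      "high_degree (?T (uq_f q) qX)" "high_degree (?T (uq_f q) qY)"
      using low unfolding in_coords_gens by (simp_all add: high_degree_coords_iff)
  qed (simp_all add: in_coords_lin act_lin comp elem acts coords_simps coords_minus
      flip: coords_minus, simp_all add: in_coords_def acts elem coords_simps coords_minus)
  then show ?thesis
    unfolding diagonal_values_def in_coords_gens
    using coords_eq_scale_gens coords_eq_iff[OF _ A.zero_closed] by simp
qed

lemma diagonal_structure_exists:
  assumes "\<sigma> \<in> {1, -1}" "\<tau> \<in> {1, -1}"
  shows "\<exists>\<pi>. \<pi> \<in> module_alg_structures (Uq_sl2 q) plane \<and> diagonal_values q \<sigma> \<tau> \<pi>"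
proof -
  interpret End: calg "End_alg plane" by (rule A.End_calg)
  have "\<exists>D\<in>alg_hom plane plane. D (qp_x q) = \<sigma> \<odot>\<^bsub>plane\<^esub> qp_x q \<and> D (qp_y q) = \<tau> \<odot>\<^bsub>plane\<^esub> qp_y q"
    by (rule qp_hom_exists[OF A.calg_axioms])
      (simp_all add: A.smult_mult_left A.smult_mult_right A.smult_smult qp_yx mult_ac)
  then obtain D where D: "D \<in> alg_hom plane plane" "D (qp_x q) = \<sigma> \<odot>\<^bsub>plane\<^esub> qp_x q" "D (qp_y q) = \<tau> \<odot>\<^bsub>plane\<^esub> qp_y q"
    by blast
  have D_End: "D \<in> carrier (End_alg plane)" using D(1) by (simp add: End_carrier_iff alg_hom_iff)
  note Dlin = lin_mapD[OF alg_homD(1)[OF D(1)]] and Dmult = alg_homD(2,3)[OF D(1)]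
  have signs: "\<sigma> * \<sigma> = 1" "\<tau> * \<tau> = 1" using assms by auto
  have DD: "D (D a) = a" if "a \<in> carrier plane" for a
    using that by (induction rule: qp_induct) (simp_all add: D Dlin Dmult A.smult_smult signs)
  have "D \<otimes>\<^bsub>End_alg plane\<^esub> D = \<one>\<^bsub>End_alg plane\<^esub>" by (auto simp: End_simps DD intro!: restrict_ext)
  then have "uq_equations q (End_alg plane) D D \<zero>\<^bsub>End_alg plane\<^esub> \<zero>\<^bsub>End_alg plane\<^esub>"
    using D_End by (simp add: uq_equations_def End.minus_eq_zero_iff End.r_neg a_minus_def)
  then obtain \<pi> where \<pi>: "\<pi> \<in> alg_hom (uq_alg q) (End_alg plane)" "\<pi> (uq_k q) = D" "\<pi> (uq_kinv q) = D"
      "\<pi> (uq_e q) = \<zero>\<^bsub>End_alg plane\<^esub>" "\<pi> (uq_f q) = \<zero>\<^bsub>End_alg plane\<^esub>"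
    using uq_hom_exists[OF A.End_calg D_End D_End End.zero_closed End.zero_closed] by blast
  have "skew_leibniz q plane \<pi>"
    by (simp add: skew_leibniz_def \<pi>(2-5) Dmult Dlin End_simps(2))
  then have "\<pi> \<in> module_alg_structures (Uq_sl2 q) plane"
    by (simp add: module_alg_structures_Uq_iff[OF q0 A.calg_axioms] \<pi>(1))
  moreover have "diagonal_values q \<sigma> \<tau> \<pi>"
    by (simp add: diagonal_values_def \<pi>(2-5) D End_simps(2))
  ultimately show ?thesis by blast
qed

text \<open>
  The automorphism \<open>k\<close> is determined by its values at the generators, and a skew derivation that
  vanishes at the generators is 0.
\<close>

lemma diagonal_structure_unique:
  assumes "\<pi>\<^sub>1 \<in> module_alg_structures (Uq_sl2 q) plane" "diagonal_values q \<sigma> \<tau> \<pi>\<^sub>1"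
    and "\<pi>\<^sub>2 \<in> module_alg_structures (Uq_sl2 q) plane" "diagonal_values q \<sigma> \<tau> \<pi>\<^sub>2"
  shows "\<pi>\<^sub>1 = \<pi>\<^sub>2"
proof -
  have k_hom: "\<pi> (uq_k q) \<in> alg_hom plane plane" and zero: "\<And>a. a \<in> carrier plane \<Longrightarrow> \<pi> (uq_e q) a = \<zero>\<^bsub>plane\<^esub>"
      "\<And>a. a \<in> carrier plane \<Longrightarrow> \<pi> (uq_f q) a = \<zero>\<^bsub>plane\<^esub>"
    if "\<pi> \<in> module_alg_structures (Uq_sl2 q) plane" "diagonal_values q \<sigma> \<tau> \<pi>" for \<pi>
  proof -
    interpret uq_action q plane \<pi> using that(1) structures_iff by blast
    have Lb: "skew_leibniz q plane \<pi>" using that(1) structures_iff by blast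
    note Lb = Lb[unfolded skew_leibniz_def] and val = that(2)[unfolded diagonal_values_def]
    show "\<pi> (uq_k q) \<in> alg_hom plane plane"
      using Lb act_End[of "uq_k q"] by (simp add: alg_hom_iff End_carrier_iff)
    show "\<pi> (uq_e q) a = \<zero>\<^bsub>plane\<^esub>" if "a \<in> carrier plane" for a
      using that by (induction rule: qp_induct) (use Lb val in \<open>simp_all add: act_simps\<close>)
    show "\<pi> (uq_f q) a = \<zero>\<^bsub>plane\<^esub>" if "a \<in> carrier plane" for a
      using that by (induction rule: qp_induct) (use Lb val in \<open>simp_all add: act_simps\<close>)
  qed
  have hom: "\<pi>\<^sub>1 \<in> alg_hom (uq_alg q) (End_alg plane)" "\<pi>\<^sub>2 \<in> alg_hom (uq_alg q) (End_alg plane)"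
    using assms(1,3) by (simp_all add: module_alg_structures_Uq_iff[OF q0 A.calg_axioms])
  note End = lin_mapD(1)[OF alg_homD(1)[OF hom(1)]] lin_mapD(1)[OF alg_homD(1)[OF hom(2)]]
  show ?thesis
  proof (rule uq_hom_eqI[OF hom A.End_calg])
    show "\<pi>\<^sub>1 (uq_k q) = \<pi>\<^sub>2 (uq_k q)"
      using assms(2,4) by (intro qp_hom_eqI[OF k_hom[OF assms(1,2)] k_hom[OF assms(3,4)]])
        (simp_all add: diagonal_values_def)
    show "\<pi>\<^sub>1 (uq_e q) = \<pi>\<^sub>2 (uq_e q)" "\<pi>\<^sub>1 (uq_f q) = \<pi>\<^sub>2 (uq_f q)"
      by (intro A.End_eqI End uq_gens_closed; simp add: zero[OF assms(1,2)] zero[OF assms(3,4)])+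
  qed
qed

lemma zero_zero_structures_eq:
  "zero_zero_structures q = {\<pi> \<in> module_alg_structures (Uq_sl2 q) plane.
     \<exists>\<sigma>\<in>{1, -1}. \<exists>\<tau>\<in>{1, -1}. diagonal_values q \<sigma> \<tau> \<pi>}"
proof -
  have "qp_proj q i \<zero>\<^bsub>plane\<^esub> = \<zero>\<^bsub>plane\<^esub>" for i
    using qp_proj_eq_zero_iff[OF A.zero_closed] by simp
  then have "\<pi> \<in> zero_zero_structures q"
    if "\<pi> \<in> module_alg_structures (Uq_sl2 q) plane" "diagonal_values q \<sigma> \<tau> \<pi>" for \<pi> \<sigma> \<tau>
    using that by (auto simp: zero_zero_structures_def diagonal_values_def)
  moreover have "zero_zero_structures q \<subseteq> module_alg_structures (Uq_sl2 q) plane"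
    by (auto simp: zero_zero_structures_def)
  ultimately show ?thesis using zero_zero_diagonal by blast
qed

lemma alg_aut_diagonal:
  assumes "\<Psi> \<in> alg_aut plane"
  shows "\<exists>\<alpha> \<beta>. \<alpha> \<noteq> 0 \<and> \<beta> \<noteq> 0 \<and> \<Psi> (qp_x q) = \<alpha> \<odot>\<^bsub>plane\<^esub> qp_x q \<and> \<Psi> (qp_y q) = \<beta> \<odot>\<^bsub>plane\<^esub> qp_y q"
proof -
  let ?\<Phi> = "inv_into (carrier plane) \<Psi>"
  have hom: "\<Psi> \<in> alg_hom plane plane" and bij: "bij_betw \<Psi> (carrier plane) (carrier plane)"
    using assms by (auto simp: alg_aut_def)
  have \<Psi>\<Phi>: "\<Psi> (?\<Phi> a) = a" and \<Phi>: "?\<Phi> a \<in> carrier plane" if "a \<in> carrier plane" for a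
    using bij that by (auto simp: bij_betw_def f_inv_into_f inv_into_into)
  have \<Phi>I: "?\<Phi> b = a" if "a \<in> carrier plane" "\<Psi> a = b" for a b
    using bij that by (auto simp: bij_betw_def inv_into_f_eq)
  note lin = lin_mapD[OF alg_homD(1)[OF hom]] and mult = alg_homD(2,3)[OF hom]
  have \<Phi>lin: "lin_map plane plane ?\<Phi>"
    unfolding lin_map_def by (auto intro!: \<Phi>I simp: \<Phi> \<Psi>\<Phi> lin)
  have "\<exists>\<alpha> \<beta>. \<alpha> \<noteq> 0 \<and> \<beta> \<noteq> 0 \<and> in_coords \<Psi> qX = scale \<alpha> qX \<and> in_coords \<Psi> qY = scale \<beta> qY"
  proof (rule qpoly_automorphism_diagonal[OF q0 qn])
    show "qpoly_endo q (in_coords \<Psi>)" by (rule in_coords_endo[OF alg_homD(1)[OF hom]]) (simp_all add: mult)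
    show "qpoly_endo q (in_coords ?\<Phi>)"
      by (rule in_coords_endo[OF \<Phi>lin]) (auto intro!: \<Phi>I simp: \<Phi> \<Psi>\<Phi> mult)
    show "in_coords \<Psi> (in_coords ?\<Phi> p) = p" for p
      using in_coords_comp[OF \<Phi>lin] by (simp add: \<Psi>\<Phi> qp_elem_simps)
  qed
  then show ?thesis
    unfolding in_coords_gens using coords_eq_scale_gens lin by simp
qed

text \<open>
  The generators are eigenvectors of every automorphism \<open>\<Psi>\<close>, so conjugation by \<open>\<Psi>\<close> does not change
  the eigenvalues of \<open>k\<close> at them.
\<close>

lemma isomorphic_same_signs:
  assumes iso: "isomorphic_structures (Uq_sl2 q) plane \<pi>\<^sub>1 \<pi>\<^sub>2"
    and \<pi>\<^sub>1: "\<pi>\<^sub>1 \<in> module_alg_structures (Uq_sl2 q) plane"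
    and "diagonal_values q \<sigma> \<tau> \<pi>\<^sub>1" "diagonal_values q \<sigma>' \<tau>' \<pi>\<^sub>2"
  shows "\<sigma> = \<sigma>'" "\<tau> = \<tau>'"
proof -
  interpret uq_action q plane \<pi>\<^sub>1 using \<pi>\<^sub>1 structures_iff by blast
  have act: "lin_map plane plane (\<pi>\<^sub>1 (uq_k q))" by (simp add: act_lin)
  obtain \<Psi> where \<Psi>: "\<Psi> \<in> alg_aut plane"
    and conj: "\<And>h a. h \<in> carrier (uq_alg q) \<Longrightarrow> a \<in> carrier plane \<Longrightarrow>
      \<Psi> (\<pi>\<^sub>1 h (inv_into (carrier plane) \<Psi> a)) = \<pi>\<^sub>2 h a"
    using iso unfolding isomorphic_structures_def Uq_simps by blast
  have hom: "\<Psi> \<in> alg_hom plane plane" and bij: "bij_betw \<Psi> (carrier plane) (carrier plane)"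
    using \<Psi> by (auto simp: alg_aut_def)
  note lin = lin_mapD[OF alg_homD(1)[OF hom]]
  obtain \<alpha> \<beta> where diag: "\<alpha> \<noteq> 0" "\<beta> \<noteq> 0" "\<Psi> (qp_x q) = \<alpha> \<odot>\<^bsub>plane\<^esub> qp_x q" "\<Psi> (qp_y q) = \<beta> \<odot>\<^bsub>plane\<^esub> qp_y q"
    using alg_aut_diagonal[OF \<Psi>] by blast
  have eq: "c = c'"
    if z: "z \<in> carrier plane" "z \<noteq> \<zero>\<^bsub>plane\<^esub>" "\<Psi> z = \<gamma> \<odot>\<^bsub>plane\<^esub> z" "\<gamma> \<noteq> 0"
      and k: "\<pi>\<^sub>1 (uq_k q) z = c \<odot>\<^bsub>plane\<^esub> z" "\<pi>\<^sub>2 (uq_k q) z = c' \<odot>\<^bsub>plane\<^esub> z" for z \<gamma> c c'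
  proof -
    have "inv_into (carrier plane) \<Psi> z = (1 / \<gamma>) \<odot>\<^bsub>plane\<^esub> z"
      using bij_betw_imp_inj_on[OF bij] z
      by (intro inv_into_f_eq) (simp_all add: lin A.smult_smult)
    then have "c' \<odot>\<^bsub>plane\<^esub> z = \<Psi> (\<pi>\<^sub>1 (uq_k q) ((1 / \<gamma>) \<odot>\<^bsub>plane\<^esub> z))"
      using conj[OF uq_gens_closed(1) z(1)] k(2) by simp
    also have "\<dots> = c \<odot>\<^bsub>plane\<^esub> z"
      using z k(1) by (simp add: lin_mapD(3)[OF act] lin A.smult_smult)
    finally show ?thesis using A.smult_inj[OF z(1,2)] by simp
  qed
  show "\<sigma> = \<sigma>'" "\<tau> = \<tau>'"
    using eq[OF qp_gens_closed(1) qp_gens_nonzero(1) diag(3,1)]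
      eq[OF qp_gens_closed(2) qp_gens_nonzero(2) diag(4,2)] assms(3,4)
    by (simp_all add: diagonal_values_def)
qed

end

end

theorem theorem8:
  fixes q :: complex
  assumes "q \<noteq> 0" and "\<And>n::nat. n > 0 \<Longrightarrow> q ^ n \<noteq> 1"
  shows "(\<forall>\<sigma>\<in>{1, -1}. \<forall>\<tau>\<in>{1, -1}.
            \<exists>!\<pi>. \<pi> \<in> module_alg_structures (Uq_sl2 q) (quantum_plane q) \<and> diagonal_values q \<sigma> \<tau> \<pi>) \<and>
         zero_zero_structures q =
           {\<pi> \<in> module_alg_structures (Uq_sl2 q) (quantum_plane q).
              \<exists>\<sigma>\<in>{1, -1}. \<exists>\<tau>\<in>{1, -1}. diagonal_values q \<sigma> \<tau> \<pi>} \<and>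
         card (zero_zero_structures q) = 4 \<and>
         (\<forall>\<pi>\<^sub>1\<in>zero_zero_structures q. \<forall>\<pi>\<^sub>2\<in>zero_zero_structures q. \<pi>\<^sub>1 \<noteq> \<pi>\<^sub>2 \<longrightarrow>
            \<not> isomorphic_structures (Uq_sl2 q) (quantum_plane q) \<pi>\<^sub>1 \<pi>\<^sub>2)"
proof (intro conjI)
  let ?M = "module_alg_structures (Uq_sl2 q) (quantum_plane q)"
  let ?S = "{1, -1} :: complex set"
  note unique = diagonal_structure_unique[OF assms]
  show ex1: "\<forall>\<sigma>\<in>?S. \<forall>\<tau>\<in>?S. \<exists>!\<pi>. \<pi> \<in> ?M \<and> diagonal_values q \<sigma> \<tau> \<pi>"
  proof (intro ballI ex_ex1I)
    show "\<exists>\<pi>. \<pi> \<in> ?M \<and> diagonal_values q \<sigma> \<tau> \<pi>" if "\<sigma> \<in> ?S" "\<tau> \<in> ?S" for \<sigma> \<tau>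
      using diagonal_structure_exists[OF assms that] .
  qed (use unique in blast)
  show eq: "zero_zero_structures q = {\<pi> \<in> ?M. \<exists>\<sigma>\<in>?S. \<exists>\<tau>\<in>?S. diagonal_values q \<sigma> \<tau> \<pi>}"
    by (rule zero_zero_structures_eq[OF assms])
  define str where "str s = (THE \<pi>. \<pi> \<in> ?M \<and> diagonal_values q (fst s) (snd s) \<pi>)" for s
  have str: "str s \<in> ?M" "diagonal_values q (fst s) (snd s) (str s)" if "s \<in> ?S \<times> ?S" for s
  proof -
    have "\<exists>!\<pi>. \<pi> \<in> ?M \<and> diagonal_values q (fst s) (snd s) \<pi>" using ex1 that by auto
    from theI'[OF this] show "str s \<in> ?M" "diagonal_values q (fst s) (snd s) (str s)"
      unfolding str_def by blast+
  qed
  have "inj_on str (?S \<times> ?S)"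
  proof (rule inj_onI)
    fix s s' assume s: "s \<in> ?S \<times> ?S" "s' \<in> ?S \<times> ?S" "str s = str s'"
    show "s = s'"
      using diagonal_values_inj[OF str(2)[OF s(1)] str(2)[OF s(2), folded s(3)]]
      by (simp add: prod_eq_iff)
  qed
  moreover have "zero_zero_structures q = str ` (?S \<times> ?S)"
  proof
    show "zero_zero_structures q \<subseteq> str ` (?S \<times> ?S)"
    proof
      fix \<pi> assume "\<pi> \<in> zero_zero_structures q"
      then obtain \<sigma> \<tau> where \<pi>: "\<pi> \<in> ?M" "\<sigma> \<in> ?S" "\<tau> \<in> ?S" "diagonal_values q \<sigma> \<tau> \<pi>"
        unfolding eq by blast
      then have "\<pi> = str (\<sigma>, \<tau>)"
        using str[of "(\<sigma>, \<tau>)"] unique by (metis SigmaI fst_conv snd_conv)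
      then show "\<pi> \<in> str ` (?S \<times> ?S)" using \<pi> by blast
    qed
    show "str ` (?S \<times> ?S) \<subseteq> zero_zero_structures q"
      unfolding eq using str by fastforce
  qed
  moreover have "(1 :: complex) \<noteq> -1" by simp
  then have "card (?S \<times> ?S) = 4" by (simp add: card_cartesian_product)
  ultimately show "card (zero_zero_structures q) = 4" by (simp add: card_image)
  show "\<forall>\<pi>\<^sub>1\<in>zero_zero_structures q. \<forall>\<pi>\<^sub>2\<in>zero_zero_structures q. \<pi>\<^sub>1 \<noteq> \<pi>\<^sub>2 \<longrightarrow>
      \<not> isomorphic_structures (Uq_sl2 q) (quantum_plane q) \<pi>\<^sub>1 \<pi>\<^sub>2"
  proof (intro ballI impI notI)
    fix \<pi>\<^sub>1 \<pi>\<^sub>2 assume \<pi>: "\<pi>\<^sub>1 \<in> zero_zero_structures q" "\<pi>\<^sub>2 \<in> zero_zero_structures q" "\<pi>\<^sub>1 \<noteq> \<pi>\<^sub>2"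
      and iso: "isomorphic_structures (Uq_sl2 q) (quantum_plane q) \<pi>\<^sub>1 \<pi>\<^sub>2"
    obtain \<sigma> \<tau> \<sigma>' \<tau>' where "\<pi>\<^sub>1 \<in> ?M" "diagonal_values q \<sigma> \<tau> \<pi>\<^sub>1" "\<pi>\<^sub>2 \<in> ?M" "diagonal_values q \<sigma>' \<tau>' \<pi>\<^sub>2"
      using \<pi>(1,2) unfolding eq by blast
    with isomorphic_same_signs[OF assms iso] unique \<pi>(3) show False by metis
  qed
qed

end
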